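(* Let $0\le t<T$, $k\ge 2$ and $i_1,\ldots,i_k\in\{0,1,\ldots,m\}$. Suppose that $\xi_\tau\in\mathrm{S}_2([t,T])$ and that $\Phi(t_1,\ldots,t_{k-1})$ is a continuous nonrandom function on the closed domain $\{(t_1,\ldots,t_{k-1}):\ t\le t_{k-1}\le\ldots\le t_1\le T\}$. Then the stochastic integral $\hat J[\xi,\Phi]^{(k)}_{T,t}$ exists and $$J[\xi,\Phi]^{(k)}_{T,t}=\hat J[\xi,\Phi]^{(k)}_{T,t}\quad\text{with probability }1.$$
   Context: Setting. $(\Omega,\mathrm{F},\mathsf{P})$ is a complete probability space, $\mathsf{M}$ denotes expectation, $\mathbf{f}^{(i)}_\tau$ $(i=1,\ldots,m)$, $\tau\in[0,T]$, are independent standard real Wiener processes, and $\{\mathrm{F}_\tau,\ \tau\in[0,T]\}$ is a family of $\sigma$-algebras with $\mathrm{F}_s\subset\mathrm{F}_\tau\subset\mathrm{F}$ for $s<\tau$, such that all $\mathbf{f}^{(i)}_\tau$ are $\mathrm{F}_\tau$-measurable and the increments $\mathbf{f}^{(i)}_{\tau+\Delta}-\mathbf{f}^{(i)}_\tau$ $(i=1,\ldots,m)$ are jointly independent of $\mathrm{F}_\tau$ for all $\tau\ge0$, $\Delta>0$. Put $\mathbf{w}^{(i)}_\tau=\mathbf{f}^{(i)}_\tau$ for $i=1,\ldots,m$ and $\mathbf{w}^{(0)}_\tau=\tau$. Class $\mathrm{M}_2([t,T])$: functions $\xi:[t,T]\times\Omega\to\mathbb{R}$ that are jointly measurable, $\mathrm{F}_\tau$-measurable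 for each $\tau\in[t,T]$ (with $\xi(\tau,\cdot)$ independent of the increments of the Wiener processes after time $\tau$), with $\int_t^T\mathsf{M}\{\xi(\tau,\omega)^2\}d\tau<\infty$ and $\mathsf{M}\{\xi(\tau,\omega)^2\}<\infty$ for all $\tau\in[t,T]$. Class $\mathrm{S}_2([t,T])$: those $\xi\in\mathrm{M}_2([t,T])$ that are mean-square continuous on $[t,T]$. Iterated Ito integral. $$J[\xi,\Phi]^{(k)}_{T,t}=\int_t^T\ldots\int_t^{t_{k-1}}\Phi(t_1,\ldots,t_{k-1})\,\xi_{t_k}\,d\mathbf{w}^{(i_k)}_{t_k}\ldots d\mathbf{w}^{(i_1)}_{t_1},$$ the innermost integration being over $t_k\in[t,t_{k-1}]$ and the outermost over $t_1\in[t,T]$ (usual Ito integrals for $i_j\ne0$, mean-square integrals with respect to time for $i_j=0$). Reversed-order integrals. All limits $\mathrm{l.i.m.}$ are mean-square limits along partitions $s=\tau_0<\tau_1<\ldots<\tau_N=T$ of the relevant interval $[s,T]$ with mesh tending to $0$ as $N\to\infty$, and $\Delta\mathbf{w}^{(i)}_{\tau_l}=\mathbf{w}^{(i)}_{\tau_{l+1}}-\mathbf{w}^{(i)}_{\tau_l}$. Define $$A_1(s;t_2,\ldots,t_{k-1})=\int_s^T\Phi(t_1,t_2,\ldots,t_{k-1})\,d\mathbf{w}^{(i_1)}_{t_1},$$ and for $2\le r\le k-1$, $$A_r(s;t_{r+1},\ldots,t_{k-1})=\underset{N\to\infty}{\mathrm{l.i.m.}}\ \sum_{l=0}^{N-1}\Delta\mathbf{w}^{(i_r)}_{\tau_l}\,A_{r-1}(\tau_{l+1};\tau_l,t_{r+1},\ldots,t_{k-1})$$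 with $\{\tau_l\}$ partitioning $[s,T]$ and $t\le t_{k-1}\le\ldots\le t_{r+1}\le s\le T$; $A_r(s;t_{r+1},\ldots,t_{k-1})$ is the meaning of $\int_s^Td\mathbf{w}^{(i_r)}_{t_r}\int_{t_r}^T d\mathbf{w}^{(i_{r-1})}_{t_{r-1}}\ldots\int_{t_2}^T\Phi(t_1,\ldots,t_{k-1})d\mathbf{w}^{(i_1)}_{t_1}$. Then $$\hat J[\xi,\Phi]^{(k)}_{T,t}=\int_t^T\xi_{t_k}d\mathbf{w}^{(i_k)}_{t_k}\ldots\int_{t_3}^Td\mathbf{w}^{(i_2)}_{t_2}\int_{t_2}^T\Phi(t_1,\ldots,t_{k-1})d\mathbf{w}^{(i_1)}_{t_1}:=\underset{N\to\infty}{\mathrm{l.i.m.}}\ \sum_{l=0}^{N-1}\xi_{\tau_l}\,\Delta\mathbf{w}^{(i_k)}_{\tau_l}\,A_{k-1}(\tau_{l+1})$$ with $\{\tau_l\}$ partitioning $[t,T]$. Existence of $\hat J$ means existence of the mean-square limits in this definition. *)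

theory Defs
  imports "HOL-Probability.Probability"
begin

subsection \<open>Mean-square limits along partitions\<close>

definition square_integrable :: "'a measure \<Rightarrow> ('a \<Rightarrow> real) \<Rightarrow> bool" where
  "square_integrable M X \<longleftrightarrow> X \<in> borel_measurable M \<and> integrable M (\<lambda>\<omega>. (X \<omega>)\<^sup>2)"

definition ms_limit :: "'a measure \<Rightarrow> (nat \<Rightarrow> 'a \<Rightarrow> real) \<Rightarrow> ('a \<Rightarrow> real) \<Rightarrow> bool" where
  "ms_limit M S X \<longleftrightarrow>
     (\<forall>n. square_integrable M (S n)) \<and> square_integrable M X \<and>
     (\<lambda>n. \<integral>\<omega>. (S n \<omega> - X \<omega>)\<^sup>2 \<partial>M) \<longlonglongrightarrow> 0"

text \<open>
  A partition of \<open>[a,b]\<close> is given by the number \<open>N\<close> of its subintervals and its points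
  \<open>\<tau> 0, \<dots>, \<tau> N\<close>. For \<open>a = b\<close> only \<open>N = 0\<close> is possible, so that all integral sums over a
  degenerate interval vanish.
\<close>

definition is_partition :: "real \<Rightarrow> real \<Rightarrow> nat \<Rightarrow> (nat \<Rightarrow> real) \<Rightarrow> bool" where
  "is_partition a b N \<tau> \<longleftrightarrow> \<tau> 0 = a \<and> \<tau> N = b \<and> (\<forall>l<N. \<tau> l < \<tau> (Suc l))"

definition refining_partitions ::
    "real \<Rightarrow> real \<Rightarrow> (nat \<Rightarrow> nat) \<Rightarrow> (nat \<Rightarrow> nat \<Rightarrow> real) \<Rightarrow> bool" where
  "refining_partitions a b N \<tau> \<longleftrightarrow>
     (\<forall>n. is_partition a b (N n) (\<tau> n)) \<and>
     (\<forall>\<delta>>0. \<forall>\<^sub>F n in sequentially. \<forall>l<N n. \<tau> n (Suc l) - \<tau> n l < \<delta>)"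

definition has_partition_limit ::
    "'a measure \<Rightarrow> real \<Rightarrow> real \<Rightarrow> (nat \<Rightarrow> (nat \<Rightarrow> real) \<Rightarrow> 'a \<Rightarrow> real) \<Rightarrow> ('a \<Rightarrow> real) \<Rightarrow> bool" where
  "has_partition_limit M a b S X \<longleftrightarrow>
     (\<forall>N \<tau>. refining_partitions a b N \<tau> \<longrightarrow> ms_limit M (\<lambda>n. S (N n) (\<tau> n)) X)"


subsection \<open>Wiener processes and the filtration\<close>

definition standard_wiener :: "'a measure \<Rightarrow> real \<Rightarrow> (real \<Rightarrow> 'a \<Rightarrow> real) \<Rightarrow> bool" where
  "standard_wiener M T W \<longleftrightarrow>
     (\<forall>\<tau>\<in>{0..T}. W \<tau> \<in> borel_measurable M) \<and>
     (AE \<omega> in M. W 0 \<omega> = 0) \<and>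
     (AE \<omega> in M. continuous_on {0..T} (\<lambda>\<tau>. W \<tau> \<omega>)) \<and>
     (\<forall>u v. 0 \<le> u \<and> u < v \<and> v \<le> T \<longrightarrow>
        distributed M lborel (\<lambda>\<omega>. W v \<omega> - W u \<omega>) (\<lambda>x. ennreal (normal_density 0 (sqrt (v - u)) x))) \<and>
     (\<forall>n u. mono_on {..n} u \<and> u ` {..n} \<subseteq> {0..T} \<longrightarrow>
        prob_space.indep_vars M (\<lambda>_. borel) (\<lambda>l \<omega>. W (u (Suc l)) \<omega> - W (u l) \<omega>) {..<n})"

definition increments :: "(nat \<Rightarrow> real \<Rightarrow> 'a \<Rightarrow> real) \<Rightarrow> nat \<Rightarrow> real \<Rightarrow> real \<Rightarrow> 'a \<Rightarrow> nat \<Rightarrow> real" where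
  "increments f m u v \<omega> = (\<lambda>i\<in>{1..m}. f i v \<omega> - f i u \<omega>)"

definition increment_events ::
    "'a measure \<Rightarrow> (nat \<Rightarrow> real \<Rightarrow> 'a \<Rightarrow> real) \<Rightarrow> nat \<Rightarrow> real \<Rightarrow> real \<Rightarrow> 'a set set" where
  "increment_events M f m u v =
     {increments f m u v -` A \<inter> space M |A. A \<in> sets (PiM {1..m} (\<lambda>_. borel))}"

text \<open>
  The filtration \<open>F\<close> is neither assumed to be right-continuous nor to contain the null sets of \<open>M\<close>.
\<close>

locale wiener_setting = prob_space M + complete_measure M
  for M :: "'a measure" +
  fixes F :: "real \<Rightarrow> 'a measure"
    and f :: "nat \<Rightarrow> real \<Rightarrow> 'a \<Rightarrow> real"
    and m :: nat
    and T :: real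
  assumes space_filtration: "\<tau> \<in> {0..T} \<Longrightarrow> space (F \<tau>) = space M"
    and sets_filtration: "\<tau> \<in> {0..T} \<Longrightarrow> sets (F \<tau>) \<subseteq> sets M"
    and filtration_mono: "0 \<le> s \<Longrightarrow> s < \<tau> \<Longrightarrow> \<tau> \<le> T \<Longrightarrow> sets (F s) \<subseteq> sets (F \<tau>)"
    and wiener: "i \<in> {1..m} \<Longrightarrow> standard_wiener M T (f i)"
    and wiener_indep:
      "indep_vars (\<lambda>_. PiM {0..T} (\<lambda>_. borel)) (\<lambda>i \<omega>. \<lambda>\<tau>\<in>{0..T}. f i \<tau> \<omega>) {1..m}"
    and wiener_adapted: "i \<in> {1..m} \<Longrightarrow> \<tau> \<in> {0..T} \<Longrightarrow> f i \<tau> \<in> borel_measurable (F \<tau>)"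
    and increments_indep:
      "0 \<le> \<tau> \<Longrightarrow> 0 < \<Delta> \<Longrightarrow> \<tau> + \<Delta> \<le> T \<Longrightarrow>
       indep_set (sets (F \<tau>)) (increment_events M f m \<tau> (\<tau> + \<Delta>))"

definition integrator :: "(nat \<Rightarrow> real \<Rightarrow> 'a \<Rightarrow> real) \<Rightarrow> nat \<Rightarrow> real \<Rightarrow> 'a \<Rightarrow> real" where
  "integrator f i \<tau> \<omega> = (if i = 0 then \<tau> else f i \<tau> \<omega>)"


subsection \<open>Classes of integrands\<close>

definition class_M2 ::
    "'a measure \<Rightarrow> (real \<Rightarrow> 'a measure) \<Rightarrow> (nat \<Rightarrow> real \<Rightarrow> 'a \<Rightarrow> real) \<Rightarrow> nat \<Rightarrow> real \<Rightarrow> real \<Rightarrow>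
     (real \<Rightarrow> 'a \<Rightarrow> real) set" where
  "class_M2 M F f m t T = {\<xi>.
     (\<lambda>(\<tau>, \<omega>). \<xi> \<tau> \<omega>) \<in> borel_measurable (restrict_space borel {t..T} \<Otimes>\<^sub>M M) \<and>
     (\<forall>\<tau>\<in>{t..T}. \<xi> \<tau> \<in> borel_measurable (F \<tau>)) \<and>
     (\<forall>\<tau> u v. t \<le> \<tau> \<and> \<tau> \<le> u \<and> u < v \<and> v \<le> T \<longrightarrow>
        prob_space.indep_set M {\<xi> \<tau> -` B \<inter> space M |B. B \<in> sets borel} (increment_events M f m u v)) \<and>
     (\<forall>\<tau>\<in>{t..T}. square_integrable M (\<xi> \<tau>)) \<and>
     set_integrable lborel {t..T} (\<lambda>\<tau>. \<integral>\<omega>. (\<xi> \<tau> \<omega>)\<^sup>2 \<partial>M)}"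

definition class_S2 ::
    "'a measure \<Rightarrow> (real \<Rightarrow> 'a measure) \<Rightarrow> (nat \<Rightarrow> real \<Rightarrow> 'a \<Rightarrow> real) \<Rightarrow> nat \<Rightarrow> real \<Rightarrow> real \<Rightarrow>
     (real \<Rightarrow> 'a \<Rightarrow> real) set" where
  "class_S2 M F f m t T = {\<xi> \<in> class_M2 M F f m t T.
     \<forall>\<tau>\<in>{t..T}. ((\<lambda>s. \<integral>\<omega>. (\<xi> s \<omega> - \<xi> \<tau> \<omega>)\<^sup>2 \<partial>M) \<longlongrightarrow> 0) (at \<tau> within {t..T})}"


subsection \<open>Stochastic integrals\<close>

text \<open>
  All integrals are relations between an integrand and a random variable, since their values are
  determined only up to null sets.

  The Ito integral is the mean-square limit of the integrals of adapted step processes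
  \<open>\<eta> n\<close> (equal to \<open>\<eta> n l\<close> on \<open>[\<tau> n l, \<tau> n (l + 1))\<close>) that approximate \<open>H\<close> in the sense that
  \<open>\<integral> E(H_n(s) - H(s))^2 ds\<close> tends to 0. This is insensitive to replacing each \<open>H s\<close> by an
  almost surely equal random variable. Therefore no joint measurability or adaptedness
  of \<open>H\<close> itself is demanded: an inner integral of an iterated integral is a process whose
  value at each time is an arbitrary representative modulo null sets.
\<close>

definition step_process :: "nat \<Rightarrow> (nat \<Rightarrow> real) \<Rightarrow> (nat \<Rightarrow> 'a \<Rightarrow> real) \<Rightarrow> real \<Rightarrow> 'a \<Rightarrow> real" where
  "step_process N \<tau> \<eta> s \<omega> = (\<Sum>l<N. indicator {\<tau> l..<\<tau> (Suc l)} s * \<eta> l \<omega>)"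

definition has_ito_integral ::
    "'a measure \<Rightarrow> (real \<Rightarrow> 'a measure) \<Rightarrow> (real \<Rightarrow> 'a \<Rightarrow> real) \<Rightarrow> real \<Rightarrow> real \<Rightarrow>
     (real \<Rightarrow> 'a \<Rightarrow> real) \<Rightarrow> ('a \<Rightarrow> real) \<Rightarrow> bool" where
  "has_ito_integral M F W a b H X \<longleftrightarrow>
     (\<forall>s\<in>{a..b}. square_integrable M (H s)) \<and>
     (\<exists>N \<tau> \<eta>.
        (\<forall>n. is_partition a b (N n) (\<tau> n)) \<and>
        (\<forall>n. \<forall>l<N n. \<eta> n l \<in> borel_measurable (F (\<tau> n l)) \<and> square_integrable M (\<eta> n l)) \<and>
        (\<forall>n. set_integrable lborel {a..b}
               (\<lambda>s. \<integral>\<omega>. (step_process (N n) (\<tau> n) (\<eta> n) s \<omega> - H s \<omega>)\<^sup>2 \<partial>M)) \<and>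
        (\<lambda>n. LINT s:{a..b}|lborel.
               (\<integral>\<omega>. (step_process (N n) (\<tau> n) (\<eta> n) s \<omega> - H s \<omega>)\<^sup>2 \<partial>M)) \<longlonglongrightarrow> 0 \<and>
        ms_limit M (\<lambda>n \<omega>. \<Sum>l<N n. \<eta> n l \<omega> * (W (\<tau> n (Suc l)) \<omega> - W (\<tau> n l) \<omega>)) X)"

text \<open>
  The mean-square integral with respect to time: the mean-square limit of Riemann sums, with
  arbitrary intermediate points.
\<close>

definition has_ms_integral ::
    "'a measure \<Rightarrow> real \<Rightarrow> real \<Rightarrow> (real \<Rightarrow> 'a \<Rightarrow> real) \<Rightarrow> ('a \<Rightarrow> real) \<Rightarrow> bool" where
  "has_ms_integral M a b H X \<longleftrightarrow>
     (\<forall>N \<tau> \<sigma>. refining_partitions a b N \<tau> \<and>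
        (\<forall>n. \<forall>l<N n. \<sigma> n l \<in> {\<tau> n l..\<tau> n (Suc l)}) \<longrightarrow>
        ms_limit M (\<lambda>n \<omega>. \<Sum>l<N n. H (\<sigma> n l) \<omega> * (\<tau> n (Suc l) - \<tau> n l)) X)"

definition has_stochastic_integral ::
    "'a measure \<Rightarrow> (real \<Rightarrow> 'a measure) \<Rightarrow> (nat \<Rightarrow> real \<Rightarrow> 'a \<Rightarrow> real) \<Rightarrow> nat \<Rightarrow> real \<Rightarrow> real \<Rightarrow>
     (real \<Rightarrow> 'a \<Rightarrow> real) \<Rightarrow> ('a \<Rightarrow> real) \<Rightarrow> bool" where
  "has_stochastic_integral M F f i a b H X \<longleftrightarrow>
     (if i = 0 then has_ms_integral M a b H X else has_ito_integral M F (f i) a b H X)"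


subsection \<open>Iterated integrals\<close>

text \<open>
  The points \<open>(x_p, ..., x_q)\<close> with \<open>b \<ge> x_p \<ge> ... \<ge> x_q \<ge> a\<close>, as extensional functions on
  \<open>{p..q}\<close>. If \<open>p > q\<close>, the only element is \<open>\<lambda>_. undefined\<close>, the empty tuple. As the values
  outside \<open>{p..q}\<close> are fixed, the product topology on \<open>nat \<Rightarrow> real\<close> induces the
  Euclidean topology on this set.
\<close>

definition decreasing_points :: "nat \<Rightarrow> nat \<Rightarrow> real \<Rightarrow> real \<Rightarrow> (nat \<Rightarrow> real) set" where
  "decreasing_points p q a b = {x \<in> {p..q} \<rightarrow>\<^sub>E {a..b}. antimono_on {p..q} x}"

text \<open>
  In the iterated Ito integral, \<open>I j (t_1, ..., t_{j-1})\<close> is the result of the integrations over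
  \<open>t_k, ..., t_j\<close>, where \<open>t_j\<close> runs from \<open>t\<close> to \<open>t_{j-1}\<close> (to \<open>T\<close> if \<open>j = 1\<close>), and \<open>I (k + 1)\<close> is the
  integrand.
\<close>

definition has_iterated_ito_integral ::
    "'a measure \<Rightarrow> (real \<Rightarrow> 'a measure) \<Rightarrow> (nat \<Rightarrow> real \<Rightarrow> 'a \<Rightarrow> real) \<Rightarrow> nat \<Rightarrow> (nat \<Rightarrow> nat) \<Rightarrow>
     real \<Rightarrow> real \<Rightarrow> (real \<Rightarrow> 'a \<Rightarrow> real) \<Rightarrow> ((nat \<Rightarrow> real) \<Rightarrow> real) \<Rightarrow> ('a \<Rightarrow> real) \<Rightarrow> bool" where
  "has_iterated_ito_integral M F f k i t T \<xi> \<Phi> J \<longleftrightarrow>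
     (\<exists>I :: nat \<Rightarrow> (nat \<Rightarrow> real) \<Rightarrow> 'a \<Rightarrow> real.
        (\<forall>x\<in>decreasing_points 1 k t T.
           I (Suc k) x = (\<lambda>\<omega>. \<Phi> (restrict x {1..k-1}) * \<xi> (x k) \<omega>)) \<and>
        (\<forall>j\<in>{1..k}. \<forall>x\<in>decreasing_points 1 (j-1) t T.
           has_stochastic_integral M F f (i j) t (if j = 1 then T else x (j-1))
             (\<lambda>s. I (Suc j) (x(j := s))) (I j x)) \<and>
        J = I 1 (\<lambda>_. undefined))"

text \<open>
  In the reversed-order integral, \<open>A r s y\<close> is the integral over \<open>s \<le> t_r \<le> ... \<le> t_1 \<le> T\<close> taken
  in the order \<open>t_1, ..., t_r\<close>, with parameters \<open>y = (t_{r+1}, ..., t_{k-1})\<close>. The definition of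
  \<open>J\<close> includes the existence of all intermediate mean-square limits.
\<close>

definition has_reversed_integral ::
    "'a measure \<Rightarrow> (real \<Rightarrow> 'a measure) \<Rightarrow> (nat \<Rightarrow> real \<Rightarrow> 'a \<Rightarrow> real) \<Rightarrow> nat \<Rightarrow> (nat \<Rightarrow> nat) \<Rightarrow>
     real \<Rightarrow> real \<Rightarrow> (real \<Rightarrow> 'a \<Rightarrow> real) \<Rightarrow> ((nat \<Rightarrow> real) \<Rightarrow> real) \<Rightarrow> ('a \<Rightarrow> real) \<Rightarrow> bool" where
  "has_reversed_integral M F f k i t T \<xi> \<Phi> J \<longleftrightarrow>
     (\<exists>A :: nat \<Rightarrow> real \<Rightarrow> (nat \<Rightarrow> real) \<Rightarrow> 'a \<Rightarrow> real.
        (\<forall>s\<in>{t..T}. \<forall>y\<in>decreasing_points 2 (k-1) t s.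
           has_stochastic_integral M F f (i 1) s T (\<lambda>u \<omega>. \<Phi> (y(1 := u))) (A 1 s y)) \<and>
        (\<forall>r\<in>{2..k-1}. \<forall>s\<in>{t..T}. \<forall>y\<in>decreasing_points (Suc r) (k-1) t s.
           has_partition_limit M s T
             (\<lambda>N \<tau> \<omega>. \<Sum>l<N.
                (integrator f (i r) (\<tau> (Suc l)) \<omega> - integrator f (i r) (\<tau> l) \<omega>) *
                A (r-1) (\<tau> (Suc l)) (y(r := \<tau> l)) \<omega>)
             (A r s y)) \<and>
        has_partition_limit M t T
          (\<lambda>N \<tau> \<omega>. \<Sum>l<N.
             \<xi> (\<tau> l) \<omega> *
             (integrator f (i k) (\<tau> (Suc l)) \<omega> - integrator f (i k) (\<tau> l) \<omega>) *
             A (k-1) (\<tau> (Suc l)) (\<lambda>_. undefined) \<omega>)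
          J)"

end

theory Submission
  imports Defs
begin

text \<open>
  An integrator enters only through the bound
  \<open>E (\<Sum> \<eta>_l \<Delta>w_l)^2 \<le> (T + 1) \<Sum> E \<eta>_l^2 \<Delta>\<tau>_l\<close> for adapted step processes, which is the Ito isometry for
  a Wiener process and the Cauchy-Schwarz inequality for time. It makes the integral a bounded linear
  map, in the supremum over time of the mean-square norm, on adapted processes that are uniform limits
  of step processes.

  For the exchange of the order of integration, the factor \<open>\<xi>(\<tau>_l) \<Delta>w_l\<close> of the \<open>l\<close>-th summand of the
  reversed integral is known at time \<open>\<tau>_(l+1)\<close>, the lower limit of the integrals it multiplies. Hence it
  can be moved inside all of them, and the whole sum becomes an iterated Ito integral whose innermost
  integrand is a partial integral sum of \<open>\<xi> \<Phi> dw\<close>. These sums converge to the innermost integral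
  uniformly in the outer variables, and the outer integrations are bounded maps.
\<close>

section \<open>The mean-square norm\<close>

text \<open>The integrals are fixed only up to null sets and depend on uncountably many parameters,
  so no path of an inner integral is ever formed: estimates are suprema over the parameters of
  mean-square norms, and identities between integrals hold almost surely for each parameter
  separately. The supremum norm, rather than the norm of L2(ds x P), lets an error pass through the
  outer integrals; agreement with the L2(ds) definition of the Ito integral is a separate
  comparison.

  The candidate for the intermediate reversed integral A_r with lower limit s is the ordinary
  iterated Ito integral over the same simplex. One limit statement then serves all stages: its
  factor \<open>Z\<close> is 1 for A_2, ..., A_(k-1) and \<xi> for the last sum.

  Two obstacles shape the exchange. The factor of the l-th summand is unbounded, so moving it inside
  needs truncation, and square integrability of the summands is a result of the exchange. The lower
  limits \<tau>_(l+1) vary with the summand; cutting the integrands off to zero below them yields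
  the common lower limit s, so that the summands can be added under one integral.\<close>

definition l2norm :: "'a measure \<Rightarrow> ('a \<Rightarrow> real) \<Rightarrow> real" where
  "l2norm M X = sqrt (\<integral>\<omega>. (X \<omega>)\<^sup>2 \<partial>M)"

lemma square_integrable_measurable: "square_integrable M X \<Longrightarrow> X \<in> borel_measurable M"
  by (simp add: square_integrable_def)

lemma integrable_mult_square_integrable:
  assumes "square_integrable M X" "square_integrable M Y"
  shows "integrable M (\<lambda>\<omega>. X \<omega> * Y \<omega>)"
proof (rule Bochner_Integration.integrable_bound)
  show "integrable M (\<lambda>\<omega>. (X \<omega>)\<^sup>2 + (Y \<omega>)\<^sup>2)" "(\<lambda>\<omega>. X \<omega> * Y \<omega>) \<in> borel_measurable M"
    using assms by (auto simp: square_integrable_def)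
  have "\<bar>x * y\<bar> \<le> x\<^sup>2 + y\<^sup>2" for x y :: real
    using sum_squares_bound[of "\<bar>x\<bar>" "\<bar>y\<bar>"] abs_ge_zero[of "x*y"] unfolding abs_mult power2_abs by linarith
  then show "AE \<omega> in M. norm (X \<omega> * Y \<omega>) \<le> norm ((X \<omega>)\<^sup>2 + (Y \<omega>)\<^sup>2)"
    by (auto intro: order_trans[OF _ abs_ge_self])
qed

lemma square_integrable_zero [simp]: "square_integrable M (\<lambda>\<omega>. 0)"
  by (simp add: square_integrable_def)

lemma square_integrable_cmult:
  "square_integrable M X \<Longrightarrow> square_integrable M (\<lambda>\<omega>. c * X \<omega>)"
  by (auto simp: square_integrable_def power_mult_distrib)

lemma square_integrable_add:
  assumes "square_integrable M X" "square_integrable M Y"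
  shows "square_integrable M (\<lambda>\<omega>. X \<omega> + Y \<omega>)"
proof -
  have "(\<lambda>\<omega>. (X \<omega> + Y \<omega>)\<^sup>2) = (\<lambda>\<omega>. (X \<omega>)\<^sup>2 + (Y \<omega>)\<^sup>2 + 2 * (X \<omega> * Y \<omega>))"
    by (auto simp: power2_eq_square algebra_simps)
  then show ?thesis
    using assms integrable_mult_square_integrable[OF assms] by (auto simp: square_integrable_def)
qed

lemma square_integrable_diff:
  "square_integrable M X \<Longrightarrow> square_integrable M Y \<Longrightarrow> square_integrable M (\<lambda>\<omega>. X \<omega> - Y \<omega>)"
  using square_integrable_add[of M X "\<lambda>\<omega>. (-1) * Y \<omega>"] square_integrable_cmult[of M Y "-1"] by simp

lemma square_integrable_sum:
  "(\<And>i. i \<in> I \<Longrightarrow> square_integrable M (X i)) \<Longrightarrow> square_integrable M (\<lambda>\<omega>. \<Sum>i\<in>I. X i \<omega>)"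
  by (induction I rule: infinite_finite_induct) (auto intro: square_integrable_add)

lemma square_integrable_cong_AE:
  assumes "square_integrable M X" "Y \<in> borel_measurable M" "AE \<omega> in M. X \<omega> = Y \<omega>"
  shows "square_integrable M Y"
proof -
  have "integrable M (\<lambda>\<omega>. (Y \<omega>)\<^sup>2)"
    by (rule integrable_cong_AE_imp[of M "\<lambda>\<omega>. (X \<omega>)\<^sup>2"]) (use assms in \<open>auto simp: square_integrable_def\<close>)
  then show ?thesis using assms by (simp add: square_integrable_def)
qed

lemma square_integrable_bounded_mult:
  assumes "square_integrable M X" "c \<in> borel_measurable M" "\<And>\<omega>. \<bar>c \<omega>\<bar> \<le> B"
  shows "square_integrable M (\<lambda>\<omega>. c \<omega> * X \<omega>)"
proof -
  have "integrable M (\<lambda>\<omega>. (c \<omega> * X \<omega>)\<^sup>2)"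
  proof (rule Bochner_Integration.integrable_bound)
    show "integrable M (\<lambda>\<omega>. B\<^sup>2 * (X \<omega>)\<^sup>2)" "(\<lambda>\<omega>. (c \<omega> * X \<omega>)\<^sup>2) \<in> borel_measurable M"
      using assms by (auto simp: square_integrable_def)
    have "(c \<omega>)\<^sup>2 \<le> B\<^sup>2" for \<omega> using assms(3)[of \<omega>] by (meson abs_le_square_iff abs_ge_self order_trans)
    then show "AE \<omega> in M. norm ((c \<omega> * X \<omega>)\<^sup>2) \<le> norm (B\<^sup>2 * (X \<omega>)\<^sup>2)"
      by (auto simp: power_mult_distrib mult_right_mono)
  qed
  then show ?thesis using assms by (auto simp: square_integrable_def)
qed

lemma l2norm_nonneg [simp]: "0 \<le> l2norm M X"
  by (simp add: l2norm_def)

lemma l2norm_power2: "(l2norm M X)\<^sup>2 = (\<integral>\<omega>. (X \<omega>)\<^sup>2 \<partial>M)"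
  by (simp add: l2norm_def)

lemma l2norm_zero [simp]: "l2norm M (\<lambda>\<omega>. 0) = 0"
  by (simp add: l2norm_def)

lemma l2norm_cmult: "l2norm M (\<lambda>\<omega>. c * X \<omega>) = \<bar>c\<bar> * l2norm M X"
  by (simp add: l2norm_def power_mult_distrib real_sqrt_mult)

lemma l2norm_minus_commute: "l2norm M (\<lambda>\<omega>. X \<omega> - Y \<omega>) = l2norm M (\<lambda>\<omega>. Y \<omega> - X \<omega>)"
  by (simp add: l2norm_def power2_commute)

lemma l2norm_cong_AE:
  assumes "X \<in> borel_measurable M" "Y \<in> borel_measurable M" "AE \<omega> in M. X \<omega> = Y \<omega>"
  shows "l2norm M X = l2norm M Y"
proof -
  have "(\<integral>\<omega>. (X \<omega>)\<^sup>2 \<partial>M) = (\<integral>\<omega>. (Y \<omega>)\<^sup>2 \<partial>M)"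
    by (rule integral_cong_AE) (use assms in auto)
  then show ?thesis by (simp add: l2norm_def)
qed

lemma l2norm_eq_0_iff:
  assumes "square_integrable M X"
  shows "l2norm M X = 0 \<longleftrightarrow> (AE \<omega> in M. X \<omega> = 0)"
  using assms by (simp add: l2norm_def square_integrable_def integral_nonneg_eq_0_iff_AE)

lemma l2norm_triangle:
  assumes X: "square_integrable M X" and Y: "square_integrable M Y"
  shows "l2norm M (\<lambda>\<omega>. X \<omega> + Y \<omega>) \<le> l2norm M X + l2norm M Y"
\<comment> \<open>The weights of the main case divide by both norms, hence the split; a vanishing
  norm means that the variable is almost surely zero.\<close>
proof (cases "l2norm M X = 0 \<or> l2norm M Y = 0")
  case True
  then show ?thesis
  proof
    assume "l2norm M X = 0"
    then have "l2norm M (\<lambda>\<omega>. X \<omega> + Y \<omega>) = l2norm M Y"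
      using X Y by (intro l2norm_cong_AE) (auto simp: l2norm_eq_0_iff square_integrable_def)
    then show ?thesis by simp
  next
    assume "l2norm M Y = 0"
    then have "l2norm M (\<lambda>\<omega>. X \<omega> + Y \<omega>) = l2norm M X"
      using X Y by (intro l2norm_cong_AE) (auto simp: l2norm_eq_0_iff square_integrable_def)
    then show ?thesis by simp
  qed
next
  case False
  define p q where "p = l2norm M X" and "q = l2norm M Y"
  have pq: "p > 0" "q > 0" using False l2norm_nonneg[of M X] l2norm_nonneg[of M Y] unfolding p_def q_def by linarith+
  (* convexity of the square, with weights p/(p+q) and q/(p+q) *)
  have *: "(x + y)\<^sup>2 \<le> (1 + q / p) * x\<^sup>2 + (1 + p / q) * y\<^sup>2" for x y :: real
  proof -
    have "(1 + q / p) * x\<^sup>2 + (1 + p / q) * y\<^sup>2 - (x + y)\<^sup>2 = (q * x - p * y)\<^sup>2 / (p * q)"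
      using pq by (simp add: field_simps power2_eq_square)
    also have "\<dots> \<ge> 0" using pq by simp
    finally show ?thesis by simp
  qed
  have "(\<integral>\<omega>. (X \<omega> + Y \<omega>)\<^sup>2 \<partial>M) \<le> (\<integral>\<omega>. (1 + q / p) * (X \<omega>)\<^sup>2 + (1 + p / q) * (Y \<omega>)\<^sup>2 \<partial>M)"
    using X Y square_integrable_add[OF X Y] *
    by (intro integral_mono) (auto simp: square_integrable_def)
  also have "\<dots> = (1 + q / p) * p\<^sup>2 + (1 + p / q) * q\<^sup>2"
    using X Y unfolding p_def q_def l2norm_power2 by (simp add: square_integrable_def)
  also have "\<dots> = (p + q)\<^sup>2"
    using pq by (simp add: field_simps power2_eq_square)
  finally have "l2norm M (\<lambda>\<omega>. X \<omega> + Y \<omega>) \<le> sqrt ((p + q)\<^sup>2)"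
    unfolding l2norm_def by (rule real_sqrt_le_mono)
  then show ?thesis using pq by (simp add: p_def q_def)
qed

lemma l2norm_triangle_diff:
  assumes "square_integrable M X" "square_integrable M Y" "square_integrable M Z"
  shows "l2norm M (\<lambda>\<omega>. X \<omega> - Z \<omega>) \<le> l2norm M (\<lambda>\<omega>. X \<omega> - Y \<omega>) + l2norm M (\<lambda>\<omega>. Y \<omega> - Z \<omega>)"
  using l2norm_triangle[OF square_integrable_diff[OF assms(1,2)] square_integrable_diff[OF assms(2,3)]]
  by simp

lemma l2norm_le_diff:
  assumes "square_integrable M X" "square_integrable M Y"
  shows "l2norm M X \<le> l2norm M (\<lambda>\<omega>. X \<omega> - Y \<omega>) + l2norm M Y"
  using l2norm_triangle_diff[OF assms square_integrable_zero] by simp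

lemma l2norm_sum_le:
  assumes "\<And>i. i \<in> I \<Longrightarrow> square_integrable M (X i)"
  shows "l2norm M (\<lambda>\<omega>. \<Sum>i\<in>I. X i \<omega>) \<le> (\<Sum>i\<in>I. l2norm M (X i))"
  using assms
proof (induction I rule: infinite_finite_induct)
  case (insert i I)
  have "l2norm M (\<lambda>\<omega>. X i \<omega> + (\<Sum>i\<in>I. X i \<omega>)) \<le> l2norm M (X i) + l2norm M (\<lambda>\<omega>. \<Sum>i\<in>I. X i \<omega>)"
    using insert by (intro l2norm_triangle square_integrable_sum) auto
  with insert show ?case by fastforce
qed auto

lemma l2norm_eq_0_imp_AE_eq:
  assumes "square_integrable M X" "square_integrable M Y" "l2norm M (\<lambda>\<omega>. X \<omega> - Y \<omega>) \<le> 0"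
  shows "AE \<omega> in M. X \<omega> = Y \<omega>"
proof -
  have "l2norm M (\<lambda>\<omega>. X \<omega> - Y \<omega>) = 0" using assms(3) l2norm_nonneg[of M] by (intro antisym) auto
  then show ?thesis using l2norm_eq_0_iff[OF square_integrable_diff[OF assms(1,2)]] by auto
qed

lemma ms_limit_iff:
  "ms_limit M S X \<longleftrightarrow> (\<forall>n. square_integrable M (S n)) \<and> square_integrable M X \<and>
     (\<lambda>n. l2norm M (\<lambda>\<omega>. S n \<omega> - X \<omega>)) \<longlonglongrightarrow> 0"
proof -
  have "((\<lambda>n. (l2norm M (\<lambda>\<omega>. S n \<omega> - X \<omega>))\<^sup>2) \<longlonglongrightarrow> 0) \<longleftrightarrow> ((\<lambda>n. l2norm M (\<lambda>\<omega>. S n \<omega> - X \<omega>)) \<longlonglongrightarrow> 0)"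
    using tendsto_real_sqrt[of "\<lambda>n. (l2norm M (\<lambda>\<omega>. S n \<omega> - X \<omega>))\<^sup>2" 0 sequentially]
      tendsto_power[of "\<lambda>n. l2norm M (\<lambda>\<omega>. S n \<omega> - X \<omega>)" 0 sequentially 2] by auto
  then show ?thesis unfolding ms_limit_def l2norm_power2 by simp
qed

lemma ms_limitI:
  assumes "\<And>n. square_integrable M (S n)" "square_integrable M X"
    and "\<And>\<epsilon>. \<epsilon> > 0 \<Longrightarrow> \<forall>\<^sub>F n in sequentially. l2norm M (\<lambda>\<omega>. S n \<omega> - X \<omega>) \<le> \<epsilon>"
  shows "ms_limit M S X"
  unfolding ms_limit_iff
proof (intro conjI allI assms(1,2))
  show "(\<lambda>n. l2norm M (\<lambda>\<omega>. S n \<omega> - X \<omega>)) \<longlonglongrightarrow> 0"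
  proof (rule tendstoI)
    fix e :: real assume "e > 0"
    with assms(3)[of "e/2"] show "\<forall>\<^sub>F n in sequentially. dist (l2norm M (\<lambda>\<omega>. S n \<omega> - X \<omega>)) 0 < e"
      by (auto elim!: eventually_mono)
  qed
qed

lemma ms_limitD:
  assumes "ms_limit M S X" "\<epsilon> > 0"
  shows "\<forall>\<^sub>F n in sequentially. l2norm M (\<lambda>\<omega>. S n \<omega> - X \<omega>) < \<epsilon>"
proof -
  have "(\<lambda>n. l2norm M (\<lambda>\<omega>. S n \<omega> - X \<omega>)) \<longlonglongrightarrow> 0" using assms(1) by (simp add: ms_limit_iff)
  from order_tendstoD(2)[OF this assms(2)] show ?thesis .
qed

text \<open>The two sequences may differ on null sets because they will be integral sums built from
  different versions of the same inner integrals.\<close>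

lemma ms_limit_unique:
  assumes S: "ms_limit M S X" and S': "ms_limit M S' Y"
    and eq: "\<And>n. AE \<omega> in M. S n \<omega> = S' n \<omega>"
  shows "AE \<omega> in M. X \<omega> = Y \<omega>"
proof -
  have si: "square_integrable M X" "square_integrable M Y" "square_integrable M (S n)" "square_integrable M (S' n)" for n
    using S S' by (auto simp: ms_limit_iff)
  note [measurable] = si[THEN square_integrable_measurable]
  have "l2norm M (\<lambda>\<omega>. X \<omega> - Y \<omega>) \<le> 0"
  proof (rule field_le_epsilon)
    fix e :: real assume e: "e > 0"
    have "\<forall>\<^sub>F n in sequentially. l2norm M (\<lambda>\<omega>. S n \<omega> - X \<omega>) < e/2 \<and> l2norm M (\<lambda>\<omega>. S' n \<omega> - Y \<omega>) < e/2"
      using ms_limitD[OF S, of "e/2"] ms_limitD[OF S', of "e/2"] e by (auto intro: eventually_conj)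
    then obtain n where n: "l2norm M (\<lambda>\<omega>. S n \<omega> - X \<omega>) < e/2" "l2norm M (\<lambda>\<omega>. S' n \<omega> - Y \<omega>) < e/2"
      by (auto simp: eventually_sequentially)
    have "l2norm M (\<lambda>\<omega>. S n \<omega> - Y \<omega>) = l2norm M (\<lambda>\<omega>. S' n \<omega> - Y \<omega>)"
      using eq[of n] by (intro l2norm_cong_AE) auto
    then show "l2norm M (\<lambda>\<omega>. X \<omega> - Y \<omega>) \<le> 0 + e"
      using l2norm_triangle_diff[OF si(1) si(3)[of n] si(2)] n l2norm_minus_commute[of M X "S n"] by simp
  qed
  then show ?thesis by (rule l2norm_eq_0_imp_AE_eq[OF si(1,2)])
qed

context prob_space
begin

lemma square_integrable_const: "square_integrable M (\<lambda>\<omega>. c)"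
  by (simp add: square_integrable_def)

lemma square_integrable_imp_integrable: "square_integrable M X \<Longrightarrow> integrable M X"
  using integrable_mult_square_integrable[of M X "\<lambda>_. 1"] square_integrable_const[of 1] by simp

lemma L1_le_l2norm:
  assumes X: "square_integrable M X"
  shows "(\<integral>\<omega>. \<bar>X \<omega>\<bar> \<partial>M) \<le> l2norm M X"
proof -
  have X': "integrable M (\<lambda>\<omega>. \<bar>X \<omega>\<bar>)" "integrable M (\<lambda>\<omega>. \<bar>X \<omega>\<bar>\<^sup>2)"
    using square_integrable_imp_integrable[OF X] X by (auto simp: square_integrable_def)
  have "0 \<le> variance (\<lambda>\<omega>. \<bar>X \<omega>\<bar>)" by simp
  also have "\<dots> = expectation (\<lambda>\<omega>. \<bar>X \<omega>\<bar>\<^sup>2) - (expectation (\<lambda>\<omega>. \<bar>X \<omega>\<bar>))\<^sup>2"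
    using X' by (intro variance_eq) auto
  finally show ?thesis unfolding l2norm_def by (intro real_le_rsqrt) simp
qed

text \<open>Completeness of L2, with a limit that is measurable for \<open>G\<close> itself and not
  only up to null sets. This matters because the filtration need not contain the null sets, while
  step processes must be adapted to it exactly.\<close>

lemma square_integrable_complete:
  assumes si: "\<And>n. square_integrable M (X n)"
    and Cauchy: "\<And>\<epsilon>. \<epsilon> > 0 \<Longrightarrow> \<exists>n0. \<forall>m\<ge>n0. \<forall>n\<ge>n0. l2norm M (\<lambda>\<omega>. X m \<omega> - X n \<omega>) \<le> \<epsilon>"
    and G: "subalgebra M G" "\<And>n. X n \<in> borel_measurable G"
  obtains Y where "Y \<in> borel_measurable G" "square_integrable M Y" "ms_limit M X Y"
proof -
  note [measurable] = square_integrable_measurable[OF si]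
  have int: "integrable M (X n)" for n by (rule square_integrable_imp_integrable[OF si])
  \<comment> \<open>On a probability space the L1 norm is dominated by the mean-square norm; the L1
    Cauchy property serves to extract an almost surely convergent subsequence.\<close>
  have c1: "\<exists>N. \<forall>i\<ge>N. \<forall>j\<ge>N. LINT x|M. norm (X i x - X j x) < e" if e: "e > 0" for e
  proof -
    obtain n0 where n0: "\<forall>m\<ge>n0. \<forall>n\<ge>n0. l2norm M (\<lambda>\<omega>. X m \<omega> - X n \<omega>) \<le> e/2"
      using Cauchy[of "e/2"] e by auto
    have "LINT x|M. norm (X i x - X j x) < e" if "i \<ge> n0" "j \<ge> n0" for i j
      using L1_le_l2norm[OF square_integrable_diff[OF si si, of i j]] n0 that e by fastforce
    then show ?thesis by blast
  qed
  obtain r :: "nat \<Rightarrow> nat" where r: "strict_mono r" "AE x in M. Cauchy (\<lambda>i. X (r i) x)"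
    using cauchy_L1_AE_cauchy_subseq[of M X, OF int c1] by auto
  \<comment> \<open>\<open>lim\<close> is a total function, so \<open>Y\<close> is defined
    everywhere as a limit of \<open>G\<close>-measurable functions and no exceptional set has to be
    removed.\<close>
  define Y where "Y \<omega> = lim (\<lambda>i. X (r i) \<omega>)" for \<omega>
  have YG: "Y \<in> borel_measurable G" unfolding Y_def by (rule borel_measurable_lim_metric[OF G(2)])
  then have YM: "Y \<in> borel_measurable M" by (rule measurable_from_subalg[OF G(1)])
  have lim: "AE x in M. (\<lambda>i. X (r i) x) \<longlonglongrightarrow> Y x"
    using r(2) by eventually_elim (simp add: Y_def Cauchy_convergent_iff convergent_LIMSEQ_iff)
  \<comment> \<open>Fatou's lemma along the subsequence carries the Cauchy bound over to the
    distance from \<open>Y\<close>.\<close>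
  have key: "square_integrable M (\<lambda>\<omega>. X n \<omega> - Y \<omega>) \<and> l2norm M (\<lambda>\<omega>. X n \<omega> - Y \<omega>) \<le> \<epsilon>"
    if n0: "\<forall>m\<ge>n0. \<forall>n\<ge>n0. l2norm M (\<lambda>\<omega>. X m \<omega> - X n \<omega>) \<le> \<epsilon>" and n: "n \<ge> n0" and e: "\<epsilon> > 0" for n0 n \<epsilon>
  proof -
    have nn: "(\<integral>\<^sup>+\<omega>. ennreal ((X n \<omega> - Y \<omega>)\<^sup>2) \<partial>M) \<le> ennreal (\<epsilon>\<^sup>2)"
    proof -
      have "(\<integral>\<^sup>+\<omega>. ennreal ((X n \<omega> - Y \<omega>)\<^sup>2) \<partial>M) = (\<integral>\<^sup>+\<omega>. liminf (\<lambda>i. ennreal ((X n \<omega> - X (r i) \<omega>)\<^sup>2)) \<partial>M)"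
      proof (rule nn_integral_cong_AE)
        show "AE \<omega> in M. ennreal ((X n \<omega> - Y \<omega>)\<^sup>2) = liminf (\<lambda>i. ennreal ((X n \<omega> - X (r i) \<omega>)\<^sup>2))"
          using lim
        proof eventually_elim
          case (elim \<omega>)
          then have "(\<lambda>i. ennreal ((X n \<omega> - X (r i) \<omega>)\<^sup>2)) \<longlonglongrightarrow> ennreal ((X n \<omega> - Y \<omega>)\<^sup>2)"
            by (intro tendsto_intros)
          then show ?case by (rule lim_imp_Liminf[OF trivial_limit_sequentially, symmetric])
        qed
      qed
      also have "\<dots> \<le> liminf (\<lambda>i. \<integral>\<^sup>+\<omega>. ennreal ((X n \<omega> - X (r i) \<omega>)\<^sup>2) \<partial>M)"
        by (intro nn_integral_liminf) measurable
      also have "\<dots> \<le> ennreal (\<epsilon>\<^sup>2)"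
      proof (rule Liminf_le)
        show "\<forall>\<^sub>F i in sequentially. (\<integral>\<^sup>+\<omega>. ennreal ((X n \<omega> - X (r i) \<omega>)\<^sup>2) \<partial>M) \<le> ennreal (\<epsilon>\<^sup>2)"
          unfolding eventually_sequentially
        proof (intro exI allI impI)
          fix i assume "n0 \<le> i"
          then have "n0 \<le> r i" using seq_suble[OF r(1), of i] by linarith
          then have "(l2norm M (\<lambda>\<omega>. X n \<omega> - X (r i) \<omega>))\<^sup>2 \<le> \<epsilon>\<^sup>2"
            using n0 n by (intro power_mono) auto
          moreover have "(\<integral>\<^sup>+\<omega>. ennreal ((X n \<omega> - X (r i) \<omega>)\<^sup>2) \<partial>M) = ennreal ((l2norm M (\<lambda>\<omega>. X n \<omega> - X (r i) \<omega>))\<^sup>2)"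
            unfolding l2norm_power2 using square_integrable_diff[OF si si, of n "r i"]
            by (intro nn_integral_eq_integral) (auto simp: square_integrable_def)
          ultimately show "(\<integral>\<^sup>+\<omega>. ennreal ((X n \<omega> - X (r i) \<omega>)\<^sup>2) \<partial>M) \<le> ennreal (\<epsilon>\<^sup>2)"
            by (simp add: ennreal_leI)
        qed
      qed simp
      finally show ?thesis .
    qed
    have int2: "integrable M (\<lambda>\<omega>. (X n \<omega> - Y \<omega>)\<^sup>2)"
      using nn si[of n] YM by (intro integrableI_nonneg) (auto simp: square_integrable_def less_top[symmetric] top_unique)
    then have sq: "square_integrable M (\<lambda>\<omega>. X n \<omega> - Y \<omega>)"
      using YM by (auto simp: square_integrable_def)
    have "ennreal (\<integral>\<omega>. (X n \<omega> - Y \<omega>)\<^sup>2 \<partial>M) \<le> ennreal (\<epsilon>\<^sup>2)"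
      using nn nn_integral_eq_integral[OF int2] by simp
    then have "(\<integral>\<omega>. (X n \<omega> - Y \<omega>)\<^sup>2 \<partial>M) \<le> \<epsilon>\<^sup>2" by (simp add: ennreal_le_iff)
    then have "l2norm M (\<lambda>\<omega>. X n \<omega> - Y \<omega>) \<le> \<epsilon>"
      unfolding l2norm_def using e by (intro real_le_lsqrt) auto
    with sq show ?thesis by simp
  qed
  have Ysi: "square_integrable M Y"
  proof -
    obtain n0 where "\<forall>m\<ge>n0. \<forall>n\<ge>n0. l2norm M (\<lambda>\<omega>. X m \<omega> - X n \<omega>) \<le> 1" using Cauchy[of 1] by auto
    from key[OF this, of n0] have "square_integrable M (\<lambda>\<omega>. X n0 \<omega> - Y \<omega>)" by simp
    from square_integrable_diff[OF si[of n0] this] show ?thesis by simp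
  qed
  have "ms_limit M X Y"
  proof (rule ms_limitI[OF si Ysi])
    fix \<epsilon> :: real assume e: "\<epsilon> > 0"
    obtain n0 where "\<forall>m\<ge>n0. \<forall>n\<ge>n0. l2norm M (\<lambda>\<omega>. X m \<omega> - X n \<omega>) \<le> \<epsilon>" using Cauchy[OF e] by auto
    from key[OF this _ e] show "\<forall>\<^sub>F n in sequentially. l2norm M (\<lambda>\<omega>. X n \<omega> - Y \<omega>) \<le> \<epsilon>"
      unfolding eventually_sequentially by blast
  qed
  with YG Ysi that show thesis by blast
qed

end

section \<open>Adapted step processes and the basic mean-square bound\<close>

context wiener_setting
begin

abbreviation w :: "nat \<Rightarrow> real \<Rightarrow> 'a \<Rightarrow> real" where "w \<equiv> integrator f"
abbreviation sq_int :: "('a \<Rightarrow> real) \<Rightarrow> bool" where "sq_int \<equiv> square_integrable M"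
abbreviation nrm :: "('a \<Rightarrow> real) \<Rightarrow> real" where "nrm \<equiv> l2norm M"

definition adapted :: "real \<Rightarrow> ('a \<Rightarrow> real) \<Rightarrow> bool" where
  "adapted s X \<longleftrightarrow> X \<in> borel_measurable (F s) \<and> sq_int X"

lemma subalgebra_filtration: "\<tau> \<in> {0..T} \<Longrightarrow> subalgebra M (F \<tau>)"
  using space_filtration sets_filtration by (simp add: subalgebra_def)

lemma filtration_measurable_mono:
  assumes "X \<in> borel_measurable (F s)" "0 \<le> s" "s \<le> u" "u \<le> T"
  shows "X \<in> borel_measurable (F u)"
proof (cases "s = u")
  case False
  have "subalgebra (F u) (F s)"
    using assms False filtration_mono[of s u] space_filtration[of s] space_filtration[of u]
    by (auto simp: subalgebra_def)
  then show ?thesis using assms(1) by (rule measurable_from_subalg)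
qed (use assms in simp)

lemma adapted_mono: "adapted s X \<Longrightarrow> 0 \<le> s \<Longrightarrow> s \<le> u \<Longrightarrow> u \<le> T \<Longrightarrow> adapted u X"
  unfolding adapted_def using filtration_measurable_mono[of X s u] by blast

lemma adapted_sq_int: "adapted s X \<Longrightarrow> sq_int X"
  by (simp add: adapted_def)

lemma adapted_measurable: "adapted s X \<Longrightarrow> X \<in> borel_measurable (F s)"
  by (simp add: adapted_def)

lemma adaptedI: "X \<in> borel_measurable (F s) \<Longrightarrow> sq_int X \<Longrightarrow> adapted s X"
  by (simp add: adapted_def)

lemma adapted_zero [simp]: "adapted s (\<lambda>\<omega>. 0)"
  by (simp add: adapted_def)

lemma adapted_add: "adapted s X \<Longrightarrow> adapted s Y \<Longrightarrow> adapted s (\<lambda>\<omega>. X \<omega> + Y \<omega>)"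
  by (rule adaptedI[OF borel_measurable_add[OF adapted_measurable adapted_measurable] square_integrable_add[OF adapted_sq_int adapted_sq_int]])

lemma adapted_cmult: "adapted s X \<Longrightarrow> adapted s (\<lambda>\<omega>. c * X \<omega>)"
  by (rule adaptedI[OF borel_measurable_times[OF borel_measurable_const adapted_measurable] square_integrable_cmult[OF adapted_sq_int]])

lemma adapted_diff: "adapted s X \<Longrightarrow> adapted s Y \<Longrightarrow> adapted s (\<lambda>\<omega>. X \<omega> - Y \<omega>)"
  by (rule adaptedI[OF borel_measurable_diff[OF adapted_measurable adapted_measurable] square_integrable_diff[OF adapted_sq_int adapted_sq_int]])

lemma adapted_sum: "(\<And>i. i \<in> I \<Longrightarrow> adapted s (X i)) \<Longrightarrow> adapted s (\<lambda>\<omega>. \<Sum>i\<in>I. X i \<omega>)"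
  by (rule adaptedI[OF borel_measurable_sum[OF adapted_measurable] square_integrable_sum[OF adapted_sq_int]])

lemma adapted_bounded_mult:
  assumes "adapted s X" "c \<in> borel_measurable (F s)" "\<And>\<omega>. \<bar>c \<omega>\<bar> \<le> B" "s \<in> {0..T}"
  shows "adapted s (\<lambda>\<omega>. c \<omega> * X \<omega>)"
proof -
  have "c \<in> borel_measurable M"
    by (rule measurable_from_subalg[OF subalgebra_filtration[OF assms(4)] assms(2)])
  then have "sq_int (\<lambda>\<omega>. c \<omega> * X \<omega>)"
    using assms(1,3) by (intro square_integrable_bounded_mult) (auto simp: adapted_def)
  then show ?thesis using adapted_measurable[OF assms(1)] assms(2) by (intro adaptedI borel_measurable_times)
qed

section \<open>Independence, moments and products of increments\<close>

lemma integrator_measurable_filtration: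
  assumes "i \<le> m" "u \<in> {0..T}"
  shows "w i u \<in> borel_measurable (F u)"
proof (cases "i = 0")
  case False
  then have "w i u = f i u" by (auto simp: integrator_def)
  then show ?thesis using wiener_adapted[of i u] assms False by auto
next
  case True
  then have "w i u = (\<lambda>_. u)" by (auto simp: integrator_def)
  then show ?thesis by simp
qed

lemma wiener_measurable: "i \<in> {1..m} \<Longrightarrow> u \<in> {0..T} \<Longrightarrow> f i u \<in> borel_measurable M"
  using wiener[of i] by (simp add: standard_wiener_def)

text \<open>The locale gives independence of \<open>F u\<close> from the vector of all
  \<open>m\<close> increments. One component is a measurable function of that vector, so the events
  it generates are already among \<open>increment_events\<close>.\<close>

lemma indep_var_filtration_increment:
  assumes i: "i \<in> {1..m}" and uv: "0 \<le> u" "u < v" "v \<le> T" and X: "X \<in> borel_measurable (F u)"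
  shows "indep_var borel X borel (\<lambda>\<omega>. f i v \<omega> - f i u \<omega>)"
proof -
  let ?D = "\<lambda>\<omega>. f i v \<omega> - f i u \<omega>"
  have XM: "X \<in> borel_measurable M"
    using X by (rule measurable_from_subalg[OF subalgebra_filtration, rotated]) (use uv in auto)
  have D: "?D \<in> borel_measurable M"
    using wiener_measurable[OF i, of u] wiener_measurable[OF i, of v] uv by simp
  have ind: "indep_set (sets (F u)) (increment_events M f m u v)"
    using increments_indep[of u "v - u"] uv by simp
  have s1: "sigma_sets (space M) {X -` A \<inter> space M |A. A \<in> sets borel} \<subseteq> sets (F u)"
  proof -
    have "{X -` A \<inter> space M |A. A \<in> sets borel} \<subseteq> sets (F u)"
      using measurable_sets[OF X] space_filtration[of u] uv by auto
    then show ?thesis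
      using sets.sigma_sets_subset[of _ "F u"] space_filtration[of u] uv by auto
  qed
  have s2: "sigma_sets (space M) {?D -` A \<inter> space M |A. A \<in> sets borel} \<subseteq> increment_events M f m u v"
  proof -
    \<comment> \<open>Preimages of Borel sets already form a sigma-algebra, so it suffices to treat
      a single preimage below.\<close>
    have "sigma_sets (space M) {?D -` A \<inter> space M |A. A \<in> sets borel} = {?D -` A \<inter> space M |A. A \<in> sets borel}"
      using sets_vimage_algebra2[of ?D "space M" borel] sets_vimage_algebra[of "space M" ?D borel] by simp
    also have "\<dots> \<subseteq> increment_events M f m u v"
    proof safe
      fix A :: "real set" assume A: "A \<in> sets borel"
      let ?B = "(\<lambda>x. x i) -` A \<inter> space (PiM {1..m} (\<lambda>_. borel :: real measure))"
      have "(\<lambda>x. x i) \<in> measurable (PiM {1..m} (\<lambda>_. borel :: real measure)) borel"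
        using i by (intro measurable_component_singleton)
      then have B: "?B \<in> sets (PiM {1..m} (\<lambda>_. borel))" using A by (rule measurable_sets)
      have "?D -` A \<inter> space M = increments f m u v -` ?B \<inter> space M"
        using i by (auto simp: increments_def space_PiM)
      with B show "?D -` A \<inter> space M \<in> increment_events M f m u v"
        unfolding increment_events_def mem_Collect_eq by (intro exI[of _ ?B] conjI)
    qed
    finally show ?thesis .
  qed
  have "indep_set (sigma_sets (space M) {X -` A \<inter> space M |A. A \<in> sets borel})
     (sigma_sets (space M) {?D -` A \<inter> space M |A. A \<in> sets borel})"
    using ind s1 s2 unfolding indep_sets2_eq by blast
  then show ?thesis using XM D by (simp add: indep_var_eq)
qed

lemma wiener_increment_moments:
  assumes i: "i \<in> {1..m}" and uv: "0 \<le> u" "u < v" "v \<le> T"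
  shows "sq_int (\<lambda>\<omega>. f i v \<omega> - f i u \<omega>)"
    and "expectation (\<lambda>\<omega>. f i v \<omega> - f i u \<omega>) = 0"
    and "expectation (\<lambda>\<omega>. (f i v \<omega> - f i u \<omega>)\<^sup>2) = v - u"
proof -
  let ?D = "\<lambda>\<omega>. f i v \<omega> - f i u \<omega>"
  have D: "?D \<in> borel_measurable M"
    using wiener_measurable[OF i, of u] wiener_measurable[OF i, of v] uv by simp
  have dist: "distributed M lborel ?D (\<lambda>x. ennreal (normal_density 0 (sqrt (v - u)) x))"
    using wiener[OF i] uv by (auto simp: standard_wiener_def)
  have pos: "0 < sqrt (v - u)" using uv by simp
  show e: "expectation ?D = 0" by (rule normal_distributed_expectation[OF pos dist])
  show "expectation (\<lambda>\<omega>. (f i v \<omega> - f i u \<omega>)\<^sup>2) = v - u"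
    using normal_distributed_variance[OF pos dist] e uv by simp
  have "integrable M (\<lambda>\<omega>. (?D \<omega>)\<^sup>2) \<longleftrightarrow> integrable lborel (\<lambda>x. normal_density 0 (sqrt (v - u)) x * x\<^sup>2)"
    using distributed_integrable[OF dist, of "\<lambda>x. x\<^sup>2"] by simp
  also have "\<dots>" using integrable_normal_moment[OF pos, of 0 2] by simp
  finally show "sq_int ?D" using D by (simp add: square_integrable_def)
qed

text \<open>\<open>X\<close> may be unbounded; the product is still square integrable because the
  squares of the two factors are independent and both integrable.\<close>

lemma wiener_increment_mult:
  assumes i: "i \<in> {1..m}" and uv: "0 \<le> u" "u < v" "v \<le> T" and X: "adapted u X"
  shows "sq_int (\<lambda>\<omega>. X \<omega> * (f i v \<omega> - f i u \<omega>))"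
    and "expectation (\<lambda>\<omega>. (X \<omega> * (f i v \<omega> - f i u \<omega>))\<^sup>2) = (nrm X)\<^sup>2 * (v - u)"
proof -
  let ?D = "\<lambda>\<omega>. f i v \<omega> - f i u \<omega>"
  have X': "X \<in> borel_measurable (F u)" "integrable M (\<lambda>\<omega>. (X \<omega>)\<^sup>2)" "X \<in> borel_measurable M"
    using X by (auto simp: adapted_def square_integrable_def)
  have D: "integrable M (\<lambda>\<omega>. (?D \<omega>)\<^sup>2)" "?D \<in> borel_measurable M"
    using wiener_increment_moments(1)[OF i uv] by (auto simp: square_integrable_def)
  have "indep_var borel ((\<lambda>x. x\<^sup>2) \<circ> X) borel ((\<lambda>x. x\<^sup>2) \<circ> ?D)"
    by (rule indep_var_compose[OF indep_var_filtration_increment[OF i uv X'(1)]]) auto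
  then have ind: "indep_var borel (\<lambda>\<omega>. (X \<omega>)\<^sup>2) borel (\<lambda>\<omega>. (?D \<omega>)\<^sup>2)" by (simp add: o_def)
  show "sq_int (\<lambda>\<omega>. X \<omega> * ?D \<omega>)"
    using indep_var_integrable[OF ind X'(2) D(1)] X' D by (auto simp: square_integrable_def power_mult_distrib)
  show "expectation (\<lambda>\<omega>. (X \<omega> * (f i v \<omega> - f i u \<omega>))\<^sup>2) = (nrm X)\<^sup>2 * (v - u)"
    using indep_var_lebesgue_integral[OF ind X'(2) D(1)] wiener_increment_moments(3)[OF i uv]
    by (simp add: power_mult_distrib l2norm_power2)
qed

lemma sq_int_increment_mult:
  assumes "i \<le> m" "0 \<le> u" "u \<le> v" "v \<le> T" "adapted u X"
  shows "sq_int (\<lambda>\<omega>. X \<omega> * (w i v \<omega> - w i u \<omega>))"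
proof (cases "i = 0 \<or> u = v")
  case True
  then show ?thesis
  proof
    assume "i = 0"
    then show ?thesis using square_integrable_cmult[of M X "v - u"] assms(5)
      by (simp add: integrator_def adapted_def mult.commute)
  qed simp
next
  case False
  then show ?thesis using wiener_increment_mult(1)[of i u v X] assms by (simp add: integrator_def)
qed

lemma adapted_increment_mult:
  assumes "i \<le> m" "0 \<le> u" "u \<le> v" "v \<le> T" "adapted u X"
  shows "adapted v (\<lambda>\<omega>. X \<omega> * (w i v \<omega> - w i u \<omega>))"
proof -
  have "w i u \<in> borel_measurable (F u)"
    using assms by (intro integrator_measurable_filtration) auto
  then have "X \<in> borel_measurable (F v)" "w i u \<in> borel_measurable (F v)"
    using filtration_measurable_mono[OF _ assms(2-4)] adapted_measurable[OF assms(5)] by blast+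
  moreover have "w i v \<in> borel_measurable (F v)"
    using assms by (intro integrator_measurable_filtration) auto
  ultimately show ?thesis using sq_int_increment_mult[OF assms] by (intro adaptedI borel_measurable_times borel_measurable_diff)
qed

definition step_integral :: "nat \<Rightarrow> nat \<Rightarrow> (nat \<Rightarrow> real) \<Rightarrow> (nat \<Rightarrow> 'a \<Rightarrow> real) \<Rightarrow> 'a \<Rightarrow> real" where
  "step_integral i N \<tau> \<eta> \<omega> = (\<Sum>l<N. \<eta> l \<omega> * (w i (\<tau> (Suc l)) \<omega> - w i (\<tau> l) \<omega>))"

end

section \<open>Elementary facts on partitions\<close>

lemma is_partition_less:
  assumes "is_partition a b N \<tau>" "j < l" "l \<le> N"
  shows "\<tau> j < \<tau> l"
  using assms(2,3)
proof (induction l)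
  case (Suc l)
  then have "\<tau> l < \<tau> (Suc l)" using assms(1) by (auto simp: is_partition_def)
  moreover have "\<tau> j \<le> \<tau> l" using Suc by (cases "j = l") auto
  ultimately show ?case by linarith
qed simp

lemma is_partition_le: "is_partition a b N \<tau> \<Longrightarrow> j \<le> l \<Longrightarrow> l \<le> N \<Longrightarrow> \<tau> j \<le> \<tau> l"
  using is_partition_less[of a b N \<tau> j l] by (cases "j = l") auto

lemma is_partition_bounds:
  assumes "is_partition a b N \<tau>" "l \<le> N"
  shows "a \<le> \<tau> l" "\<tau> l \<le> b"
  using is_partition_le[OF assms(1), of 0 l] is_partition_le[OF assms(1), of l N] assms by (auto simp: is_partition_def)

lemma is_partition_sum_telescope:
  fixes G :: "real \<Rightarrow> 'b::ab_group_add"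
  assumes "is_partition a b N \<tau>"
  shows "(\<Sum>l<N. G (\<tau> (Suc l)) - G (\<tau> l)) = G b - G a"
  using assms sum_lessThan_telescope[of "\<lambda>l. G (\<tau> l)" N] by (simp add: is_partition_def)

context wiener_setting
begin

lemma step_integral_adapted:
  assumes "i \<le> m" "0 \<le> a" "b \<le> T" "is_partition a b N \<tau>" "\<And>l. l < N \<Longrightarrow> adapted (\<tau> l) (\<eta> l)"
  shows "adapted b (step_integral i N \<tau> \<eta>)"
  unfolding step_integral_def[abs_def]
proof (rule adapted_sum)
  fix l assume "l \<in> {..<N}"
  then have l: "l < N" by simp
  have "\<tau> l \<ge> 0" "\<tau> l \<le> \<tau> (Suc l)" "\<tau> (Suc l) \<le> b"
    using is_partition_bounds[OF assms(4), of l] is_partition_bounds[OF assms(4), of "Suc l"]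
      is_partition_le[OF assms(4), of l "Suc l"] l assms by auto
  then show "adapted b (\<lambda>\<omega>. \<eta> l \<omega> * (w i (\<tau> (Suc l)) \<omega> - w i (\<tau> l) \<omega>))"
    using adapted_mono[OF adapted_increment_mult[of i "\<tau> l" "\<tau> (Suc l)" "\<eta> l"], of b] assms l by auto
qed

text \<open>Induction over the initial segments of the partition. The cross term vanishes: the
  earlier sum times \<open>\<eta> n\<close> is known at time \<open>\<tau> n\<close>, and the next
  increment is independent of it with mean zero.\<close>

lemma wiener_step_isometry:
  assumes i: "i \<in> {1..m}" and a: "0 \<le> a" and N: "n \<le> N"
    and p: "is_partition a b N \<tau>" and b: "b \<le> T" and \<eta>: "\<And>l. l < N \<Longrightarrow> adapted (\<tau> l) (\<eta> l)"
  shows "(nrm (step_integral i n \<tau> \<eta>))\<^sup>2 = (\<Sum>l<n. (nrm (\<eta> l))\<^sup>2 * (\<tau> (Suc l) - \<tau> l))"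
  using N
proof (induction n)
  case 0
  then show ?case by (simp add: step_integral_def[abs_def])
next
  case (Suc n)
  let ?S = "step_integral i n \<tau> \<eta>"
  let ?D = "\<lambda>\<omega>. f i (\<tau> (Suc n)) \<omega> - f i (\<tau> n) \<omega>"
  have n: "n < N" and uv: "0 \<le> \<tau> n" "\<tau> n < \<tau> (Suc n)" "\<tau> (Suc n) \<le> T"
    using is_partition_bounds[OF p, of n] is_partition_bounds[OF p, of "Suc n"]
      is_partition_less[OF p, of n "Suc n"] Suc.prems a b by auto
  \<comment> \<open>The first \<open>n\<close> intervals partition \<open>[a, \<tau> n]\<close>,
    which makes the partial sum adapted at \<open>\<tau> n\<close> and not just at
    \<open>b\<close>.\<close>
  have pn: "is_partition a (\<tau> n) n \<tau>" using p Suc.prems by (auto simp: is_partition_def)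
  have Sa: "adapted (\<tau> n) ?S"
    by (rule step_integral_adapted[OF _ a _ pn]) (use i \<eta> n uv in auto)
  have \<eta>n: "adapted (\<tau> n) (\<eta> n)" using \<eta> n by auto
  have Dsi: "sq_int (\<lambda>\<omega>. \<eta> n \<omega> * ?D \<omega>)" by (rule wiener_increment_mult(1)[OF i uv \<eta>n])
  have Dint: "integrable M ?D"
    by (rule square_integrable_imp_integrable[OF wiener_increment_moments(1)[OF i uv]])
  have S\<eta>: "integrable M (\<lambda>\<omega>. ?S \<omega> * \<eta> n \<omega>)"
    using Sa \<eta>n by (intro integrable_mult_square_integrable) (auto simp: adapted_def)
  have ind: "indep_var borel (\<lambda>\<omega>. ?S \<omega> * \<eta> n \<omega>) borel ?D"
    by (rule indep_var_filtration_increment[OF i uv]) (use Sa \<eta>n in \<open>auto simp: adapted_def\<close>)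
  have cross: "expectation (\<lambda>\<omega>. ?S \<omega> * (\<eta> n \<omega> * ?D \<omega>)) = 0" "integrable M (\<lambda>\<omega>. ?S \<omega> * (\<eta> n \<omega> * ?D \<omega>))"
    using indep_var_lebesgue_integral[OF ind S\<eta> Dint] indep_var_integrable[OF ind S\<eta> Dint]
      wiener_increment_moments(2)[OF i uv] by (simp_all add: mult.assoc)
  have eq: "(step_integral i (Suc n) \<tau> \<eta> \<omega>)\<^sup>2 = (?S \<omega>)\<^sup>2 + 2 * (?S \<omega> * (\<eta> n \<omega> * ?D \<omega>)) + (\<eta> n \<omega> * ?D \<omega>)\<^sup>2" for \<omega>
    using i by (auto simp: step_integral_def integrator_def power2_eq_square algebra_simps)
  have "(nrm (step_integral i (Suc n) \<tau> \<eta>))\<^sup>2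
     = expectation (\<lambda>\<omega>. (?S \<omega>)\<^sup>2 + 2 * (?S \<omega> * (\<eta> n \<omega> * ?D \<omega>)) + (\<eta> n \<omega> * ?D \<omega>)\<^sup>2)"
    unfolding l2norm_power2 eq ..
  also have "\<dots> = expectation (\<lambda>\<omega>. (?S \<omega>)\<^sup>2) + 2 * expectation (\<lambda>\<omega>. ?S \<omega> * (\<eta> n \<omega> * ?D \<omega>)) + expectation (\<lambda>\<omega>. (\<eta> n \<omega> * ?D \<omega>)\<^sup>2)"
    using adapted_sq_int[OF Sa] Dsi cross(2) by (simp add: square_integrable_def)
  also have "\<dots> = (nrm ?S)\<^sup>2 + (nrm (\<eta> n))\<^sup>2 * (\<tau> (Suc n) - \<tau> n)"
    using cross(1) wiener_increment_mult(2)[OF i uv \<eta>n] by (simp add: l2norm_power2)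
  finally show ?case using Suc by simp
qed

text \<open>Cauchy-Schwarz at each \<open>\<omega>\<close> for the weights
  \<open>\<tau> (Suc l) - \<tau> l\<close>, whose total mass is \<open>b - a\<close>, followed by
  integration over \<open>\<omega>\<close>.\<close>

lemma time_step_bound:
  assumes p: "is_partition a b N \<tau>" and \<eta>: "\<And>l. l < N \<Longrightarrow> sq_int (\<eta> l)"
  shows "(nrm (\<lambda>\<omega>. \<Sum>l<N. \<eta> l \<omega> * (\<tau> (Suc l) - \<tau> l)))\<^sup>2 \<le> (b - a) * (\<Sum>l<N. (nrm (\<eta> l))\<^sup>2 * (\<tau> (Suc l) - \<tau> l))"
proof -
  have pos: "0 < \<tau> (Suc l) - \<tau> l" if "l < N" for l using p that by (auto simp: is_partition_def)
  have CS: "(\<Sum>l<N. x l * (\<tau> (Suc l) - \<tau> l))\<^sup>2 \<le> (b - a) * (\<Sum>l<N. (x l)\<^sup>2 * (\<tau> (Suc l) - \<tau> l))" for x :: "nat \<Rightarrow> real"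
  proof -
    have "(\<Sum>l<N. x l * (\<tau> (Suc l) - \<tau> l)) = (\<Sum>l<N. sqrt (\<tau> (Suc l) - \<tau> l) * (x l * sqrt (\<tau> (Suc l) - \<tau> l)))"
    proof (intro sum.cong refl)
      fix l assume "l \<in> {..<N}"
      then have "sqrt (\<tau> (Suc l) - \<tau> l) * sqrt (\<tau> (Suc l) - \<tau> l) = \<tau> (Suc l) - \<tau> l"
        using pos[of l] by simp
      then show "x l * (\<tau> (Suc l) - \<tau> l) = sqrt (\<tau> (Suc l) - \<tau> l) * (x l * sqrt (\<tau> (Suc l) - \<tau> l))"
        by (metis mult.assoc mult.commute)
    qed
    also have "(\<dots>)\<^sup>2 \<le> (\<Sum>l<N. (sqrt (\<tau> (Suc l) - \<tau> l))\<^sup>2) * (\<Sum>l<N. (x l * sqrt (\<tau> (Suc l) - \<tau> l))\<^sup>2)"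
      by (rule Cauchy_Schwarz_ineq_sum)
    also have "(\<Sum>l<N. (sqrt (\<tau> (Suc l) - \<tau> l))\<^sup>2) = (\<Sum>l<N. \<tau> (Suc l) - \<tau> l)"
      by (intro sum.cong refl) (use pos in \<open>simp add: less_imp_le\<close>)
    also have "\<dots> = b - a" using is_partition_sum_telescope[OF p, of "\<lambda>x. x"] by simp
    also have "(\<Sum>l<N. (x l * sqrt (\<tau> (Suc l) - \<tau> l))\<^sup>2) = (\<Sum>l<N. (x l)\<^sup>2 * (\<tau> (Suc l) - \<tau> l))"
      by (intro sum.cong refl) (use pos in \<open>simp add: power_mult_distrib less_imp_le\<close>)
    finally show ?thesis .
  qed
  have si: "sq_int (\<lambda>\<omega>. \<Sum>l<N. \<eta> l \<omega> * (\<tau> (Suc l) - \<tau> l))"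
    by (intro square_integrable_sum) (subst mult.commute, intro square_integrable_cmult \<eta>, simp)
  have "(nrm (\<lambda>\<omega>. \<Sum>l<N. \<eta> l \<omega> * (\<tau> (Suc l) - \<tau> l)))\<^sup>2 \<le> expectation (\<lambda>\<omega>. (b - a) * (\<Sum>l<N. (\<eta> l \<omega>)\<^sup>2 * (\<tau> (Suc l) - \<tau> l)))"
    unfolding l2norm_power2 using si \<eta> CS
    by (intro integral_mono) (auto simp: square_integrable_def)
  also have "\<dots> = (b - a) * (\<Sum>l<N. (nrm (\<eta> l))\<^sup>2 * (\<tau> (Suc l) - \<tau> l))"
    using \<eta> by (simp add: square_integrable_def l2norm_power2)
  finally show ?thesis .
qed

text \<open>\<open>T + 1\<close> dominates both constants that occur: 1 from the isometry and
  \<open>b - a\<close>, which is at most \<open>T\<close>, from the time integral.\<close>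

lemma step_integral_bound:
  assumes i: "i \<le> m" and ab: "0 \<le> a" "b \<le> T" and p: "is_partition a b N \<tau>"
    and \<eta>: "\<And>l. l < N \<Longrightarrow> adapted (\<tau> l) (\<eta> l)"
  shows "(nrm (step_integral i N \<tau> \<eta>))\<^sup>2 \<le> (T + 1) * (\<Sum>l<N. (nrm (\<eta> l))\<^sup>2 * (\<tau> (Suc l) - \<tau> l))"
proof -
  have pos: "0 \<le> (\<Sum>l<N. (nrm (\<eta> l))\<^sup>2 * (\<tau> (Suc l) - \<tau> l))"
    using p by (intro sum_nonneg mult_nonneg_nonneg) (auto simp: is_partition_def less_imp_le)
  have ab': "a \<le> b" using is_partition_bounds[OF p, of 0] p by (auto simp: is_partition_def)
  show ?thesis
  proof (cases "i = 0")
    case True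
    have "step_integral i N \<tau> \<eta> = (\<lambda>\<omega>. \<Sum>l<N. \<eta> l \<omega> * (\<tau> (Suc l) - \<tau> l))"
      using True by (auto simp: step_integral_def integrator_def)
    then have "(nrm (step_integral i N \<tau> \<eta>))\<^sup>2 \<le> (b - a) * (\<Sum>l<N. (nrm (\<eta> l))\<^sup>2 * (\<tau> (Suc l) - \<tau> l))"
      using time_step_bound[OF p, of \<eta>] \<eta> by (simp add: adapted_def)
    also have "\<dots> \<le> (T + 1) * (\<Sum>l<N. (nrm (\<eta> l))\<^sup>2 * (\<tau> (Suc l) - \<tau> l))"
      using ab pos by (intro mult_right_mono) auto
    finally show ?thesis .
  next
    case False
    then have "(nrm (step_integral i N \<tau> \<eta>))\<^sup>2 = 1 * (\<Sum>l<N. (nrm (\<eta> l))\<^sup>2 * (\<tau> (Suc l) - \<tau> l))"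
      using wiener_step_isometry[of i a N N b \<tau> \<eta>] assms by auto
    also have "\<dots> \<le> (T + 1) * (\<Sum>l<N. (nrm (\<eta> l))\<^sup>2 * (\<tau> (Suc l) - \<tau> l))"
      using ab ab' pos by (intro mult_right_mono) auto
    finally show ?thesis .
  qed
qed

end

section \<open>Refinement and concatenation of partitions\<close>

lemma is_partition_find:
  assumes p: "is_partition a b N \<tau>" and x: "a \<le> x" "x < b"
  shows "\<exists>l<N. \<tau> l \<le> x \<and> x < \<tau> (Suc l)"
proof -
  define n where "n = (LEAST n. x < \<tau> n)"
  have N: "x < \<tau> N" using p x by (simp add: is_partition_def)
  have n: "x < \<tau> n" unfolding n_def by (rule LeastI[of "\<lambda>n. x < \<tau> n", OF N])
  have nN: "n \<le> N" unfolding n_def by (rule Least_le[of "\<lambda>n. x < \<tau> n", OF N])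
  have "n \<noteq> 0" using n x p by (auto simp: is_partition_def intro: ccontr)
  then obtain l where l: "n = Suc l" using not0_implies_Suc by blast
  have "\<not> x < \<tau> l" using not_less_Least[of l "\<lambda>n. x < \<tau> n"] l unfolding n_def by simp
  then show ?thesis using n nN l by (intro exI[of _ l]) auto
qed

text \<open>The index map \<open>p\<close> is kept explicit, since it transports step values: the
  coarse values \<open>\<eta>\<close> become \<open>\<eta> (p j)\<close> on the fine
  partition.\<close>

definition refines :: "nat \<Rightarrow> (nat \<Rightarrow> real) \<Rightarrow> nat \<Rightarrow> (nat \<Rightarrow> real) \<Rightarrow> (nat \<Rightarrow> nat) \<Rightarrow> bool" where
  "refines K \<sigma> N \<tau> p \<longleftrightarrow> (\<forall>j<K. p j < N \<and> \<tau> (p j) \<le> \<sigma> j \<and> \<sigma> (Suc j) \<le> \<tau> (Suc (p j)))"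

lemma refinesI_points:
  assumes p: "is_partition a b N \<tau>" and s: "is_partition a b K \<sigma>" and sub: "\<tau> ` {..N} \<subseteq> \<sigma> ` {..K}"
  shows "\<exists>p. refines K \<sigma> N \<tau> p"
proof -
  have "\<exists>l. l < N \<and> \<tau> l \<le> \<sigma> j \<and> \<sigma> (Suc j) \<le> \<tau> (Suc l)" if j: "j < K" for j
  proof -
    have "a \<le> \<sigma> j" "\<sigma> j < b"
      using is_partition_bounds[OF s, of j] is_partition_less[OF s, of j K] s j by (auto simp: is_partition_def)
    from is_partition_find[OF p this] obtain l where l: "l < N" "\<tau> l \<le> \<sigma> j" "\<sigma> j < \<tau> (Suc l)" by blast
    then have "\<tau> (Suc l) \<in> \<sigma> ` {..K}" by (intro subsetD[OF sub] imageI) simp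
    then obtain n where n: "n \<le> K" "\<tau> (Suc l) = \<sigma> n" by auto
    have "\<not> n \<le> j" using l(3) n is_partition_le[OF s, of n j] j by fastforce
    then have "\<sigma> (Suc j) \<le> \<tau> (Suc l)" using n is_partition_le[OF s, of "Suc j" n] by fastforce
    with l show ?thesis by blast
  qed
  then show ?thesis unfolding refines_def by metis
qed

lemma is_partition_of_finite_set:
  assumes "finite S" "a \<in> S" "b \<in> S" "S \<subseteq> {a..b}"
  shows "\<exists>K \<sigma>. is_partition a b K \<sigma> \<and> S = \<sigma> ` {..K}"
proof -
  let ?xs = "sorted_list_of_set S"
  define K where "K = length ?xs - 1"
  have set: "set ?xs = S" using assms by simp
  have sorted: "sorted_wrt (<) ?xs" by simp
  have len: "length ?xs = Suc K" using assms set K_def by (cases ?xs) auto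
  have mono: "?xs ! l < ?xs ! n" if "l < n" "n \<le> K" for l n
    using sorted_wrt_nth_less[OF sorted that(1)] that len by simp
  have S: "S = (!) ?xs ` {..K}"
    using set_conv_nth[of ?xs] len set by (auto simp: image_iff less_Suc_eq_le)
  have mem: "?xs ! n \<in> S" if "n \<le> K" for n
    using nth_mem[of n ?xs] set len that by simp
  have first: "?xs ! 0 = a"
  proof -
    obtain n where n: "n \<le> K" "?xs ! n = a" using assms(2) S by (metis imageE atMost_iff)
    have "a \<le> ?xs ! 0" using mem[of 0] assms(4) by auto
    then show ?thesis using mono[of 0 n] n by (cases n) auto
  qed
  have last: "?xs ! K = b"
  proof -
    obtain n where n: "n \<le> K" "?xs ! n = b" using assms(3) S by (metis imageE atMost_iff)
    have "?xs ! K \<le> b" using mem[of K] assms(4) by auto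
    then show ?thesis using mono[of n K] n by (cases "n = K") auto
  qed
  have "is_partition a b K ((!) ?xs)"
    using first last mono by (simp add: is_partition_def)
  then show ?thesis using S by blast
qed

lemma common_refinement:
  assumes p: "is_partition a b N \<tau>" and q: "is_partition a b N' \<tau>'"
  obtains K \<sigma> p q where "is_partition a b K \<sigma>" "refines K \<sigma> N \<tau> p" "refines K \<sigma> N' \<tau>' q"
proof -
  let ?S = "\<tau> ` {..N} \<union> \<tau>' ` {..N'}"
  have "a \<in> ?S" "b \<in> ?S" using p by (auto simp: is_partition_def image_iff)
  moreover have "?S \<subseteq> {a..b}"
    using is_partition_bounds[OF p] is_partition_bounds[OF q] by auto
  ultimately obtain K \<sigma> where s: "is_partition a b K \<sigma>" "?S = \<sigma> ` {..K}"
    using is_partition_of_finite_set[of ?S a b] by auto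
  show thesis
    using refinesI_points[OF p s(1)] refinesI_points[OF q s(1)] s that by blast
qed

text \<open>\<open>G\<close> is an arbitrary function so that it can be a path of any integrator.
  Clipping at \<open>x\<close> writes \<open>G x - G a\<close> as a sum over all fine intervals; the
  values at two coarse points can then be subtracted term by term, without listing the fine
  intervals inside a coarse one.\<close>

lemma refines_sum:
  fixes G :: "real \<Rightarrow> real"
  assumes t: "is_partition a b N \<tau>" and s: "is_partition a b K \<sigma>" and r: "refines K \<sigma> N \<tau> p"
  shows "(\<Sum>l<N. g l * (G (\<tau> (Suc l)) - G (\<tau> l))) = (\<Sum>j<K. g (p j) * (G (\<sigma> (Suc j)) - G (\<sigma> j)))"
proof -
  (* the part of the increment of G over [a,x] that falls into the j-th interval of sigma *)
  define D where "D x j = G (max (\<sigma> j) (min x (\<sigma> (Suc j)))) - G (\<sigma> j)" for x j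
  have D: "(\<Sum>j<n. D x j) = G (min x (\<sigma> n)) - G a" if "a \<le> x" "n \<le> K" for x n
    using that(2)
  proof (induction n)
    case 0
    then show ?case using s that by (simp add: is_partition_def min_absorb2)
  next
    case (Suc n)
    have "\<sigma> n < \<sigma> (Suc n)" using s Suc.prems by (simp add: is_partition_def)
    then have "D x n = G (min x (\<sigma> (Suc n))) - G (min x (\<sigma> n))"
      unfolding D_def by (cases "x \<le> \<sigma> n") (auto simp: min_def max_def)
    with Suc show ?case by simp
  qed
  \<comment> \<open>A fine interval counts in full for the coarse interval containing it. For any
    other coarse interval, clipping at its two endpoints gives the same value.\<close>
  have D': "D (\<tau> (Suc l)) j - D (\<tau> l) j = (if p j = l then G (\<sigma> (Suc j)) - G (\<sigma> j) else 0)"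
    if l: "l < N" and j: "j < K" for l j
  proof -
    have pj: "p j < N" "\<tau> (p j) \<le> \<sigma> j" "\<sigma> (Suc j) \<le> \<tau> (Suc (p j))" "\<sigma> j < \<sigma> (Suc j)"
      using r s j by (auto simp: refines_def is_partition_def)
    have tl: "\<tau> l < \<tau> (Suc l)" using t l by (simp add: is_partition_def)
    consider "p j = l" | "Suc (p j) \<le> l" | "Suc l \<le> p j" by linarith
    then show ?thesis
    proof cases
      case 1
      then show ?thesis using pj by (auto simp: D_def min_def max_def)
    next
      case 2
      then have "\<tau> (Suc (p j)) \<le> \<tau> l" using is_partition_le[OF t, of "Suc (p j)" l] l by simp
      then have "\<sigma> (Suc j) \<le> \<tau> l" "\<sigma> (Suc j) \<le> \<tau> (Suc l)" using pj tl by linarith+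
      then show ?thesis using 2 by (simp add: D_def min_absorb2)
    next
      case 3
      then have "\<tau> (Suc l) \<le> \<tau> (p j)" using is_partition_le[OF t, of "Suc l" "p j"] pj by simp
      then have "\<tau> l \<le> \<sigma> j" "\<tau> (Suc l) \<le> \<sigma> j" using pj tl by linarith+
      then show ?thesis using 3 by (simp add: D_def min.coboundedI1 max_absorb1)
    qed
  qed
  have inc: "G (\<tau> (Suc l)) - G (\<tau> l) = (\<Sum>j<K. if p j = l then G (\<sigma> (Suc j)) - G (\<sigma> j) else 0)" if l: "l < N" for l
  proof -
    have b: "a \<le> \<tau> l" "\<tau> l \<le> b" "a \<le> \<tau> (Suc l)" "\<tau> (Suc l) \<le> b"
      using is_partition_bounds[OF t, of l] is_partition_bounds[OF t, of "Suc l"] l by auto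
    have "(\<Sum>j<K. D (\<tau> (Suc l)) j - D (\<tau> l) j) = G (\<tau> (Suc l)) - G (\<tau> l)"
      using D[OF b(1) order_refl] D[OF b(3) order_refl] b s
      by (simp add: sum_subtractf is_partition_def min_absorb1)
    moreover have "(\<Sum>j<K. D (\<tau> (Suc l)) j - D (\<tau> l) j) = (\<Sum>j<K. if p j = l then G (\<sigma> (Suc j)) - G (\<sigma> j) else 0)"
      by (intro sum.cong refl D'[OF l]) simp
    ultimately show ?thesis by simp
  qed
  have "(\<Sum>l<N. g l * (G (\<tau> (Suc l)) - G (\<tau> l)))
      = (\<Sum>l<N. \<Sum>j<K. if p j = l then g l * (G (\<sigma> (Suc j)) - G (\<sigma> j)) else 0)"
    by (intro sum.cong refl) (simp add: inc sum_distrib_left if_distrib cong: if_cong)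
  also have "\<dots> = (\<Sum>j<K. \<Sum>l<N. if p j = l then g l * (G (\<sigma> (Suc j)) - G (\<sigma> j)) else 0)"
    by (rule sum.swap)
  also have "\<dots> = (\<Sum>j<K. g (p j) * (G (\<sigma> (Suc j)) - G (\<sigma> j)))"
    using r by (intro sum.cong refl) (auto simp: refines_def)
  finally show ?thesis .
qed

lemma sum_lessThan_add:
  fixes g :: "nat \<Rightarrow> 'b::comm_monoid_add"
  shows "(\<Sum>l<N + N'. g l) = (\<Sum>l<N. g l) + (\<Sum>l<N'. g (N + l))"
  by (induction N') (auto simp: add.assoc)

text \<open>One operation serves both the points and the step values. Index \<open>N\<close> already
  reads from the second sequence; for points this changes nothing, because both sequences pass
  through the junction there.\<close>

definition concat_partition :: "nat \<Rightarrow> (nat \<Rightarrow> 'b) \<Rightarrow> (nat \<Rightarrow> 'b) \<Rightarrow> nat \<Rightarrow> 'b" where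
  "concat_partition N g h l = (if l < N then g l else h (l - N))"

lemma concat_partition_Suc:
  assumes "is_partition a c N \<tau>" "is_partition c b N' \<tau>'"
  shows "l < N \<Longrightarrow> concat_partition N \<tau> \<tau>' (Suc l) = \<tau> (Suc l)"
    and "l < N \<Longrightarrow> concat_partition N \<tau> \<tau>' l = \<tau> l"
    and "concat_partition N \<tau> \<tau>' (N + l) = \<tau>' l"
    and "concat_partition N \<tau> \<tau>' (Suc (N + l)) = \<tau>' (Suc l)"
  using assms by (auto simp: concat_partition_def is_partition_def not_less less_Suc_eq_le le_antisym Suc_diff_le)
     (metis Suc_leI le_antisym)

lemma is_partition_concat:
  assumes p: "is_partition a c N \<tau>" and q: "is_partition c b N' \<tau>'"
  shows "is_partition a b (N + N') (concat_partition N \<tau> \<tau>')"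
  unfolding is_partition_def
proof (intro conjI allI impI)
  note c = concat_partition_Suc[OF p q]
  show "concat_partition N \<tau> \<tau>' 0 = a" using p q by (cases N) (auto simp: concat_partition_def is_partition_def)
  show "concat_partition N \<tau> \<tau>' (N + N') = b" using c(3)[of N'] q by (simp add: is_partition_def)
  fix l assume l: "l < N + N'"
  show "concat_partition N \<tau> \<tau>' l < concat_partition N \<tau> \<tau>' (Suc l)"
  proof (cases "l < N")
    case True
    then show ?thesis using c(1,2)[of l] p by (simp add: is_partition_def)
  next
    case False
    then obtain j where "l = N + j" "j < N'" using l by (metis add_less_cancel_left le_Suc_ex not_less)
    then show ?thesis using c(3,4)[of j] q by (simp add: is_partition_def)
  qed
qed

lemma is_partition_trivial: "is_partition a a 0 (\<lambda>_. a)"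
  by (simp add: is_partition_def)

lemma is_partition_exists:
  assumes "a \<le> b" "\<delta> > 0"
  shows "\<exists>N \<tau>. is_partition a b N \<tau> \<and> (\<forall>l<N. \<tau> (Suc l) - \<tau> l < \<delta>)"
proof (cases "a = b")
  case True
  then show ?thesis using is_partition_trivial by (intro exI[of _ 0] exI[of _ "\<lambda>_. a"]) auto
next
  case False
  obtain n where n: "(b - a) / \<delta> < real n" using reals_Archimedean2 by blast
  have pos: "0 < real n" using n assms False by (smt (verit) divide_nonneg_pos)
  define c where "c = (b - a) / real n"
  define \<tau> where "\<tau> l = a + real l * c" for l
  have "c < \<delta>" "0 < c" "real n * c = b - a"
    using n pos assms False by (simp_all add: c_def field_simps)
  then have "is_partition a b n \<tau> \<and> (\<forall>l<n. \<tau> (Suc l) - \<tau> l < \<delta>)"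
    unfolding is_partition_def \<tau>_def by (simp add: distrib_right)
  then show ?thesis by blast
qed

text \<open>\<open>has_partition_limit\<close> quantifies over all refining sequences, so it
  determines its limit only because such a sequence exists.\<close>

lemma refining_partitions_exist:
  assumes "a \<le> b"
  obtains N \<tau> where "refining_partitions a b N \<tau>"
proof -
  have "\<forall>n. \<exists>K \<sigma>. is_partition a b K \<sigma> \<and> (\<forall>l<K. \<sigma> (Suc l) - \<sigma> l < 1 / real (Suc n))"
    using is_partition_exists[OF assms] by simp
  then obtain N \<tau> where p: "\<And>n. is_partition a b (N n) (\<tau> n) \<and> (\<forall>l<N n. \<tau> n (Suc l) - \<tau> n l < 1 / real (Suc n))"
    by metis
  have "\<forall>\<^sub>F n in sequentially. \<forall>l<N n. \<tau> n (Suc l) - \<tau> n l < \<delta>" if d: "\<delta> > 0" for \<delta>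
  proof -
    have "(\<lambda>n. 1 / real (Suc n)) \<longlonglongrightarrow> 0" using LIMSEQ_inverse_real_of_nat by (simp add: inverse_eq_divide)
    then have "\<forall>\<^sub>F n in sequentially. 1 / real (Suc n) < \<delta>" using order_tendstoD(2) d by blast
    then show ?thesis by eventually_elim (use p in \<open>meson less_trans\<close>)
  qed
  then show thesis using p that unfolding refining_partitions_def by blast
qed

lemma has_partition_limit_unique:
  assumes "a \<le> b" and X: "has_partition_limit M a b S X" and Y: "has_partition_limit M a b S' Y"
    and eq: "\<And>N \<tau>. is_partition a b N \<tau> \<Longrightarrow> AE \<omega> in M. S N \<tau> \<omega> = S' N \<tau> \<omega>"
  shows "AE \<omega> in M. X \<omega> = Y \<omega>"
proof -
  obtain N \<tau> where p: "refining_partitions a b N \<tau>" using refining_partitions_exist[OF assms(1)] .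
  show ?thesis
    by (rule ms_limit_unique[of M "\<lambda>n. S (N n) (\<tau> n)" X "\<lambda>n. S' (N n) (\<tau> n)"])
      (use p X Y eq in \<open>auto simp: has_partition_limit_def refining_partitions_def\<close>)
qed

section \<open>The integral of regulated adapted processes\<close>

lemma l2norm_bounded_mult_le:
  assumes X: "square_integrable M X" and c: "c \<in> borel_measurable M" "\<And>\<omega>. \<bar>c \<omega>\<bar> \<le> B"
  shows "l2norm M (\<lambda>\<omega>. c \<omega> * X \<omega>) \<le> B * l2norm M X"
proof -
  have B: "0 \<le> B" using c(2)[of undefined] abs_ge_zero[of "c undefined"] by linarith
  have c2: "(c \<omega>)\<^sup>2 \<le> B\<^sup>2" for \<omega> using c(2)[of \<omega>] B by (simp flip: abs_le_square_iff)
  have int: "integrable M (\<lambda>\<omega>. (c \<omega> * X \<omega>)\<^sup>2)" "integrable M (\<lambda>\<omega>. B\<^sup>2 * (X \<omega>)\<^sup>2)"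
    using X square_integrable_bounded_mult[OF X c] by (simp_all add: square_integrable_def)
  have "(\<integral>\<omega>. (c \<omega> * X \<omega>)\<^sup>2 \<partial>M) \<le> (\<integral>\<omega>. B\<^sup>2 * (X \<omega>)\<^sup>2 \<partial>M)"
    by (rule integral_mono[OF int]) (simp add: power_mult_distrib mult_right_mono c2)
  then have "(l2norm M (\<lambda>\<omega>. c \<omega> * X \<omega>))\<^sup>2 \<le> (B * l2norm M X)\<^sup>2"
    by (simp add: power_mult_distrib l2norm_power2)
  then show ?thesis by (rule power2_le_imp_le) (simp add: B)
qed

context wiener_setting
begin

text \<open>Closeness is uniform in \<open>s\<close>. The half-open intervals leave the value at
  \<open>b\<close> unconstrained, in accordance with the fact that the integral does not see
  it.\<close>

definition approximates ::
    "real \<Rightarrow> real \<Rightarrow> (real \<Rightarrow> 'a \<Rightarrow> real) \<Rightarrow> real \<Rightarrow> nat \<Rightarrow> (nat \<Rightarrow> real) \<Rightarrow> (nat \<Rightarrow> 'a \<Rightarrow> real) \<Rightarrow> bool" where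
  "approximates a b H \<epsilon> N \<tau> \<eta> \<longleftrightarrow> is_partition a b N \<tau> \<and>
     (\<forall>l<N. adapted (\<tau> l) (\<eta> l)) \<and>
     (\<forall>l<N. \<forall>s\<in>{\<tau> l..<\<tau> (Suc l)}. sq_int (H s) \<and> nrm (\<lambda>\<omega>. H s \<omega> - \<eta> l \<omega>) \<le> \<epsilon>)"

lemma approximatesD:
  assumes "approximates a b H \<epsilon> N \<tau> \<eta>"
  shows "is_partition a b N \<tau>" "l < N \<Longrightarrow> adapted (\<tau> l) (\<eta> l)"
    and "l < N \<Longrightarrow> \<tau> l \<le> s \<Longrightarrow> s < \<tau> (Suc l) \<Longrightarrow> sq_int (H s)"
    and "l < N \<Longrightarrow> \<tau> l \<le> s \<Longrightarrow> s < \<tau> (Suc l) \<Longrightarrow> nrm (\<lambda>\<omega>. H s \<omega> - \<eta> l \<omega>) \<le> \<epsilon>"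
  using assms by (auto simp: approximates_def)

text \<open>The closure of the graph of the step integral under uniform mean-square approximation.
  As a relation it passes linearity, concatenation and bounds from step processes to their limits by
  a single choice of approximation.\<close>

definition has_int :: "nat \<Rightarrow> real \<Rightarrow> real \<Rightarrow> (real \<Rightarrow> 'a \<Rightarrow> real) \<Rightarrow> ('a \<Rightarrow> real) \<Rightarrow> bool" where
  "has_int i a b H X \<longleftrightarrow> adapted b X \<and>
     (\<forall>\<epsilon>>0. \<exists>N \<tau> \<eta>. approximates a b H \<epsilon> N \<tau> \<eta> \<and> nrm (\<lambda>\<omega>. X \<omega> - step_integral i N \<tau> \<eta> \<omega>) \<le> \<epsilon>)"

lemma has_int_adapted: "has_int i a b H X \<Longrightarrow> adapted b X"
  and has_int_sq_int: "has_int i a b H X \<Longrightarrow> sq_int X"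
  by (simp_all add: has_int_def adapted_def)

lemma adapted_refine:
  assumes "0 \<le> a" "b \<le> T" "is_partition a b N \<tau>" "is_partition a b K \<sigma>" "refines K \<sigma> N \<tau> p"
    and "\<And>l. l < N \<Longrightarrow> adapted (\<tau> l) (\<eta> l)" "j < K"
  shows "adapted (\<sigma> j) (\<eta> (p j))"
proof -
  have p: "p j < N" "\<tau> (p j) \<le> \<sigma> j" using assms(5,7) by (auto simp: refines_def)
  have "0 \<le> \<tau> (p j)" "\<sigma> j \<le> T"
    using is_partition_bounds[OF assms(3), of "p j"] is_partition_bounds[OF assms(4), of j] p assms(1,2,7) by auto
  then show ?thesis using adapted_mono[OF assms(6)[OF p(1)]] p(2) by blast
qed

lemma step_integral_refine:
  assumes "is_partition a b N \<tau>" "is_partition a b K \<sigma>" "refines K \<sigma> N \<tau> p"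
  shows "step_integral i N \<tau> \<eta> = step_integral i K \<sigma> (\<lambda>j. \<eta> (p j))"
proof
  fix \<omega>
  show "step_integral i N \<tau> \<eta> \<omega> = step_integral i K \<sigma> (\<lambda>j. \<eta> (p j)) \<omega>"
    unfolding step_integral_def by (rule refines_sum[OF assms, of "\<lambda>l. \<eta> l \<omega>" "\<lambda>u. w i u \<omega>"])
qed

lemma approximates_refine:
  assumes ab: "0 \<le> a" "b \<le> T" and H: "approximates a b H \<epsilon> N \<tau> \<eta>"
    and s: "is_partition a b K \<sigma>" and r: "refines K \<sigma> N \<tau> p"
  shows "approximates a b H \<epsilon> K \<sigma> (\<lambda>j. \<eta> (p j))"
proof -
  note D = approximatesD[OF H]
  have "sq_int (H u) \<and> nrm (\<lambda>\<omega>. H u \<omega> - \<eta> (p j) \<omega>) \<le> \<epsilon>" if "j < K" "u \<in> {\<sigma> j..<\<sigma> (Suc j)}" for j u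
  proof -
    have "p j < N" "\<tau> (p j) \<le> u" "u < \<tau> (Suc (p j))" using r that by (auto simp: refines_def)
    then show ?thesis using D(3,4) by blast
  qed
  then show ?thesis
    using s adapted_refine[OF ab D(1) s r D(2)] unfolding approximates_def by blast
qed

lemma common_approximation:
  assumes ab: "0 \<le> a" "b \<le> T"
    and H: "approximates a b H \<epsilon> N \<tau> \<eta>" and H': "approximates a b H' \<epsilon>' N' \<tau>' \<eta>'"
  obtains K \<sigma> \<zeta> \<zeta>' where "approximates a b H \<epsilon> K \<sigma> \<zeta>" "approximates a b H' \<epsilon>' K \<sigma> \<zeta>'"
    "step_integral i N \<tau> \<eta> = step_integral i K \<sigma> \<zeta>" "step_integral i N' \<tau>' \<eta>' = step_integral i K \<sigma> \<zeta>'"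
proof -
  obtain K \<sigma> p q where s: "is_partition a b K \<sigma>" and r: "refines K \<sigma> N \<tau> p" "refines K \<sigma> N' \<tau>' q"
    using common_refinement[OF approximatesD(1)[OF H] approximatesD(1)[OF H']] .
  show thesis
    by (rule that[OF approximates_refine[OF ab H s r(1)] approximates_refine[OF ab H' s r(2)]
          step_integral_refine[OF approximatesD(1)[OF H] s r(1)]
          step_integral_refine[OF approximatesD(1)[OF H'] s r(2)]])
qed

text \<open>The length \<open>b - a\<close> stays under the root: it makes integrals over short
  intervals small, which later yields continuity in the upper limit.\<close>

lemma step_integral_sup_bound:
  assumes i: "i \<le> m" and ab: "0 \<le> a" "b \<le> T" and p: "is_partition a b N \<tau>"
    and \<eta>: "\<And>l. l < N \<Longrightarrow> adapted (\<tau> l) (\<eta> l)" and d: "\<And>l. l < N \<Longrightarrow> nrm (\<eta> l) \<le> d" "0 \<le> d"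
  shows "nrm (step_integral i N \<tau> \<eta>) \<le> sqrt ((T + 1) * (b - a)) * d"
proof -
  have le: "a \<le> b" using is_partition_bounds[OF p, of 0] p by (simp add: is_partition_def)
  have c: "0 \<le> (T + 1) * (b - a)" using ab le by (intro mult_nonneg_nonneg) auto
  have pos: "0 \<le> \<tau> (Suc l) - \<tau> l" if "l < N" for l
    using is_partition_le[OF p, of l "Suc l"] that by simp
  have "(nrm (step_integral i N \<tau> \<eta>))\<^sup>2 \<le> (T + 1) * (\<Sum>l<N. (nrm (\<eta> l))\<^sup>2 * (\<tau> (Suc l) - \<tau> l))"
    by (rule step_integral_bound[OF i ab p \<eta>])
  also have "\<dots> \<le> (T + 1) * (\<Sum>l<N. d\<^sup>2 * (\<tau> (Suc l) - \<tau> l))"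
    using ab le pos d(1) by (intro mult_left_mono sum_mono mult_right_mono power_mono) auto
  also have "\<dots> = (T + 1) * (d\<^sup>2 * (b - a))"
    by (simp only: sum_distrib_left[symmetric] is_partition_sum_telescope[OF p, of "\<lambda>x. x"])
  also have "\<dots> = (sqrt ((T + 1) * (b - a)) * d)\<^sup>2"
    using c by (simp add: power_mult_distrib mult.commute mult.left_commute)
  finally show ?thesis by (rule power2_le_imp_le) (use d(2) c in simp)
qed

lemma step_integral_diff:
  "step_integral i N \<tau> (\<lambda>l \<omega>. \<eta> l \<omega> - \<eta>' l \<omega>) \<omega> = step_integral i N \<tau> \<eta> \<omega> - step_integral i N \<tau> \<eta>' \<omega>"
  by (simp add: step_integral_def left_diff_distrib sum_subtractf)

text \<open>On a common refinement both step values on an interval are compared with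
  \<open>H\<close> at its left endpoint, hence they differ by at most the sum of the two
  errors.\<close>

lemma approximates_step_dist:
  assumes i: "i \<le> m" and ab: "0 \<le> a" "b \<le> T"
    and H: "approximates a b H \<epsilon> N \<tau> \<eta>" and H': "approximates a b H \<epsilon>' N' \<tau>' \<eta>'"
    and e: "0 \<le> \<epsilon>" "0 \<le> \<epsilon>'"
  shows "nrm (\<lambda>\<omega>. step_integral i N \<tau> \<eta> \<omega> - step_integral i N' \<tau>' \<eta>' \<omega>) \<le> sqrt ((T + 1) * (b - a)) * (\<epsilon> + \<epsilon>')"
proof -
  obtain K \<sigma> \<zeta> \<zeta>' where A: "approximates a b H \<epsilon> K \<sigma> \<zeta>" "approximates a b H \<epsilon>' K \<sigma> \<zeta>'"
    and eq: "step_integral i N \<tau> \<eta> = step_integral i K \<sigma> \<zeta>" "step_integral i N' \<tau>' \<eta>' = step_integral i K \<sigma> \<zeta>'"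
    using common_approximation[OF ab H H'] .
  note D = approximatesD[OF A(1)] and D' = approximatesD[OF A(2)]
  have "nrm (\<lambda>\<omega>. \<zeta> j \<omega> - \<zeta>' j \<omega>) \<le> \<epsilon> + \<epsilon>'" if j: "j < K" for j
  proof -
    have s: "\<sigma> j < \<sigma> (Suc j)" using D(1) j by (simp add: is_partition_def)
    have "nrm (\<lambda>\<omega>. \<zeta> j \<omega> - \<zeta>' j \<omega>) \<le> nrm (\<lambda>\<omega>. \<zeta> j \<omega> - H (\<sigma> j) \<omega>) + nrm (\<lambda>\<omega>. H (\<sigma> j) \<omega> - \<zeta>' j \<omega>)"
      by (rule l2norm_triangle_diff)
        (use D(2)[OF j] D'(2)[OF j] D(3)[OF j order_refl s] in \<open>auto simp: adapted_def\<close>)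
    then show ?thesis
      using D(4)[OF j order_refl s] D'(4)[OF j order_refl s] l2norm_minus_commute[of M "\<zeta> j" "H (\<sigma> j)"] by simp
  qed
  then have "nrm (step_integral i K \<sigma> (\<lambda>j \<omega>. \<zeta> j \<omega> - \<zeta>' j \<omega>)) \<le> sqrt ((T + 1) * (b - a)) * (\<epsilon> + \<epsilon>')"
    using D(2) D'(2) e by (intro step_integral_sup_bound[OF i ab D(1)] adapted_diff) auto
  then show ?thesis unfolding eq by (simp add: step_integral_diff[abs_def])
qed

text \<open>\<open>has_int\<close> supplies one good approximation for every accuracy; comparison
  with it shows that every uniform approximation of \<open>H\<close> has an integral near
  \<open>X\<close>.\<close>

lemma has_int_step_dist:
  assumes i: "i \<le> m" and ab: "0 \<le> a" "b \<le> T" and X: "has_int i a b H X"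
    and H: "approximates a b H \<epsilon> N \<tau> \<eta>" and e: "0 \<le> \<epsilon>"
  shows "nrm (\<lambda>\<omega>. X \<omega> - step_integral i N \<tau> \<eta> \<omega>) \<le> sqrt ((T + 1) * (b - a)) * \<epsilon>"
proof -
  define c where "c = sqrt ((T + 1) * (b - a))"
  have le: "a \<le> b" using is_partition_bounds[OF approximatesD(1)[OF H], of 0] approximatesD(1)[OF H] by (simp add: is_partition_def)
  have c: "0 \<le> c" unfolding c_def using ab le by simp
  have S: "sq_int (step_integral i N \<tau> \<eta>)"
    using step_integral_adapted[OF i ab approximatesD(1,2)[OF H]] by (simp add: adapted_def)
  have "nrm (\<lambda>\<omega>. X \<omega> - step_integral i N \<tau> \<eta> \<omega>) \<le> c * \<epsilon> + e" if e': "e > 0" for e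
  proof -
    \<comment> \<open>Chosen so that \<open>c * d + d = e\<close>: one \<open>d\<close> for the
      distance from \<open>X\<close> to the auxiliary step integral, and \<open>c * d\<close> for
      its contribution to the distance between the two step integrals.\<close>
    define d where "d = e / (c + 1)"
    have "d > 0" "(c + 1) * d = e" using c e' by (auto simp: d_def)
    then have d: "d > 0" "c * d + d = e" by (simp_all add: distrib_right)
    obtain N' \<tau>' \<eta>' where A: "approximates a b H d N' \<tau>' \<eta>'" "nrm (\<lambda>\<omega>. X \<omega> - step_integral i N' \<tau>' \<eta>' \<omega>) \<le> d"
      using X d(1) unfolding has_int_def by blast
    have S': "sq_int (step_integral i N' \<tau>' \<eta>')"
      using step_integral_adapted[OF i ab approximatesD(1,2)[OF A(1)]] by (simp add: adapted_def)
    have "nrm (\<lambda>\<omega>. X \<omega> - step_integral i N \<tau> \<eta> \<omega>) \<le> d + c * (d + \<epsilon>)"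
      using l2norm_triangle_diff[OF has_int_sq_int[OF X] S' S] A(2)
        approximates_step_dist[OF i ab A(1) H less_imp_le[OF d(1)] e] unfolding c_def by linarith
    also have "\<dots> = c * \<epsilon> + e" using d(2) by (simp add: algebra_simps)
    finally show ?thesis .
  qed
  then show ?thesis unfolding c_def by (rule field_le_epsilon)
qed

text \<open>Step integrals of better and better approximations form a Cauchy sequence, and
  completeness relative to \<open>F b\<close> provides a limit adapted at \<open>b\<close>.\<close>

lemma has_int_exists:
  assumes i: "i \<le> m" and ab: "0 \<le> a" "a \<le> b" "b \<le> T"
    and H: "\<And>\<epsilon>. \<epsilon> > 0 \<Longrightarrow> \<exists>N \<tau> \<eta>. approximates a b H \<epsilon> N \<tau> \<eta>"
  shows "\<exists>X. has_int i a b H X"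
proof -
  have "\<forall>n. \<exists>N \<tau> \<eta>. approximates a b H (1 / real (Suc n)) N \<tau> \<eta>" using H by simp
  then obtain N \<tau> \<eta> where A: "\<And>n. approximates a b H (1 / real (Suc n)) (N n) (\<tau> n) (\<eta> n)" by metis
  define S where "S n = step_integral i (N n) (\<tau> n) (\<eta> n)" for n
  define c where "c = sqrt ((T + 1) * (b - a))"
  have c: "0 \<le> c" unfolding c_def using ab by simp
  have S: "adapted b (S n)" for n
    unfolding S_def using step_integral_adapted[OF i ab(1,3) approximatesD(1,2)[OF A[of n]]] by simp
  have cauchy: "\<exists>n0. \<forall>m\<ge>n0. \<forall>n\<ge>n0. nrm (\<lambda>\<omega>. S m \<omega> - S n \<omega>) \<le> \<epsilon>" if e: "\<epsilon> > 0" for \<epsilon>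
  proof -
    obtain n0 :: nat where n0: "2 * (c + 1) / \<epsilon> < real n0" using reals_Archimedean2 by blast
    have "nrm (\<lambda>\<omega>. S p \<omega> - S q \<omega>) \<le> \<epsilon>" if "p \<ge> n0" "q \<ge> n0" for p q
    proof -
      have n1: "real (Suc n0) > 0" by simp
      have b: "1 / real (Suc p) \<le> 1 / real (Suc n0)" "1 / real (Suc q) \<le> 1 / real (Suc n0)"
        using that by (auto intro!: divide_left_mono)
      have "nrm (\<lambda>\<omega>. S p \<omega> - S q \<omega>) \<le> c * (1 / real (Suc p) + 1 / real (Suc q))"
        unfolding S_def c_def by (rule approximates_step_dist[OF i ab(1,3) A A]) auto
      also have "\<dots> \<le> c * (1 / real (Suc n0) + 1 / real (Suc n0))"
        using b c by (intro mult_left_mono add_mono) auto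
      also have "\<dots> = 2 * c / real (Suc n0)" by simp
      also have "\<dots> \<le> \<epsilon>"
      proof -
        have "2 * (c + 1) < real n0 * \<epsilon>" using n0 e by (simp add: field_simps)
        also have "\<dots> \<le> real (Suc n0) * \<epsilon>" using e by (intro mult_right_mono) auto
        finally show ?thesis using n1 by (simp add: field_simps)
      qed
      finally show ?thesis .
    qed
    then show ?thesis by blast
  qed
  have b: "b \<in> {0..T}" using ab by simp
  obtain X where X: "X \<in> borel_measurable (F b)" "sq_int X" "ms_limit M S X"
    using square_integrable_complete[of S "F b", OF adapted_sq_int[OF S] cauchy subalgebra_filtration[OF b] adapted_measurable[OF S]]
    by blast
  have "\<exists>N \<tau> \<eta>. approximates a b H \<epsilon> N \<tau> \<eta> \<and> nrm (\<lambda>\<omega>. X \<omega> - step_integral i N \<tau> \<eta> \<omega>) \<le> \<epsilon>" if e: "\<epsilon> > 0" for \<epsilon>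
  proof -
    have "(\<lambda>n. 1 / real (Suc n)) \<longlonglongrightarrow> 0" using LIMSEQ_inverse_real_of_nat by (simp add: inverse_eq_divide)
    then have "\<forall>\<^sub>F n in sequentially. 1 / real (Suc n) < \<epsilon>" using order_tendstoD(2) e by blast
    then have "\<forall>\<^sub>F n in sequentially. 1 / real (Suc n) < \<epsilon> \<and> nrm (\<lambda>\<omega>. S n \<omega> - X \<omega>) < \<epsilon>"
      using ms_limitD[OF X(3) e] by (rule eventually_conj)
    then obtain n where n: "1 / real (Suc n) < \<epsilon>" "nrm (\<lambda>\<omega>. S n \<omega> - X \<omega>) < \<epsilon>"
      unfolding eventually_sequentially by blast
    have "approximates a b H \<epsilon> (N n) (\<tau> n) (\<eta> n)"
      using A[of n] n(1) unfolding approximates_def by (meson less_imp_le order_trans)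
    then show ?thesis using n(2) l2norm_minus_commute[of M X "S n"] unfolding S_def by (intro exI conjI) auto
  qed
  then show ?thesis using X unfolding has_int_def adapted_def by blast
qed

text \<open>The step values inherit the bound on \<open>H\<close> up to an arbitrarily small error,
  since every value of the step process is compared with \<open>H\<close> at the left endpoint of
  its interval.\<close>

lemma has_int_bound:
  assumes i: "i \<le> m" and ab: "0 \<le> a" "a \<le> b" "b \<le> T" and X: "has_int i a b H X"
    and d: "\<And>s. a \<le> s \<Longrightarrow> s < b \<Longrightarrow> nrm (H s) \<le> d" "0 \<le> d"
  shows "nrm X \<le> sqrt ((T + 1) * (b - a)) * d"
proof -
  define c where "c = sqrt ((T + 1) * (b - a))"
  have c: "0 \<le> c" unfolding c_def using ab by simp
  have "nrm X \<le> c * d + e" if e: "e > 0" for e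
  proof -
    define h where "h = e / (c + 1)"
    have "h > 0" "(c + 1) * h = e" using c e by (auto simp: h_def)
    then have h: "h > 0" "c * h + h = e" by (simp_all add: distrib_right)
    obtain N \<tau> \<eta> where A: "approximates a b H h N \<tau> \<eta>" "nrm (\<lambda>\<omega>. X \<omega> - step_integral i N \<tau> \<eta> \<omega>) \<le> h"
      using X h(1) unfolding has_int_def by blast
    note D = approximatesD[OF A(1)]
    have "nrm (\<eta> l) \<le> d + h" if l: "l < N" for l
    proof -
      have s: "\<tau> l < \<tau> (Suc l)" using D(1) l by (simp add: is_partition_def)
      have "a \<le> \<tau> l" "\<tau> l < b"
        using is_partition_bounds[OF D(1), of l] is_partition_bounds[OF D(1), of "Suc l"] s l by auto
      then have "nrm (H (\<tau> l)) \<le> d" by (rule d(1))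
      moreover have "nrm (\<eta> l) \<le> nrm (\<lambda>\<omega>. \<eta> l \<omega> - H (\<tau> l) \<omega>) + nrm (H (\<tau> l))"
        by (rule l2norm_le_diff[OF adapted_sq_int[OF D(2)[OF l]] D(3)[OF l order_refl s]])
      ultimately show ?thesis
        using D(4)[OF l order_refl s] l2norm_minus_commute[of M "\<eta> l" "H (\<tau> l)"] by simp
    qed
    then have "nrm (step_integral i N \<tau> \<eta>) \<le> c * (d + h)"
      unfolding c_def using d(2) h D(2) by (intro step_integral_sup_bound[OF i ab(1,3) D(1)]) auto
    moreover have "nrm X \<le> nrm (\<lambda>\<omega>. X \<omega> - step_integral i N \<tau> \<eta> \<omega>) + nrm (step_integral i N \<tau> \<eta>)"
      using step_integral_adapted[OF i ab(1,3) D(1,2)]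
      by (intro l2norm_le_diff has_int_sq_int[OF X]) (simp add: adapted_def)
    ultimately show ?thesis using A(2) h(2) by (simp add: algebra_simps)
  qed
  then show ?thesis unfolding c_def by (rule field_le_epsilon)
qed

lemma has_int_linear:
  assumes i: "i \<le> m" and ab: "0 \<le> a" "b \<le> T" and X: "has_int i a b H X" and Y: "has_int i a b H' Y"
  shows "has_int i a b (\<lambda>s \<omega>. H s \<omega> + c * H' s \<omega>) (\<lambda>\<omega>. X \<omega> + c * Y \<omega>)"
  unfolding has_int_def
proof (intro conjI allI impI)
  show "adapted b (\<lambda>\<omega>. X \<omega> + c * Y \<omega>)"
    by (rule adapted_add[OF has_int_adapted[OF X] adapted_cmult[OF has_int_adapted[OF Y]]])
  fix \<epsilon> :: real assume e: "\<epsilon> > 0"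
  define d where "d = \<epsilon> / (1 + \<bar>c\<bar>)"
  have "0 < 1 + \<bar>c\<bar>" by simp
  then have "d > 0" "(1 + \<bar>c\<bar>) * d = \<epsilon>" using e unfolding d_def by (auto simp del: abs_not_less_zero)
  then have d: "d > 0" "d + \<bar>c\<bar> * d = \<epsilon>" by (simp_all add: distrib_right)
  obtain N \<tau> \<eta> where A: "approximates a b H d N \<tau> \<eta>" "nrm (\<lambda>\<omega>. X \<omega> - step_integral i N \<tau> \<eta> \<omega>) \<le> d"
    using X d(1) unfolding has_int_def by blast
  obtain N' \<tau>' \<eta>' where A': "approximates a b H' d N' \<tau>' \<eta>'" "nrm (\<lambda>\<omega>. Y \<omega> - step_integral i N' \<tau>' \<eta>' \<omega>) \<le> d"
    using Y d(1) unfolding has_int_def by blast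
  obtain K \<sigma> \<zeta> \<zeta>' where B: "approximates a b H d K \<sigma> \<zeta>" "approximates a b H' d K \<sigma> \<zeta>'"
    and eq: "step_integral i N \<tau> \<eta> = step_integral i K \<sigma> \<zeta>" "step_integral i N' \<tau>' \<eta>' = step_integral i K \<sigma> \<zeta>'"
    using common_approximation[OF ab A(1) A'(1)] .
  note D = approximatesD[OF B(1)] and D' = approximatesD[OF B(2)]
  let ?\<theta> = "\<lambda>j \<omega>. \<zeta> j \<omega> + c * \<zeta>' j \<omega>"
  have comb: "nrm (\<lambda>\<omega>. (U \<omega> + c * V \<omega>) - (U' \<omega> + c * V' \<omega>)) \<le> \<epsilon>"
    if "sq_int U" "sq_int V" "sq_int U'" "sq_int V'" "nrm (\<lambda>\<omega>. U \<omega> - U' \<omega>) \<le> d" "nrm (\<lambda>\<omega>. V \<omega> - V' \<omega>) \<le> d" for U V U' V'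
  proof -
    have "nrm (\<lambda>\<omega>. (U \<omega> - U' \<omega>) + c * (V \<omega> - V' \<omega>)) \<le> nrm (\<lambda>\<omega>. U \<omega> - U' \<omega>) + nrm (\<lambda>\<omega>. c * (V \<omega> - V' \<omega>))"
      using that by (intro l2norm_triangle square_integrable_diff square_integrable_cmult)
    also have "\<dots> \<le> d + \<bar>c\<bar> * d"
      unfolding l2norm_cmult using that by (intro add_mono mult_left_mono) auto
    finally show ?thesis using d(2) by (simp add: algebra_simps)
  qed
  have "approximates a b (\<lambda>s \<omega>. H s \<omega> + c * H' s \<omega>) \<epsilon> K \<sigma> ?\<theta>"
    unfolding approximates_def
  proof (intro conjI allI impI ballI)
    fix l s assume "l < K" "s \<in> {\<sigma> l..<\<sigma> (Suc l)}"
    then have *: "l < K" "\<sigma> l \<le> s" "s < \<sigma> (Suc l)" by auto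
    show "sq_int (\<lambda>\<omega>. H s \<omega> + c * H' s \<omega>)"
      by (intro square_integrable_add square_integrable_cmult D(3)[OF *] D'(3)[OF *])
    show "nrm (\<lambda>\<omega>. (H s \<omega> + c * H' s \<omega>) - (\<zeta> l \<omega> + c * \<zeta>' l \<omega>)) \<le> \<epsilon>"
      by (intro comb D(3,4)[OF *] D'(3,4)[OF *] adapted_sq_int[OF D(2)[OF *(1)]] adapted_sq_int[OF D'(2)[OF *(1)]])
  qed (use D(1) in \<open>auto intro!: adapted_add adapted_cmult D(2) D'(2)\<close>)
  moreover have "nrm (\<lambda>\<omega>. (X \<omega> + c * Y \<omega>) - step_integral i K \<sigma> ?\<theta> \<omega>) \<le> \<epsilon>"
  proof -
    have "step_integral i K \<sigma> ?\<theta> = (\<lambda>\<omega>. step_integral i K \<sigma> \<zeta> \<omega> + c * step_integral i K \<sigma> \<zeta>' \<omega>)"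
      by (simp add: step_integral_def[abs_def] sum_distrib_left sum.distrib distrib_right mult.assoc)
    moreover have "nrm (\<lambda>\<omega>. (X \<omega> + c * Y \<omega>) - (step_integral i K \<sigma> \<zeta> \<omega> + c * step_integral i K \<sigma> \<zeta>' \<omega>)) \<le> \<epsilon>"
      using step_integral_adapted[OF i ab D(1,2)] step_integral_adapted[OF i ab D'(1,2)] A(2) A'(2) eq
      by (intro comb has_int_sq_int[OF X] has_int_sq_int[OF Y]) (auto simp: adapted_def)
    ultimately show ?thesis by simp
  qed
  ultimately show "\<exists>N \<tau> \<eta>. approximates a b (\<lambda>s \<omega>. H s \<omega> + c * H' s \<omega>) \<epsilon> N \<tau> \<eta> \<and>
      nrm (\<lambda>\<omega>. X \<omega> + c * Y \<omega> - step_integral i N \<tau> \<eta> \<omega>) \<le> \<epsilon>" by blast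
qed

lemma has_int_zero:
  assumes "a \<le> b"
  shows "has_int i a b (\<lambda>s \<omega>. 0) (\<lambda>\<omega>. 0)"
proof -
  obtain N \<tau> where "is_partition a b N \<tau>" using is_partition_exists[OF assms, of 1] by auto
  then have "approximates a b (\<lambda>s \<omega>. 0) \<epsilon> N \<tau> (\<lambda>l \<omega>. 0) \<and> nrm (\<lambda>\<omega>. 0 - step_integral i N \<tau> (\<lambda>l \<omega>. 0) \<omega>) \<le> \<epsilon>"
    if "\<epsilon> > 0" for \<epsilon>
    using that by (auto simp: approximates_def step_integral_def)
  then show ?thesis unfolding has_int_def by (metis adapted_zero)
qed

lemma has_int_diff:
  assumes "i \<le> m" "0 \<le> a" "b \<le> T" "has_int i a b H X" "has_int i a b H' Y"
  shows "has_int i a b (\<lambda>s \<omega>. H s \<omega> - H' s \<omega>) (\<lambda>\<omega>. X \<omega> - Y \<omega>)"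
  using has_int_linear[OF assms, of "-1"] by simp

lemma has_int_sum:
  fixes n :: nat
  assumes "i \<le> m" "0 \<le> a" "a \<le> b" "b \<le> T" "\<And>l. l < n \<Longrightarrow> has_int i a b (H l) (X l)"
  shows "has_int i a b (\<lambda>s \<omega>. \<Sum>l<n. H l s \<omega>) (\<lambda>\<omega>. \<Sum>l<n. X l \<omega>)"
  using assms(5)
proof (induction n)
  case 0
  then show ?case using has_int_zero[OF assms(3)] by simp
next
  case (Suc n)
  have "has_int i a b (\<lambda>s \<omega>. (\<Sum>l<n. H l s \<omega>) + 1 * H n s \<omega>) (\<lambda>\<omega>. (\<Sum>l<n. X l \<omega>) + 1 * X n \<omega>)"
    by (rule has_int_linear[OF assms(1,2,4)]) (use Suc in auto)
  then show ?case by simp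
qed

lemma has_int_cong:
  assumes X: "has_int i a b H X" and eq: "\<And>s. a \<le> s \<Longrightarrow> s < b \<Longrightarrow> H' s = H s"
  shows "has_int i a b H' X"
proof -
  have "approximates a b H' \<epsilon> N \<tau> \<eta>" if A: "approximates a b H \<epsilon> N \<tau> \<eta>" for \<epsilon> N \<tau> \<eta>
  proof -
    note D = approximatesD[OF A]
    have "H' s = H s" if "l < N" "\<tau> l \<le> s" "s < \<tau> (Suc l)" for l s
      using eq[of s] that is_partition_bounds[OF D(1), of l] is_partition_bounds[OF D(1), of "Suc l"] by auto
    then show ?thesis using A by (simp add: approximates_def)
  qed
  then show ?thesis using X unfolding has_int_def by meson
qed

text \<open>The exceptional null set may depend on \<open>s\<close>, because the bound on the
  difference involves only the norm at each time. This is what makes the choice of versions of inner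
  integrals harmless.\<close>

lemma has_int_unique:
  assumes i: "i \<le> m" and ab: "0 \<le> a" "a \<le> b" "b \<le> T"
    and X: "has_int i a b H X" and Y: "has_int i a b H' Y"
    and eq: "\<And>s. a \<le> s \<Longrightarrow> s < b \<Longrightarrow> AE \<omega> in M. H s \<omega> = H' s \<omega>"
  shows "AE \<omega> in M. X \<omega> = Y \<omega>"
proof -
  have D: "has_int i a b (\<lambda>s \<omega>. H s \<omega> - H' s \<omega>) (\<lambda>\<omega>. X \<omega> - Y \<omega>)"
    by (rule has_int_diff[OF i ab(1,3) X Y])
  have 0: "nrm (\<lambda>\<omega>. H s \<omega> - H' s \<omega>) \<le> 0" if "a \<le> s" "s < b" for s
  proof -
    have "(\<integral>\<omega>. (H s \<omega> - H' s \<omega>)\<^sup>2 \<partial>M) = 0"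
      by (rule integral_eq_zero_AE) (use eq[OF that] in auto)
    then show ?thesis by (simp add: l2norm_def)
  qed
  have "nrm (\<lambda>\<omega>. X \<omega> - Y \<omega>) \<le> sqrt ((T + 1) * (b - a)) * 0"
    by (rule has_int_bound[OF i ab D 0]) auto
  then show ?thesis
    by (intro l2norm_eq_0_imp_AE_eq has_int_sq_int[OF X] has_int_sq_int[OF Y]) simp
qed

text \<open>A factor known at the lower limit keeps step values adapted at all later times, and
  boundedness keeps them square integrable with controlled error.\<close>

lemma has_int_bounded_mult:
  assumes i: "i \<le> m" and ab: "0 \<le> a" "a \<le> b" "b \<le> T" and X: "has_int i a b H X"
    and c: "c \<in> borel_measurable (F a)" "\<And>\<omega>. \<bar>c \<omega>\<bar> \<le> B"
  shows "has_int i a b (\<lambda>s \<omega>. c \<omega> * H s \<omega>) (\<lambda>\<omega>. c \<omega> * X \<omega>)"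
  unfolding has_int_def
proof (intro conjI allI impI)
  have cs: "c \<in> borel_measurable (F s)" if "a \<le> s" "s \<le> b" for s
    using filtration_measurable_mono[OF c(1) ab(1) that(1)] that ab by simp
  have cM: "c \<in> borel_measurable M"
    by (rule measurable_from_subalg[OF subalgebra_filtration c(1)]) (use ab in auto)
  have B: "0 \<le> B" using c(2)[of undefined] abs_ge_zero[of "c undefined"] by linarith
  show "adapted b (\<lambda>\<omega>. c \<omega> * X \<omega>)"
    using adapted_bounded_mult[OF has_int_adapted[OF X] cs c(2)] ab by simp
  fix \<epsilon> :: real assume e: "\<epsilon> > 0"
  define d where "d = \<epsilon> / (1 + B)"
  have d: "d > 0" "B * d \<le> \<epsilon>" using e B by (auto simp: d_def field_simps)
  have bd: "nrm (\<lambda>\<omega>. c \<omega> * U \<omega> - c \<omega> * V \<omega>) \<le> \<epsilon>" if "sq_int U" "sq_int V" "nrm (\<lambda>\<omega>. U \<omega> - V \<omega>) \<le> d" for U V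
  proof -
    have "nrm (\<lambda>\<omega>. c \<omega> * (U \<omega> - V \<omega>)) \<le> B * nrm (\<lambda>\<omega>. U \<omega> - V \<omega>)"
      by (rule l2norm_bounded_mult_le[OF square_integrable_diff[OF that(1,2)] cM c(2)])
    also have "\<dots> \<le> B * d" using that B by (intro mult_left_mono) auto
    finally show ?thesis using d(2) by (simp add: right_diff_distrib)
  qed
  obtain N \<tau> \<eta> where A: "approximates a b H d N \<tau> \<eta>" "nrm (\<lambda>\<omega>. X \<omega> - step_integral i N \<tau> \<eta> \<omega>) \<le> d"
    using X d(1) unfolding has_int_def by blast
  note D = approximatesD[OF A(1)]
  have "approximates a b (\<lambda>s \<omega>. c \<omega> * H s \<omega>) \<epsilon> N \<tau> (\<lambda>l \<omega>. c \<omega> * \<eta> l \<omega>)"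
    unfolding approximates_def
  proof (intro conjI allI impI ballI D(1))
    fix l assume l: "l < N"
    have "a \<le> \<tau> l" "\<tau> l \<le> b" using is_partition_bounds[OF D(1), of l] l by auto
    then show "adapted (\<tau> l) (\<lambda>\<omega>. c \<omega> * \<eta> l \<omega>)"
      using ab by (intro adapted_bounded_mult[OF D(2)[OF l] cs c(2)]) auto
    fix s assume "s \<in> {\<tau> l..<\<tau> (Suc l)}"
    then have *: "l < N" "\<tau> l \<le> s" "s < \<tau> (Suc l)" using l by auto
    show "sq_int (\<lambda>\<omega>. c \<omega> * H s \<omega>)" by (rule square_integrable_bounded_mult[OF D(3)[OF *] cM c(2)])
    show "nrm (\<lambda>\<omega>. c \<omega> * H s \<omega> - c \<omega> * \<eta> l \<omega>) \<le> \<epsilon>"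
      by (rule bd[OF D(3)[OF *] adapted_sq_int[OF D(2)[OF l]] D(4)[OF *]])
  qed
  moreover have "step_integral i N \<tau> (\<lambda>l \<omega>. c \<omega> * \<eta> l \<omega>) = (\<lambda>\<omega>. c \<omega> * step_integral i N \<tau> \<eta> \<omega>)"
    by (auto simp: step_integral_def sum_distrib_left mult.assoc)
  ultimately show "\<exists>N \<tau> \<eta>. approximates a b (\<lambda>s \<omega>. c \<omega> * H s \<omega>) \<epsilon> N \<tau> \<eta> \<and>
      nrm (\<lambda>\<omega>. c \<omega> * X \<omega> - step_integral i N \<tau> \<eta> \<omega>) \<le> \<epsilon>"
    using bd[OF has_int_sq_int[OF X] adapted_sq_int[OF step_integral_adapted[OF i ab(1,3) D(1,2)]] A(2)]
    by (intro exI conjI) auto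
qed

lemma has_int_concat:
  assumes i: "i \<le> m" and ab: "0 \<le> a" "a \<le> c" "c \<le> b" "b \<le> T"
    and X: "has_int i a c H X" and Y: "has_int i c b H Y"
  shows "has_int i a b H (\<lambda>\<omega>. X \<omega> + Y \<omega>)"
  unfolding has_int_def
proof (intro conjI allI impI)
  have "adapted b X" using adapted_mono[OF has_int_adapted[OF X]] ab by simp
  then show "adapted b (\<lambda>\<omega>. X \<omega> + Y \<omega>)" by (rule adapted_add[OF _ has_int_adapted[OF Y]])
  fix \<epsilon> :: real assume e: "\<epsilon> > 0"
  then have e2: "\<epsilon> / 2 > 0" by simp
  obtain N \<tau> \<eta> where A: "approximates a c H (\<epsilon>/2) N \<tau> \<eta>" "nrm (\<lambda>\<omega>. X \<omega> - step_integral i N \<tau> \<eta> \<omega>) \<le> \<epsilon>/2"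
    using X e2 unfolding has_int_def by blast
  obtain N' \<tau>' \<eta>' where A': "approximates c b H (\<epsilon>/2) N' \<tau>' \<eta>'" "nrm (\<lambda>\<omega>. Y \<omega> - step_integral i N' \<tau>' \<eta>' \<omega>) \<le> \<epsilon>/2"
    using Y e2 unfolding has_int_def by blast
  note D = approximatesD[OF A(1)] and D' = approximatesD[OF A'(1)]
  note cs = concat_partition_Suc[OF D(1) D'(1)]
  let ?\<sigma> = "concat_partition N \<tau> \<tau>'" and ?\<zeta> = "concat_partition N \<eta> \<eta>'"
  have split: "l < N \<or> (\<exists>j<N'. l = N + j)" if "l < N + N'" for l
    using that by (metis add_less_cancel_left le_Suc_ex not_less)
  have z: "l < N \<Longrightarrow> ?\<zeta> l = \<eta> l" "?\<zeta> (N + l) = \<eta>' l" for l by (auto simp: concat_partition_def)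
  have ap: "approximates a b H \<epsilon> (N + N') ?\<sigma> ?\<zeta>"
    unfolding approximates_def
  proof (intro conjI allI impI ballI is_partition_concat[OF D(1) D'(1)])
    fix l assume l: "l < N + N'"
    show "adapted (?\<sigma> l) (?\<zeta> l)"
      using split[OF l] D(2) D'(2) cs z by auto
    fix s assume s: "s \<in> {?\<sigma> l..<?\<sigma> (Suc l)}"
    have "sq_int (H s) \<and> nrm (\<lambda>\<omega>. H s \<omega> - ?\<zeta> l \<omega>) \<le> \<epsilon>/2"
      using split[OF l]
    proof
      assume l: "l < N"
      then show ?thesis using s D(3,4)[OF l, of s] cs(1,2)[OF l] z(1)[OF l] by simp
    next
      assume "\<exists>j<N'. l = N + j"
      then obtain j where j: "j < N'" "l = N + j" by blast
      then show ?thesis using s D'(3,4)[OF j(1), of s] cs(3,4)[of j] z(2)[of j] by simp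
    qed
    then show "sq_int (H s)" "nrm (\<lambda>\<omega>. H s \<omega> - ?\<zeta> l \<omega>) \<le> \<epsilon>" using e by auto
  qed
  have st: "step_integral i (N + N') ?\<sigma> ?\<zeta> = (\<lambda>\<omega>. step_integral i N \<tau> \<eta> \<omega> + step_integral i N' \<tau>' \<eta>' \<omega>)"
    unfolding step_integral_def[abs_def] sum_lessThan_add using cs z by (intro ext) simp
  have S: "sq_int (step_integral i N \<tau> \<eta>)" "sq_int (step_integral i N' \<tau>' \<eta>')"
    using step_integral_adapted[OF i _ _ D(1,2)] step_integral_adapted[OF i _ _ D'(1,2)] ab
    by (auto simp: adapted_def)
  have "nrm (\<lambda>\<omega>. (X \<omega> - step_integral i N \<tau> \<eta> \<omega>) + (Y \<omega> - step_integral i N' \<tau>' \<eta>' \<omega>)) \<le> \<epsilon>/2 + \<epsilon>/2"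
    using l2norm_triangle[OF square_integrable_diff[OF has_int_sq_int[OF X] S(1)] square_integrable_diff[OF has_int_sq_int[OF Y] S(2)]] A(2) A'(2)
    by linarith
  then have "nrm (\<lambda>\<omega>. X \<omega> + Y \<omega> - step_integral i (N + N') ?\<sigma> ?\<zeta> \<omega>) \<le> \<epsilon>"
    unfolding st by (simp add: algebra_simps)
  with ap show "\<exists>N \<tau> \<eta>. approximates a b H \<epsilon> N \<tau> \<eta> \<and> nrm (\<lambda>\<omega>. X \<omega> + Y \<omega> - step_integral i N \<tau> \<eta> \<omega>) \<le> \<epsilon>" by blast
qed

end

section \<open>Mean-square continuous processes\<close>

lemma sum_indicator_partition:
  fixes c :: "nat \<Rightarrow> real"
  assumes p: "is_partition a b K \<rho>"
  shows "j < K \<Longrightarrow> s \<in> {\<rho> j..<\<rho> (Suc j)} \<Longrightarrow> (\<Sum>l<K. indicator {\<rho> l..<\<rho> (Suc l)} s * c l) = c j"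
    and "s \<notin> {a..<b} \<Longrightarrow> (\<Sum>l<K. indicator {\<rho> l..<\<rho> (Suc l)} s * c l) = 0"
proof -
  assume j: "j < K" "s \<in> {\<rho> j..<\<rho> (Suc j)}"
  have "indicator {\<rho> l..<\<rho> (Suc l)} s * c l = (if l = j then c j else 0)" if l: "l < K" for l
  proof -
    consider "l = j" | "Suc l \<le> j" | "Suc j \<le> l" by linarith
    then show ?thesis
    proof cases
      case 2
      then have "\<rho> (Suc l) \<le> \<rho> j" using is_partition_le[OF p, of "Suc l" j] j by simp
      then show ?thesis using j 2 by auto
    next
      case 3
      then have "\<rho> (Suc j) \<le> \<rho> l" using is_partition_le[OF p, of "Suc j" l] l by simp
      then show ?thesis using j 3 by auto
    qed (use j in auto)
  qed
  then have "(\<Sum>l<K. indicator {\<rho> l..<\<rho> (Suc l)} s * c l) = (\<Sum>l<K. if l = j then c j else 0)"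
    by (intro sum.cong refl) simp
  then show "(\<Sum>l<K. indicator {\<rho> l..<\<rho> (Suc l)} s * c l) = c j" using j by simp
next
  assume s: "s \<notin> {a..<b}"
  have "indicator {\<rho> l..<\<rho> (Suc l)} s * c l = 0" if l: "l < K" for l
    using s is_partition_bounds[OF p, of l] is_partition_bounds[OF p, of "Suc l"] l by (auto simp: indicator_def)
  then show "(\<Sum>l<K. indicator {\<rho> l..<\<rho> (Suc l)} s * c l) = 0" by (intro sum.neutral) simp
qed

lemma step_process_eq:
  assumes "is_partition a b K \<rho>"
  shows "j < K \<Longrightarrow> s \<in> {\<rho> j..<\<rho> (Suc j)} \<Longrightarrow> step_process K \<rho> \<eta> s = \<eta> j"
    and "s \<notin> {a..<b} \<Longrightarrow> step_process K \<rho> \<eta> s = (\<lambda>\<omega>. 0)"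
  using sum_indicator_partition[OF assms] by (auto simp: step_process_def fun_eq_iff)

context wiener_setting
begin

text \<open>The modulus of continuity is uniform on the interval so that a single mesh size controls
  all subintervals; for the class S2 this follows from compactness.\<close>

definition ms_continuous :: "real \<Rightarrow> real \<Rightarrow> (real \<Rightarrow> 'a \<Rightarrow> real) \<Rightarrow> bool" where
  "ms_continuous a b H \<longleftrightarrow> (\<forall>s\<in>{a..b}. adapted s (H s)) \<and>
     (\<forall>\<epsilon>>0. \<exists>\<delta>>0. \<forall>s\<in>{a..b}. \<forall>u\<in>{a..b}. \<bar>s - u\<bar> < \<delta> \<longrightarrow> nrm (\<lambda>\<omega>. H s \<omega> - H u \<omega>) \<le> \<epsilon>)"

lemma ms_continuous_adapted: "ms_continuous a b H \<Longrightarrow> a \<le> s \<Longrightarrow> s \<le> b \<Longrightarrow> adapted s (H s)"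
  by (simp add: ms_continuous_def)

lemma ms_continuous_sq_int: "ms_continuous a b H \<Longrightarrow> a \<le> s \<Longrightarrow> s \<le> b \<Longrightarrow> sq_int (H s)"
  by (simp add: ms_continuous_def adapted_def)

lemma ms_continuousD:
  assumes "ms_continuous a b H" "\<epsilon> > 0"
  obtains \<delta> where "\<delta> > 0"
    "\<forall>s\<in>{a..b}. \<forall>u\<in>{a..b}. \<bar>s - u\<bar> < \<delta> \<longrightarrow> nrm (\<lambda>\<omega>. H s \<omega> - H u \<omega>) \<le> \<epsilon>"
  using assms unfolding ms_continuous_def by blast

lemma ms_continuous_subset:
  assumes H: "ms_continuous a b H" and "a \<le> a'" "b' \<le> b"
  shows "ms_continuous a' b' H"
  unfolding ms_continuous_def
proof (intro conjI ballI allI impI)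
  fix \<epsilon> :: real assume e: "\<epsilon> > 0"
  obtain \<delta> where "\<delta> > 0"
    "\<forall>s\<in>{a..b}. \<forall>u\<in>{a..b}. \<bar>s - u\<bar> < \<delta> \<longrightarrow> nrm (\<lambda>\<omega>. H s \<omega> - H u \<omega>) \<le> \<epsilon>"
    using ms_continuousD[OF H e] .
  then show "\<exists>\<delta>>0. \<forall>s\<in>{a'..b'}. \<forall>u\<in>{a'..b'}. \<bar>s - u\<bar> < \<delta> \<longrightarrow> nrm (\<lambda>\<omega>. H s \<omega> - H u \<omega>) \<le> \<epsilon>"
    using assms(2,3) by (intro exI[of _ \<delta>]) auto
qed (use assms in \<open>simp add: ms_continuous_adapted\<close>)

lemma ms_continuous_approximates:
  assumes H: "ms_continuous a b H" and e: "\<epsilon> > 0"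
  obtains \<delta> where "\<delta> > 0"
    "\<And>N \<tau>. is_partition a b N \<tau> \<Longrightarrow> \<forall>l<N. \<tau> (Suc l) - \<tau> l < \<delta> \<Longrightarrow> approximates a b H \<epsilon> N \<tau> (\<lambda>l. H (\<tau> l))"
proof -
  obtain \<delta> where d: "\<delta> > 0"
    "\<forall>s\<in>{a..b}. \<forall>u\<in>{a..b}. \<bar>s - u\<bar> < \<delta> \<longrightarrow> nrm (\<lambda>\<omega>. H s \<omega> - H u \<omega>) \<le> \<epsilon>"
    using ms_continuousD[OF H e] .
  have "approximates a b H \<epsilon> N \<tau> (\<lambda>l. H (\<tau> l))" if p: "is_partition a b N \<tau>" and m: "\<forall>l<N. \<tau> (Suc l) - \<tau> l < \<delta>" for N \<tau>
    unfolding approximates_def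
  proof (intro conjI allI impI ballI p)
    fix l assume l: "l < N"
    then have bd: "a \<le> \<tau> l" "\<tau> l \<le> b" "\<tau> (Suc l) \<le> b"
      using is_partition_bounds[OF p, of l] is_partition_bounds[OF p, of "Suc l"] by auto
    show "adapted (\<tau> l) (H (\<tau> l))" using ms_continuous_adapted[OF H] bd by simp
    fix s assume s: "s \<in> {\<tau> l..<\<tau> (Suc l)}"
    show "sq_int (H s)" by (rule ms_continuous_sq_int[OF H]) (use bd s in auto)
    have "\<bar>s - \<tau> l\<bar> < \<delta>" using s m l by fastforce
    then show "nrm (\<lambda>\<omega>. H s \<omega> - H (\<tau> l) \<omega>) \<le> \<epsilon>" using d(2) bd s by auto
  qed
  with d(1) show thesis by (rule that)
qed

lemma ms_continuous_has_int:
  assumes i: "i \<le> m" and ab: "0 \<le> a" "a \<le> b" "b \<le> T" and H: "ms_continuous a b H"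
  shows "\<exists>X. has_int i a b H X"
proof (rule has_int_exists[OF i ab])
  fix \<epsilon> :: real assume "\<epsilon> > 0"
  from ms_continuous_approximates[OF H this] obtain \<delta> where d: "\<delta> > 0"
    "\<And>N \<tau>. is_partition a b N \<tau> \<Longrightarrow> \<forall>l<N. \<tau> (Suc l) - \<tau> l < \<delta> \<Longrightarrow> approximates a b H \<epsilon> N \<tau> (\<lambda>l. H (\<tau> l))"
    by blast
  then show "\<exists>N \<tau> \<eta>. approximates a b H \<epsilon> N \<tau> \<eta>"
    using is_partition_exists[OF ab(2) d(1)] by blast
qed

lemma has_int_left_sums:
  assumes i: "i \<le> m" and ab: "0 \<le> a" "a \<le> b" "b \<le> T" and H: "ms_continuous a b H"
    and X: "has_int i a b H X" and e: "\<epsilon> > 0"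
  obtains \<delta> where "\<delta> > 0"
    "\<And>N \<tau>. is_partition a b N \<tau> \<Longrightarrow> \<forall>l<N. \<tau> (Suc l) - \<tau> l < \<delta> \<Longrightarrow>
       nrm (\<lambda>\<omega>. step_integral i N \<tau> (\<lambda>l. H (\<tau> l)) \<omega> - X \<omega>) \<le> \<epsilon>"
proof -
  define c where "c = sqrt ((T + 1) * (b - a))"
  have c: "0 \<le> c" unfolding c_def using ab by simp
  define d where "d = \<epsilon> / (c + 1)"
  have "d > 0" "(c + 1) * d = \<epsilon>" using c e by (auto simp: d_def)
  then have d: "d > 0" "c * d \<le> \<epsilon>" by (simp_all add: distrib_right)
  from ms_continuous_approximates[OF H d(1)] obtain \<delta> where \<delta>: "\<delta> > 0"
    "\<And>N \<tau>. is_partition a b N \<tau> \<Longrightarrow> \<forall>l<N. \<tau> (Suc l) - \<tau> l < \<delta> \<Longrightarrow> approximates a b H d N \<tau> (\<lambda>l. H (\<tau> l))"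
    by blast
  show thesis
  proof (rule that[OF \<delta>(1)])
    fix N \<tau> assume "is_partition a b N \<tau>" "\<forall>l<N. \<tau> (Suc l) - \<tau> l < \<delta>"
    from has_int_step_dist[OF i ab(1,3) X \<delta>(2)[OF this] less_imp_le[OF d(1)]] d(2)
    show "nrm (\<lambda>\<omega>. step_integral i N \<tau> (\<lambda>l. H (\<tau> l)) \<omega> - X \<omega>) \<le> \<epsilon>"
      unfolding c_def by (subst l2norm_minus_commute) linarith
  qed
qed

lemma ms_continuous_step_adapted:
  assumes i: "i \<le> m" and ab: "0 \<le> a" "b \<le> T" and H: "ms_continuous a b H" and p: "is_partition a b N \<tau>"
  shows "adapted b (step_integral i N \<tau> (\<lambda>l. H (\<tau> l)))"
proof (rule step_integral_adapted[OF i ab p])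
  fix l assume "l < N"
  then show "adapted (\<tau> l) (H (\<tau> l))"
    using is_partition_bounds[OF p, of l] by (intro ms_continuous_adapted[OF H]) auto
qed

section \<open>Agreement with limits of sums, mean-square integrals and Ito integrals\<close>

lemma has_int_imp_has_partition_limit:
  assumes i: "i \<le> m" and ab: "0 \<le> a" "a \<le> b" "b \<le> T" and H: "ms_continuous a b H" and X: "has_int i a b H X"
  shows "has_partition_limit M a b (\<lambda>N \<tau>. step_integral i N \<tau> (\<lambda>l. H (\<tau> l))) X"
  unfolding has_partition_limit_def
proof (intro allI impI ms_limitI has_int_sq_int[OF X])
  fix N \<tau> assume r: "refining_partitions a b N \<tau>"
  then show "sq_int (step_integral i (N n) (\<tau> n) (\<lambda>l. H (\<tau> n l)))" for n
    using ms_continuous_step_adapted[OF i ab(1,3) H] by (simp add: refining_partitions_def adapted_def)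
  fix \<epsilon> :: real assume "\<epsilon> > 0"
  from has_int_left_sums[OF i ab H X this] obtain \<delta> where d: "\<delta> > 0"
    "\<And>N \<tau>. is_partition a b N \<tau> \<Longrightarrow> \<forall>l<N. \<tau> (Suc l) - \<tau> l < \<delta> \<Longrightarrow>
       nrm (\<lambda>\<omega>. step_integral i N \<tau> (\<lambda>l. H (\<tau> l)) \<omega> - X \<omega>) \<le> \<epsilon>" by blast
  have "\<forall>\<^sub>F n in sequentially. \<forall>l<N n. \<tau> n (Suc l) - \<tau> n l < \<delta>"
    using r d(1) by (simp add: refining_partitions_def)
  then show "\<forall>\<^sub>F n in sequentially. nrm (\<lambda>\<omega>. step_integral i (N n) (\<tau> n) (\<lambda>l. H (\<tau> n l)) \<omega> - X \<omega>) \<le> \<epsilon>"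
    by eventually_elim (use d(2) r in \<open>simp add: refining_partitions_def\<close>)
qed

text \<open>Left-endpoint sums are step integrals against time. Moving the evaluation points within
  the subintervals changes the sum by at most the modulus of continuity times
  \<open>b - a\<close>.\<close>

lemma has_int_imp_has_ms_integral:
  assumes ab: "0 \<le> a" "a \<le> b" "b \<le> T" and H: "ms_continuous a b H" and X: "has_int 0 a b H X"
  shows "has_ms_integral M a b H X"
  unfolding has_ms_integral_def
proof (intro allI impI)
  fix N \<tau> \<sigma>
  assume *: "refining_partitions a b N \<tau> \<and> (\<forall>n. \<forall>l<N n. \<sigma> n l \<in> {\<tau> n l..\<tau> n (Suc l)})"
  then have r: "refining_partitions a b N \<tau>" and \<sigma>: "\<And>n l. l < N n \<Longrightarrow> \<tau> n l \<le> \<sigma> n l \<and> \<sigma> n l \<le> \<tau> n (Suc l)"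
    by auto
  have p: "is_partition a b (N n) (\<tau> n)" for n using r by (simp add: refining_partitions_def)
  have bd: "a \<le> \<tau> n l" "\<tau> n l \<le> b" "a \<le> \<sigma> n l" "\<sigma> n l \<le> b" "0 \<le> \<tau> n (Suc l) - \<tau> n l" if "l < N n" for n l
    using is_partition_bounds[OF p, of l n] is_partition_bounds[OF p, of "Suc l" n]
      is_partition_le[OF p, of l "Suc l" n] \<sigma>[OF that] that by auto
  define S where "S n \<omega> = (\<Sum>l<N n. H (\<sigma> n l) \<omega> * (\<tau> n (Suc l) - \<tau> n l))" for n \<omega>
  define S' where "S' n = step_integral 0 (N n) (\<tau> n) (\<lambda>l. H (\<tau> n l))" for n
  have scaled: "sq_int (\<lambda>\<omega>. H s \<omega> * c)" if "a \<le> s" "s \<le> b" for s c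
    using square_integrable_cmult[OF ms_continuous_sq_int[OF H that], of c] by (simp add: mult.commute)
  have S: "sq_int (S n)" for n
    unfolding S_def[abs_def] by (intro square_integrable_sum scaled bd) auto
  have lim: "ms_limit M S' X"
    using has_int_imp_has_partition_limit[OF _ ab H X] r unfolding has_partition_limit_def S'_def by blast
  then have S': "sq_int (S' n)" for n by (simp add: ms_limit_iff)
  show "ms_limit M (\<lambda>n \<omega>. \<Sum>l<N n. H (\<sigma> n l) \<omega> * (\<tau> n (Suc l) - \<tau> n l)) X"
    unfolding S_def[symmetric]
  proof (rule ms_limitI[OF S has_int_sq_int[OF X]])
    fix \<epsilon> :: real assume e: "\<epsilon> > 0"
    \<comment> \<open>The summand 1 avoids division by zero for a degenerate interval.\<close>
    define q where "q = b - a + 1"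
    define h where "h = \<epsilon> / 2 / q"
    have q: "q > 0" using ab by (simp add: q_def)
    then have h: "h > 0" using e by (simp add: h_def)
    have "h * (b - a) \<le> h * q" using h by (intro mult_left_mono) (simp_all add: q_def)
    also have "h * q = \<epsilon> / 2" using q by (simp add: h_def)
    finally have hq: "h * (b - a) \<le> \<epsilon> / 2" .
    from ms_continuousD[OF H h] obtain \<delta> where d: "\<delta> > 0"
      "\<forall>s\<in>{a..b}. \<forall>u\<in>{a..b}. \<bar>s - u\<bar> < \<delta> \<longrightarrow> nrm (\<lambda>\<omega>. H s \<omega> - H u \<omega>) \<le> h"
      by blast
    have close: "nrm (\<lambda>\<omega>. S n \<omega> - S' n \<omega>) \<le> \<epsilon> / 2" if mesh: "\<forall>l<N n. \<tau> n (Suc l) - \<tau> n l < \<delta>" for n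
    proof -
      have "nrm (\<lambda>\<omega>. S n \<omega> - S' n \<omega>) = nrm (\<lambda>\<omega>. \<Sum>l<N n. (\<tau> n (Suc l) - \<tau> n l) * (H (\<sigma> n l) \<omega> - H (\<tau> n l) \<omega>))"
        by (simp add: S_def S'_def step_integral_def integrator_def right_diff_distrib sum_subtractf mult.commute)
      also have "\<dots> \<le> (\<Sum>l<N n. nrm (\<lambda>\<omega>. (\<tau> n (Suc l) - \<tau> n l) * (H (\<sigma> n l) \<omega> - H (\<tau> n l) \<omega>)))"
        by (intro l2norm_sum_le square_integrable_cmult square_integrable_diff ms_continuous_sq_int[OF H] bd) auto
      also have "\<dots> \<le> (\<Sum>l<N n. h * (\<tau> n (Suc l) - \<tau> n l))"
      proof (rule sum_mono)
        fix l assume "l \<in> {..<N n}"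
        then have l: "l < N n" by simp
        have "\<bar>\<sigma> n l - \<tau> n l\<bar> < \<delta>" using \<sigma>[OF l] mesh l by fastforce
        then have "nrm (\<lambda>\<omega>. H (\<sigma> n l) \<omega> - H (\<tau> n l) \<omega>) \<le> h" using d(2) bd[OF l] by auto
        then show "nrm (\<lambda>\<omega>. (\<tau> n (Suc l) - \<tau> n l) * (H (\<sigma> n l) \<omega> - H (\<tau> n l) \<omega>)) \<le> h * (\<tau> n (Suc l) - \<tau> n l)"
          using bd(5)[OF l] by (simp add: l2norm_cmult mult.commute[of h] mult_left_mono)
      qed
      also have "\<dots> = h * (b - a)"
        by (simp only: sum_distrib_left[symmetric] is_partition_sum_telescope[OF p, of "\<lambda>x. x"])
      finally show ?thesis using hq by linarith
    qed
    have "\<forall>\<^sub>F n in sequentially. \<forall>l<N n. \<tau> n (Suc l) - \<tau> n l < \<delta>"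
      using r d(1) by (simp add: refining_partitions_def)
    moreover have "\<forall>\<^sub>F n in sequentially. nrm (\<lambda>\<omega>. S' n \<omega> - X \<omega>) < \<epsilon> / 2"
      using ms_limitD[OF lim, of "\<epsilon> / 2"] e by simp
    ultimately show "\<forall>\<^sub>F n in sequentially. nrm (\<lambda>\<omega>. S n \<omega> - X \<omega>) \<le> \<epsilon>"
    proof eventually_elim
      case (elim n)
      then show ?case using close[OF elim(1)] l2norm_triangle_diff[OF S S' has_int_sq_int[OF X], of n n] by linarith
    qed
  qed
qed

text \<open>Supplies the integrability in time of the mean-square errors that the definition of the
  Ito integral demands.\<close>

lemma continuous_on_nrm_diff:
  assumes H: "ms_continuous a b H" and Y: "sq_int Y"
  shows "continuous_on {a..b} (\<lambda>s. nrm (\<lambda>\<omega>. Y \<omega> - H s \<omega>))"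
proof (rule continuous_onI)
  fix s \<epsilon> :: real assume s: "s \<in> {a..b}" and e: "\<epsilon> > 0"
  obtain \<delta> where d: "\<delta> > 0"
    "\<forall>s\<in>{a..b}. \<forall>u\<in>{a..b}. \<bar>s - u\<bar> < \<delta> \<longrightarrow> nrm (\<lambda>\<omega>. H s \<omega> - H u \<omega>) \<le> \<epsilon>"
    using ms_continuousD[OF H e] .
  have "dist (nrm (\<lambda>\<omega>. Y \<omega> - H u \<omega>)) (nrm (\<lambda>\<omega>. Y \<omega> - H s \<omega>)) \<le> \<epsilon>" if u: "u \<in> {a..b}" "dist u s < \<delta>" for u
  proof -
    have si: "sq_int (H s)" "sq_int (H u)" using ms_continuous_sq_int[OF H] s u by auto
    have "nrm (\<lambda>\<omega>. H u \<omega> - H s \<omega>) \<le> \<epsilon>" using d(2) s u by (auto simp: dist_real_def)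
    then show ?thesis
      using l2norm_triangle_diff[OF Y si] l2norm_triangle_diff[OF Y si(2,1)] l2norm_minus_commute[of M "H u" "H s"]
      by (simp add: dist_real_def abs_le_iff)
  qed
  with d(1) show "\<exists>d>0. \<forall>u\<in>{a..b}. dist u s < d \<longrightarrow> dist (nrm (\<lambda>\<omega>. Y \<omega> - H u \<omega>)) (nrm (\<lambda>\<omega>. Y \<omega> - H s \<omega>)) \<le> \<epsilon>"
    by blast
qed

lemma step_process_error:
  assumes H: "ms_continuous a b H" and ab: "0 \<le> a" "a \<le> b" and A: "approximates a b H \<epsilon> N \<tau> (\<lambda>l. H (\<tau> l))"
    and e: "0 \<le> \<epsilon>"
  defines "g \<equiv> \<lambda>s. \<integral>\<omega>. (step_process N \<tau> (\<lambda>l. H (\<tau> l)) s \<omega> - H s \<omega>)\<^sup>2 \<partial>M"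
  shows "set_integrable lborel {a..b} g" and "0 \<le> (LINT s:{a..b}|lborel. g s)"
    and "(LINT s:{a..b}|lborel. g s) \<le> \<epsilon>\<^sup>2 * (b - a)"
proof -
  note D = approximatesD[OF A]
  define h where "h Y s = (nrm (\<lambda>\<omega>. Y \<omega> - H s \<omega>))\<^sup>2" for Y s
  \<comment> \<open>At \<open>s = b\<close> no half-open interval is active, so the step process is
    zero there and the error is the squared norm of \<open>H b\<close>; the last term accounts for
    this point.\<close>
  have g_eq: "g s = (\<Sum>l<N. indicator {\<tau> l..<\<tau> (Suc l)} s * h (H (\<tau> l)) s) + indicator {b} s * h (\<lambda>\<omega>. 0) s"
    if s: "s \<in> {a..b}" for s
  proof (cases "s = b")
    case True
    then show ?thesis
      using step_process_eq(2)[OF D(1), of s "\<lambda>l. H (\<tau> l)"] sum_indicator_partition(2)[OF D(1), of s]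
      by (simp add: g_def h_def l2norm_power2)
  next
    case False
    with s obtain l where "l < N" "s \<in> {\<tau> l..<\<tau> (Suc l)}" using is_partition_find[OF D(1), of s] by auto
    then show ?thesis
      using step_process_eq(1)[OF D(1), of l s "\<lambda>l. H (\<tau> l)"] sum_indicator_partition(1)[OF D(1), of l s] False
      by (simp add: g_def h_def l2norm_power2)
  qed
  have h: "set_integrable lborel {a..b} (h Y)" if "sq_int Y" for Y
    unfolding h_def by (intro borel_integrable_atLeastAtMost' continuous_on_power continuous_on_nrm_diff[OF H that])
  have hi: "set_integrable lborel {a..b} (\<lambda>s. indicator B s * h Y s)" if "sq_int Y" "B \<in> sets borel" for Y B
  proof -
    have "integrable lborel (\<lambda>s. indicator B s *\<^sub>R (indicator {a..b} s *\<^sub>R h Y s))"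
      using that(2) h[OF that(1)] unfolding set_integrable_def by (intro integrable_mult_indicator[of B]) simp_all
    then show ?thesis unfolding set_integrable_def by (simp add: mult.left_commute)
  qed
  have "set_integrable lborel {a..b} (\<lambda>s. \<Sum>l<N. indicator {\<tau> l..<\<tau> (Suc l)} s * h (H (\<tau> l)) s)"
    unfolding set_integrable_def scaleR_sum_right
  proof (rule Bochner_Integration.integrable_sum)
    fix l assume "l \<in> {..<N}"
    then show "integrable lborel (\<lambda>s. indicat_real {a..b} s *\<^sub>R (indicator {\<tau> l..<\<tau> (Suc l)} s * h (H (\<tau> l)) s))"
      using hi[of "H (\<tau> l)" "{\<tau> l..<\<tau> (Suc l)}"] adapted_sq_int[OF D(2)[of l]] by (simp add: set_integrable_def)
  qed
  from set_integral_add(1)[OF this hi[of "\<lambda>\<omega>. 0" "{b}"]]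
  have "set_integrable lborel {a..b} (\<lambda>s. (\<Sum>l<N. indicator {\<tau> l..<\<tau> (Suc l)} s * h (H (\<tau> l)) s) + indicator {b} s * h (\<lambda>\<omega>. 0) s)"
    by simp
  then show int: "set_integrable lborel {a..b} g"
    by (subst set_integrable_cong[OF refl refl g_eq]) auto
  show "0 \<le> (LINT s:{a..b}|lborel. g s)"
    unfolding set_lebesgue_integral_def g_def by (intro Bochner_Integration.integral_nonneg) auto
  have "g s \<le> \<epsilon>\<^sup>2" if s: "s \<in> {a..b}" "s \<noteq> b" for s
  proof -
    obtain l where l: "l < N" "\<tau> l \<le> s" "s < \<tau> (Suc l)" using is_partition_find[OF D(1), of s] s by auto
    then have "g s = (nrm (\<lambda>\<omega>. H s \<omega> - H (\<tau> l) \<omega>))\<^sup>2"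
      using step_process_eq(1)[OF D(1), of l s "\<lambda>l. H (\<tau> l)"] by (simp add: g_def l2norm_power2 power2_commute)
    then show ?thesis using D(4)[OF l] by (simp add: power_mono)
  qed
  \<comment> \<open>The single point \<open>b\<close>, where the uniform estimate may fail, is
    Lebesgue null.\<close>
  then have "AE s in lborel. indicat_real {a..b} s *\<^sub>R g s \<le> indicat_real {a..b} s *\<^sub>R \<epsilon>\<^sup>2"
    using AE_lborel_singleton[of b] by (auto simp: indicator_def elim!: eventually_mono)
  moreover have "set_integrable lborel {a..b} (\<lambda>s. \<epsilon>\<^sup>2)"
    by (intro borel_integrable_atLeastAtMost' continuous_on_const)
  ultimately have "(LINT s:{a..b}|lborel. g s) \<le> (LINT s:{a..b}|lborel. \<epsilon>\<^sup>2)"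
    using int unfolding set_lebesgue_integral_def set_integrable_def by (intro integral_mono_AE)
  also have "\<dots> = \<epsilon>\<^sup>2 * (b - a)" using ab by (simp add: set_lebesgue_integral_def)
  finally show "(LINT s:{a..b}|lborel. g s) \<le> \<epsilon>\<^sup>2 * (b - a)" .
qed

lemma has_int_imp_has_ito_integral:
  assumes i: "i \<in> {1..m}" and ab: "0 \<le> a" "a \<le> b" "b \<le> T" and H: "ms_continuous a b H" and X: "has_int i a b H X"
  shows "has_ito_integral M F (f i) a b H X"
proof -
  have im: "i \<le> m" "i \<noteq> 0" using i by auto
  obtain N \<tau> where r: "refining_partitions a b N \<tau>" using refining_partitions_exist[OF ab(2)] .
  have p: "is_partition a b (N n) (\<tau> n)" for n using r by (simp add: refining_partitions_def)
  have *: "\<exists>\<delta>>0. \<forall>N \<tau>. is_partition a b N \<tau> \<longrightarrow> (\<forall>l<N. \<tau> (Suc l) - \<tau> l < \<delta>) \<longrightarrow> approximates a b H \<epsilon> N \<tau> (\<lambda>l. H (\<tau> l))"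
    if "\<epsilon> > 0" for \<epsilon> using ms_continuous_approximates[OF H that] by blast
  have ad: "adapted (\<tau> n l) (H (\<tau> n l))" if "l < N n" for n l
    using is_partition_bounds[OF p, of l n] that by (intro ms_continuous_adapted[OF H]) auto
  have ev: "\<forall>\<^sub>F n in sequentially. approximates a b H \<epsilon> (N n) (\<tau> n) (\<lambda>l. H (\<tau> n l))" if "\<epsilon> > 0" for \<epsilon>
  proof -
    obtain \<delta> where d: "\<delta> > 0" "\<forall>N \<tau>. is_partition a b N \<tau> \<longrightarrow> (\<forall>l<N. \<tau> (Suc l) - \<tau> l < \<delta>) \<longrightarrow> approximates a b H \<epsilon> N \<tau> (\<lambda>l. H (\<tau> l))"
      using *[OF \<open>\<epsilon> > 0\<close>] by blast
    have "\<forall>\<^sub>F n in sequentially. \<forall>l<N n. \<tau> n (Suc l) - \<tau> n l < \<delta>"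
      using r d(1) by (simp add: refining_partitions_def)
    then show ?thesis by eventually_elim (use d(2) p in blast)
  qed
  \<comment> \<open>Integrability of the error must hold for every index, but the approximation
    property is available only once the mesh is small. The first \<open>n0\<close> partitions are
    therefore dropped.\<close>
  obtain n0 where n0: "\<And>n. n \<ge> n0 \<Longrightarrow> approximates a b H 1 (N n) (\<tau> n) (\<lambda>l. H (\<tau> n l))"
    using ev[of 1] by (auto simp: eventually_sequentially)
  define N' \<tau>' where "N' n = N (n + n0)" and "\<tau>' n = \<tau> (n + n0)" for n
  have r': "refining_partitions a b N' \<tau>'"
    using r unfolding refining_partitions_def N'_def \<tau>'_def
    by (auto dest: sequentially_offset[of "\<lambda>n. \<forall>l<N n. \<tau> n (Suc l) - \<tau> n l < _"])
  have app1: "approximates a b H 1 (N' n) (\<tau>' n) (\<lambda>l. H (\<tau>' n l))" for n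
    unfolding N'_def \<tau>'_def using n0 by simp
  define g where "g n s = (\<integral>\<omega>. (step_process (N' n) (\<tau>' n) (\<lambda>l. H (\<tau>' n l)) s \<omega> - H s \<omega>)\<^sup>2 \<partial>M)" for n s
  have g1: "set_integrable lborel {a..b} (g n)" "0 \<le> (LINT s:{a..b}|lborel. g n s)" for n
    using step_process_error[OF H ab(1,2) app1] by (simp_all add: g_def[abs_def])
  have "(\<lambda>n. LINT s:{a..b}|lborel. g n s) \<longlonglongrightarrow> 0"
  proof (rule tendstoI)
    fix e :: real assume e: "e > 0"
    define q where "q = b - a + 1"
    define \<epsilon> where "\<epsilon> = sqrt (e / 2 / q)"
    have q: "q > 0" using ab by (simp add: q_def)
    have \<epsilon>: "\<epsilon> > 0" using e q by (simp add: \<epsilon>_def)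
    have "\<epsilon>\<^sup>2 * (b - a) \<le> \<epsilon>\<^sup>2 * q" by (rule mult_left_mono) (simp_all add: q_def)
    also have "\<epsilon>\<^sup>2 * q = e / 2" using e q by (simp add: \<epsilon>_def)
    finally have lt: "\<epsilon>\<^sup>2 * (b - a) < e" using e by linarith
    have "\<forall>\<^sub>F n in sequentially. approximates a b H \<epsilon> (N' n) (\<tau>' n) (\<lambda>l. H (\<tau>' n l))"
      using sequentially_offset[OF ev[OF \<epsilon>], of n0] by (simp add: N'_def \<tau>'_def)
    then show "\<forall>\<^sub>F n in sequentially. dist (LINT s:{a..b}|lborel. g n s) 0 < e"
    proof eventually_elim
      case (elim n)
      have "(LINT s:{a..b}|lborel. g n s) \<le> \<epsilon>\<^sup>2 * (b - a)"
        using step_process_error(3)[OF H ab(1,2) elim less_imp_le[OF \<epsilon>]] by (simp add: g_def[abs_def])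
      then show ?case using g1(2)[of n] lt by (simp add: dist_real_def)
    qed
  qed
  moreover have "ms_limit M (\<lambda>n \<omega>. \<Sum>l<N' n. H (\<tau>' n l) \<omega> * (f i (\<tau>' n (Suc l)) \<omega> - f i (\<tau>' n l) \<omega>)) X"
    using has_int_imp_has_partition_limit[OF im(1) ab H X] r' im
    by (simp add: has_partition_limit_def step_integral_def[abs_def] integrator_def)
  moreover have "\<forall>s\<in>{a..b}. sq_int (H s)" using ms_continuous_sq_int[OF H] by simp
  moreover have "\<forall>n. \<forall>l<N' n. H (\<tau>' n l) \<in> borel_measurable (F (\<tau>' n l)) \<and> sq_int (H (\<tau>' n l))"
    using ad unfolding N'_def \<tau>'_def adapted_def by blast
  moreover have "\<forall>n. is_partition a b (N' n) (\<tau>' n)" using r' by (simp add: refining_partitions_def)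
  ultimately show ?thesis
    using g1(1) unfolding has_ito_integral_def g_def[abs_def]
    by (intro conjI exI[of _ N'] exI[of _ \<tau>'] exI[of _ "\<lambda>n l. H (\<tau>' n l)"] allI) auto
qed

text \<open>Any Ito integral of a version of \<open>H\<close> is compared with a left-endpoint sum
  of \<open>H\<close>. The given step processes are close to \<open>H'\<close> only in L2(ds), so on
  a common refinement the pointwise distance of the step values is averaged over time and the
  quadratic bound on step integrals is applied.\<close>

lemma has_int_eq_ito_integral:
  assumes i: "i \<in> {1..m}" and ab: "0 \<le> a" "a \<le> b" "b \<le> T" and H: "ms_continuous a b H" and X: "has_int i a b H X"
    and X': "has_ito_integral M F (f i) a b H' X'"
    and eq: "\<And>s. a \<le> s \<Longrightarrow> s \<le> b \<Longrightarrow> AE \<omega> in M. H s \<omega> = H' s \<omega>"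
  shows "AE \<omega> in M. X \<omega> = X' \<omega>"
proof -
  have im: "i \<le> m" "i \<noteq> 0" using i by auto
  obtain N \<tau> \<eta> where p: "\<And>n. is_partition a b (N n) (\<tau> n)"
    and \<eta>: "\<And>n l. l < N n \<Longrightarrow> adapted (\<tau> n l) (\<eta> n l)"
    and int: "\<And>n. set_integrable lborel {a..b} (\<lambda>s. \<integral>\<omega>. (step_process (N n) (\<tau> n) (\<eta> n) s \<omega> - H' s \<omega>)\<^sup>2 \<partial>M)"
    and lim0: "(\<lambda>n. LINT s:{a..b}|lborel. (\<integral>\<omega>. (step_process (N n) (\<tau> n) (\<eta> n) s \<omega> - H' s \<omega>)\<^sup>2 \<partial>M)) \<longlonglongrightarrow> 0"
    and lim: "ms_limit M (\<lambda>n \<omega>. \<Sum>l<N n. \<eta> n l \<omega> * (f i (\<tau> n (Suc l)) \<omega> - f i (\<tau> n l) \<omega>)) X'"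
    and H': "\<And>s. a \<le> s \<Longrightarrow> s \<le> b \<Longrightarrow> sq_int (H' s)"
    using X' unfolding has_ito_integral_def adapted_def by auto
  define g where "g n s = (\<integral>\<omega>. (step_process (N n) (\<tau> n) (\<eta> n) s \<omega> - H' s \<omega>)\<^sup>2 \<partial>M)" for n s
  define S where "S n = step_integral i (N n) (\<tau> n) (\<eta> n)" for n
  have limS: "ms_limit M S X'" using lim im(2) by (simp add: S_def[abs_def] step_integral_def[abs_def] integrator_def)
  have Ssi: "sq_int (S n)" and X'si: "sq_int X'" for n using limS by (simp_all add: ms_limit_iff)
  note Xsi = has_int_sq_int[OF X]
  define c where "c = sqrt ((T + 1) * (b - a))"
  \<comment> \<open>The three terms bound the three parts of the final triangle inequality: from
    \<open>S n\<close> to \<open>X'\<close>, from \<open>S n\<close> to \<open>S'\<close>, and from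
    \<open>X\<close> to \<open>S'\<close>.\<close>
  define C where "C = 1 + sqrt ((T + 1) * (2 + 2 * (b - a))) + c"
  have "nrm (\<lambda>\<omega>. X \<omega> - X' \<omega>) \<le> C * e" if e: "e > 0" for e
  proof -
    obtain \<delta> where d: "\<delta> > 0" "\<And>N \<tau>. is_partition a b N \<tau> \<Longrightarrow> \<forall>l<N. \<tau> (Suc l) - \<tau> l < \<delta> \<Longrightarrow> approximates a b H e N \<tau> (\<lambda>l. H (\<tau> l))"
      using ms_continuous_approximates[OF H e] by blast
    obtain K \<sigma> where A: "approximates a b H e K \<sigma> (\<lambda>l. H (\<sigma> l))"
      using is_partition_exists[OF ab(2) d(1)] d(2) by blast
    note D = approximatesD[OF A]
    define S' where "S' = step_integral i K \<sigma> (\<lambda>l. H (\<sigma> l))"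
    have S'si: "sq_int S'" using step_integral_adapted[OF im(1) ab(1,3) D(1,2)] by (simp add: S'_def adapted_def)
    have XS': "nrm (\<lambda>\<omega>. X \<omega> - S' \<omega>) \<le> c * e"
      unfolding S'_def c_def by (rule has_int_step_dist[OF im(1) ab(1,3) X A]) (use e in simp)
    have "\<forall>\<^sub>F n in sequentially. nrm (\<lambda>\<omega>. S n \<omega> - X' \<omega>) < e \<and> (LINT s:{a..b}|lborel. g n s) < e\<^sup>2"
      using ms_limitD[OF limS e] order_tendstoD(2)[OF lim0, of "e\<^sup>2"] e unfolding g_def by (auto intro: eventually_conj)
    then obtain n where n: "nrm (\<lambda>\<omega>. S n \<omega> - X' \<omega>) < e" "(LINT s:{a..b}|lborel. g n s) < e\<^sup>2"
      by (auto simp: eventually_sequentially)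
    obtain L \<rho> p' q where \<rho>: "is_partition a b L \<rho>" and rp: "refines L \<rho> (N n) (\<tau> n) p'" and rq: "refines L \<rho> K \<sigma> q"
      using common_refinement[OF p[of n] D(1)] .
    have S1: "S n = step_integral i L \<rho> (\<lambda>j. \<eta> n (p' j))" unfolding S_def by (rule step_integral_refine[OF p \<rho> rp])
    have S2: "S' = step_integral i L \<rho> (\<lambda>j. H (\<sigma> (q j)))" unfolding S'_def by (rule step_integral_refine[OF D(1) \<rho> rq])
    have ad1: "adapted (\<rho> j) (\<eta> n (p' j))" and ad2: "adapted (\<rho> j) (H (\<sigma> (q j)))" if "j < L" for j
      using adapted_refine[OF ab(1,3) p \<rho> rp \<eta> that] adapted_refine[OF ab(1,3) D(1) \<rho> rq D(2) that] by auto
    define k where "k j = (nrm (\<lambda>\<omega>. \<eta> n (p' j) \<omega> - H (\<sigma> (q j)) \<omega>))\<^sup>2" for j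
    \<comment> \<open>The left side does not depend on \<open>s\<close>; bounding it for every
      \<open>s\<close> in the fine interval allows both sides to be integrated over that
      interval.\<close>
    have k: "k j \<le> 2 * g n s + 2 * e\<^sup>2" if j: "j < L" and s: "s \<in> {\<rho> j..<\<rho> (Suc j)}" for j s
    proof -
      have sab: "a \<le> s" "s \<le> b"
        using is_partition_bounds[OF \<rho>, of j] is_partition_bounds[OF \<rho>, of "Suc j"] j s by auto
      have pj: "p' j < N n" "s \<in> {\<tau> n (p' j)..<\<tau> n (Suc (p' j))}" and qj: "q j < K" "\<sigma> (q j) \<le> s" "s < \<sigma> (Suc (q j))"
        using rp rq j s by (auto simp: refines_def)
      have gs: "g n s = (nrm (\<lambda>\<omega>. \<eta> n (p' j) \<omega> - H' s \<omega>))\<^sup>2"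
        unfolding g_def step_process_eq(1)[OF p pj] l2norm_power2 ..
      note [measurable] = square_integrable_measurable[OF adapted_sq_int[OF ad1[OF j]]]
        square_integrable_measurable[OF H'[OF sab]] square_integrable_measurable[OF ms_continuous_sq_int[OF H sab]]
      have "nrm (\<lambda>\<omega>. \<eta> n (p' j) \<omega> - H' s \<omega>) = nrm (\<lambda>\<omega>. \<eta> n (p' j) \<omega> - H s \<omega>)"
        using eq[OF sab] by (intro l2norm_cong_AE) auto
      moreover have "nrm (\<lambda>\<omega>. \<eta> n (p' j) \<omega> - H (\<sigma> (q j)) \<omega>) \<le> nrm (\<lambda>\<omega>. \<eta> n (p' j) \<omega> - H s \<omega>) + e"
        using l2norm_triangle_diff[OF adapted_sq_int[OF ad1[OF j]] ms_continuous_sq_int[OF H sab] adapted_sq_int[OF ad2[OF j]]]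
          D(4)[OF qj] by linarith
      ultimately have "k j \<le> (nrm (\<lambda>\<omega>. \<eta> n (p' j) \<omega> - H' s \<omega>) + e)\<^sup>2"
        unfolding k_def by (intro power_mono) auto
      also have "\<dots> \<le> 2 * g n s + 2 * e\<^sup>2"
        unfolding gs using sum_squares_bound[of "nrm (\<lambda>\<omega>. \<eta> n (p' j) \<omega> - H' s \<omega>)" e] by (simp add: power2_sum)
      finally show ?thesis .
    qed
    have "(\<Sum>j<L. k j * (\<rho> (Suc j) - \<rho> j)) \<le> 2 * e\<^sup>2 + 2 * e\<^sup>2 * (b - a)"
    proof -
      have int1: "integrable lborel (\<lambda>s. indicator {\<rho> j..<\<rho> (Suc j)} s * k j)"
        and val1: "(\<integral>s. indicator {\<rho> j..<\<rho> (Suc j)} s * k j \<partial>lborel) = k j * (\<rho> (Suc j) - \<rho> j)"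
        if j: "j < L" for j
      proof -
        have le: "\<rho> j \<le> \<rho> (Suc j)" using is_partition_le[OF \<rho>, of j "Suc j"] j by simp
        then have "integrable lborel (indicat_real {\<rho> j..<\<rho> (Suc j)})"
          by (intro integrable_real_indicator) auto
        then show "integrable lborel (\<lambda>s. indicator {\<rho> j..<\<rho> (Suc j)} s * k j)"
          "(\<integral>s. indicator {\<rho> j..<\<rho> (Suc j)} s * k j \<partial>lborel) = k j * (\<rho> (Suc j) - \<rho> j)"
          using le by simp_all
      qed
      have int2: "set_integrable lborel {a..b} (\<lambda>s. 2 * g n s + 2 * e\<^sup>2)"
        using int[of n] ab unfolding g_def by (intro set_integral_add(1) set_integrable_mult_right) (auto simp: set_integrable_def)
      \<comment> \<open>Reading the sum as the integral of a step function of time lets the previous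
        pointwise bound be used under the integral.\<close>
      have "(\<Sum>j<L. k j * (\<rho> (Suc j) - \<rho> j)) = (\<integral>s. (\<Sum>j<L. indicator {\<rho> j..<\<rho> (Suc j)} s * k j) \<partial>lborel)"
        using int1 val1 by (subst Bochner_Integration.integral_sum) (auto simp del: integral_mult_left_zero integral_mult_left intro!: sum.cong)
      also have "\<dots> \<le> (LINT s:{a..b}|lborel. 2 * g n s + 2 * e\<^sup>2)"
        unfolding set_lebesgue_integral_def
      proof (rule integral_mono)
        show "integrable lborel (\<lambda>s. \<Sum>j<L. indicator {\<rho> j..<\<rho> (Suc j)} s * k j)"
          by (rule Bochner_Integration.integrable_sum, rule int1) simp
        show "integrable lborel (\<lambda>s. indicat_real {a..b} s *\<^sub>R (2 * g n s + 2 * e\<^sup>2))"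
          using int2 by (simp add: set_integrable_def)
        fix s
        have g0: "0 \<le> g n s" by (simp add: g_def)
        show "(\<Sum>j<L. indicator {\<rho> j..<\<rho> (Suc j)} s * k j) \<le> indicat_real {a..b} s *\<^sub>R (2 * g n s + 2 * e\<^sup>2)"
        proof (cases "s \<in> {a..<b}")
          case True
          then obtain j where j: "j < L" "s \<in> {\<rho> j..<\<rho> (Suc j)}" using is_partition_find[OF \<rho>, of s] by auto
          then show ?thesis using sum_indicator_partition(1)[OF \<rho> j] k[OF j] True by (auto simp: indicator_def)
        next
          case False
          then show ?thesis using sum_indicator_partition(2)[OF \<rho> False] g0 by (simp add: indicator_def)
        qed
      qed
      also have "\<dots> = 2 * (LINT s:{a..b}|lborel. g n s) + 2 * e\<^sup>2 * (b - a)"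
      proof -
        have "set_integrable lborel {a..b} (\<lambda>s. 2 * g n s)" "set_integrable lborel {a..b} (\<lambda>s. 2 * e\<^sup>2)"
          using int[of n] unfolding g_def
          by (auto intro!: set_integrable_mult_right borel_integrable_atLeastAtMost' continuous_on_const)
        then show ?thesis using ab(2) by (simp add: set_integral_add(2)) (simp add: set_lebesgue_integral_def)
      qed
      finally show ?thesis using n(2) by linarith
    qed
    note sum_le = this
    define q where "q = (T + 1) * (2 + 2 * (b - a))"
    have q: "0 \<le> q" using ab unfolding q_def by (intro mult_nonneg_nonneg) auto
    have "(nrm (\<lambda>\<omega>. S n \<omega> - S' \<omega>))\<^sup>2 \<le> (T + 1) * (\<Sum>j<L. k j * (\<rho> (Suc j) - \<rho> j))"
      using step_integral_bound[OF im(1) ab(1,3) \<rho> adapted_diff[OF ad1 ad2]]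
      unfolding S1 S2 step_integral_diff[abs_def] k_def .
    also have "\<dots> \<le> (T + 1) * (2 * e\<^sup>2 + 2 * e\<^sup>2 * (b - a))"
      using ab by (intro mult_left_mono[OF sum_le]) simp
    also have "\<dots> = q * e\<^sup>2" by (simp add: q_def algebra_simps)
    also have "\<dots> = (sqrt q * e)\<^sup>2" using q by (simp add: power_mult_distrib)
    finally have "nrm (\<lambda>\<omega>. S n \<omega> - S' \<omega>) \<le> sqrt q * e"
      by (rule power2_le_imp_le) (use q e in simp)
    then have "nrm (\<lambda>\<omega>. S n \<omega> - S' \<omega>) \<le> sqrt ((T + 1) * (2 + 2 * (b - a))) * e"
      by (simp only: q_def)
    moreover have "nrm (\<lambda>\<omega>. X \<omega> - X' \<omega>) \<le> nrm (\<lambda>\<omega>. X \<omega> - S' \<omega>) + nrm (\<lambda>\<omega>. S n \<omega> - S' \<omega>) + nrm (\<lambda>\<omega>. S n \<omega> - X' \<omega>)"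
      using l2norm_triangle_diff[OF Xsi S'si X'si] l2norm_triangle_diff[OF S'si Ssi X'si, of n]
        l2norm_minus_commute[of M "S n" S'] by linarith
    ultimately show ?thesis using XS' n(1) by (simp add: C_def distrib_right)
  qed
  note bound = this
  have "C > 0" unfolding C_def c_def using ab by (simp add: add_pos_nonneg)
  then have "nrm (\<lambda>\<omega>. X \<omega> - X' \<omega>) \<le> 0 + e" if "e > 0" for e
    using bound[of "e / C"] that by simp
  then have "nrm (\<lambda>\<omega>. X \<omega> - X' \<omega>) \<le> 0" by (rule field_le_epsilon)
  then show ?thesis by (rule l2norm_eq_0_imp_AE_eq[OF Xsi X'si])
qed

lemma has_int_imp_has_stochastic_integral:
  assumes "i \<le> m" "0 \<le> a" "a \<le> b" "b \<le> T" "ms_continuous a b H" "has_int i a b H X"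
  shows "has_stochastic_integral M F f i a b H X"
  using assms has_int_imp_has_ms_integral has_int_imp_has_ito_integral
  by (auto simp: has_stochastic_integral_def)

lemma has_int_eq_stochastic_integral:
  assumes i: "i \<le> m" and ab: "0 \<le> a" "a \<le> b" "b \<le> T" and H: "ms_continuous a b H" and X: "has_int i a b H X"
    and X': "has_stochastic_integral M F f i a b H' X'"
    and eq: "\<And>s. a \<le> s \<Longrightarrow> s \<le> b \<Longrightarrow> AE \<omega> in M. H s \<omega> = H' s \<omega>"
  shows "AE \<omega> in M. X \<omega> = X' \<omega>"
proof (cases "i = 0")
  case False
  then show ?thesis
    using has_int_eq_ito_integral[OF _ ab H X _ eq] X' i by (simp add: has_stochastic_integral_def)
next
  case True
  have "has_partition_limit M a b (\<lambda>N \<tau>. step_integral i N \<tau> (\<lambda>l. H (\<tau> l))) X"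
    by (rule has_int_imp_has_partition_limit[OF i ab H X])
  moreover have "has_partition_limit M a b (\<lambda>N \<tau>. step_integral i N \<tau> (\<lambda>l. H' (\<tau> l))) X'"
    unfolding has_partition_limit_def
  proof (intro allI impI)
    fix N \<tau> assume r: "refining_partitions a b N \<tau>"
    \<comment> \<open>Left endpoints are among the permitted intermediate points, and with them the
      Riemann sums are step integrals.\<close>
    then have "\<forall>n. \<forall>l<N n. \<tau> n l \<in> {\<tau> n l..\<tau> n (Suc l)}"
      by (auto simp: refining_partitions_def is_partition_def less_imp_le)
    with r X' True show "ms_limit M (\<lambda>n. step_integral i (N n) (\<tau> n) (\<lambda>l. H' (\<tau> n l))) X'"
      by (simp add: has_stochastic_integral_def has_ms_integral_def step_integral_def[abs_def] integrator_def)
  qed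
  moreover have "AE \<omega> in M. step_integral i N \<tau> (\<lambda>l. H (\<tau> l)) \<omega> = step_integral i N \<tau> (\<lambda>l. H' (\<tau> l)) \<omega>"
    if p: "is_partition a b N \<tau>" for N \<tau>
  proof -
    have "AE \<omega> in M. \<forall>l\<in>{..<N}. H (\<tau> l) \<omega> = H' (\<tau> l) \<omega>"
      by (intro AE_finite_allI eq) (use is_partition_bounds[OF p] in auto)
    then show ?thesis by eventually_elim (simp add: step_integral_def)
  qed
  ultimately show ?thesis by (rule has_partition_limit_unique[OF ab(2)])
qed

section \<open>Iterated integrals\<close>

text \<open>
  The integration variables \<open>x 1, \<dots>, x n\<close> run over \<open>T = x 0 \<ge> x 1 \<ge> \<dots> \<ge> x n \<ge> a\<close>; the entries of \<open>x\<close>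
  beyond \<open>n\<close> are parameters frozen to the values of \<open>y\<close>.
\<close>

definition ordered_simplex :: "nat \<Rightarrow> real \<Rightarrow> (nat \<Rightarrow> real) \<Rightarrow> (nat \<Rightarrow> real) set" where
  "ordered_simplex n a y = {x. x 0 = T \<and> (\<forall>l<n. x (Suc l) \<le> x l) \<and> a \<le> x n \<and> (\<forall>l>n. x l = y l)}"

lemma simplex_decreasing:
  assumes "x \<in> ordered_simplex n a y" "j \<le> l" "l \<le> n"
  shows "x l \<le> x j"
  using assms(2,3)
proof (induction l rule: dec_induct)
  case (step l)
  then have "x (Suc l) \<le> x l" using assms(1) by (simp add: ordered_simplex_def)
  with step show ?case by simp
qed simp

lemma simplex_bounds:
  assumes "x \<in> ordered_simplex n a y" "l \<le> n"
  shows "a \<le> x l" "x l \<le> T"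
  using simplex_decreasing[OF assms(1), of l n] simplex_decreasing[OF assms(1), of 0 l] assms
  by (auto simp: ordered_simplex_def)

lemma simplex_upd:
  "x \<in> ordered_simplex n a y \<Longrightarrow> a \<le> u \<Longrightarrow> u \<le> x n \<Longrightarrow> x(Suc n := u) \<in> ordered_simplex (Suc n) a y"
  by (auto simp: ordered_simplex_def less_Suc_eq)

text \<open>For a parameter below the lower limit: \<open>\<tau> l\<close> is inserted as last
  coordinate while the other variables stay above \<open>\<tau> (Suc l)\<close>.\<close>

lemma simplex_upd_param:
  "x \<in> ordered_simplex n a y \<Longrightarrow> s \<le> c \<Longrightarrow> c \<le> a \<Longrightarrow> x(Suc n := c) \<in> ordered_simplex (Suc n) s y"
  by (auto simp: ordered_simplex_def less_Suc_eq)

lemma simplex_raise: "x \<in> ordered_simplex n s y \<Longrightarrow> a \<le> x n \<Longrightarrow> x \<in> ordered_simplex n a y"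
  by (auto simp: ordered_simplex_def)

text \<open>The conditions are chosen to survive integration over the last variable. That integral
  has upper limit \<open>x (n - 1)\<close> and so is adapted there; uniform continuity controls the
  change of the integrand, and the bound controls the change of the upper limit.\<close>

definition admissible :: "nat \<Rightarrow> real \<Rightarrow> (nat \<Rightarrow> real) \<Rightarrow> ((nat \<Rightarrow> real) \<Rightarrow> 'a \<Rightarrow> real) \<Rightarrow> bool" where
  "admissible n a y Q \<longleftrightarrow>
     (\<forall>x\<in>ordered_simplex n a y. adapted (x n) (Q x)) \<and>
     (\<exists>B. \<forall>x\<in>ordered_simplex n a y. nrm (Q x) \<le> B) \<and>
     (\<forall>\<epsilon>>0. \<exists>\<delta>>0. \<forall>x\<in>ordered_simplex n a y. \<forall>x'\<in>ordered_simplex n a y.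
        (\<forall>l\<le>n. \<bar>x l - x' l\<bar> < \<delta>) \<longrightarrow> nrm (\<lambda>\<omega>. Q x \<omega> - Q x' \<omega>) \<le> \<epsilon>)"

lemma admissible_bound:
  assumes "admissible n a y Q"
  obtains B where "0 \<le> B" "\<forall>x\<in>ordered_simplex n a y. nrm (Q x) \<le> B"
proof -
  obtain B where "\<forall>x\<in>ordered_simplex n a y. nrm (Q x) \<le> B" using assms by (auto simp: admissible_def)
  then have "\<forall>x\<in>ordered_simplex n a y. nrm (Q x) \<le> max 0 B" by (auto intro: max.coboundedI2)
  then show thesis by (intro that[of "max 0 B"]) auto
qed

lemma admissible_continuous:
  assumes "admissible n a y Q" "\<epsilon> > 0"
  obtains \<delta> where "\<delta> > 0" "\<forall>x\<in>ordered_simplex n a y. \<forall>x'\<in>ordered_simplex n a y.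
     (\<forall>l\<le>n. \<bar>x l - x' l\<bar> < \<delta>) \<longrightarrow> nrm (\<lambda>\<omega>. Q x \<omega> - Q x' \<omega>) \<le> \<epsilon>"
  using assms unfolding admissible_def by meson

lemma admissible_section_continuous:
  assumes Q: "admissible (Suc n) a y Q" and e: "\<epsilon> > 0"
  obtains \<delta> where "\<delta> > 0" "\<forall>x\<in>ordered_simplex n a y. \<forall>u\<in>{a..x n}. \<forall>v\<in>{a..x n}. \<bar>u - v\<bar> < \<delta> \<longrightarrow>
     nrm (\<lambda>\<omega>. Q (x(Suc n := u)) \<omega> - Q (x(Suc n := v)) \<omega>) \<le> \<epsilon>"
proof -
  obtain \<delta> where d: "\<delta> > 0" "\<forall>x\<in>ordered_simplex (Suc n) a y. \<forall>x'\<in>ordered_simplex (Suc n) a y.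
     (\<forall>l\<le>Suc n. \<bar>x l - x' l\<bar> < \<delta>) \<longrightarrow> nrm (\<lambda>\<omega>. Q x \<omega> - Q x' \<omega>) \<le> \<epsilon>"
    using admissible_continuous[OF Q e] .
  have "nrm (\<lambda>\<omega>. Q (x(Suc n := u)) \<omega> - Q (x(Suc n := v)) \<omega>) \<le> \<epsilon>"
    if "x \<in> ordered_simplex n a y" "u \<in> {a..x n}" "v \<in> {a..x n}" "\<bar>u - v\<bar> < \<delta>" for x u v
  proof -
    have "x(Suc n := u) \<in> ordered_simplex (Suc n) a y" "x(Suc n := v) \<in> ordered_simplex (Suc n) a y"
      using that by (auto intro: simplex_upd)
    moreover have "\<forall>l\<le>Suc n. \<bar>(x(Suc n := u)) l - (x(Suc n := v)) l\<bar> < \<delta>" using that d(1) by auto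
    ultimately show ?thesis using d(2) by blast
  qed
  then show thesis using d(1) that by blast
qed

lemma admissible_section:
  assumes Q: "admissible (Suc n) a y Q" and x: "x \<in> ordered_simplex n a y"
  shows "ms_continuous a (x n) (\<lambda>u. Q (x(Suc n := u)))"
  unfolding ms_continuous_def
proof (intro conjI ballI allI impI)
  fix u assume "u \<in> {a..x n}"
  then have "x(Suc n := u) \<in> ordered_simplex (Suc n) a y" using x by (auto intro: simplex_upd)
  then have "adapted ((x(Suc n := u)) (Suc n)) (Q (x(Suc n := u)))"
    using Q unfolding admissible_def by blast
  then show "adapted u (Q (x(Suc n := u)))" by simp
next
  fix \<epsilon> :: real assume "\<epsilon> > 0"
  from admissible_section_continuous[OF Q this] show "\<exists>\<delta>>0. \<forall>s\<in>{a..x n}. \<forall>u\<in>{a..x n}. \<bar>s - u\<bar> < \<delta> \<longrightarrow>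
      nrm (\<lambda>\<omega>. Q (x(Suc n := s)) \<omega> - Q (x(Suc n := u)) \<omega>) \<le> \<epsilon>"
    using x by metis
qed

text \<open>A version of the integral; it is meaningful only if \<open>has_int\<close> holds for some random variable.\<close>

definition integ :: "nat \<Rightarrow> real \<Rightarrow> real \<Rightarrow> (real \<Rightarrow> 'a \<Rightarrow> real) \<Rightarrow> 'a \<Rightarrow> real" where
  "integ i a b H = (SOME X. has_int i a b H X)"

lemma has_int_integ: "\<exists>X. has_int i a b H X \<Longrightarrow> has_int i a b H (integ i a b H)"
  unfolding integ_def by (rule someI_ex[of "has_int i a b H"])

lemma admissible_has_int:
  assumes i: "i \<le> m" and a: "0 \<le> a" and Q: "admissible (Suc n) a y Q" and x: "x \<in> ordered_simplex n a y"
  shows "has_int i a (x n) (\<lambda>u. Q (x(Suc n := u))) (integ i a (x n) (\<lambda>u. Q (x(Suc n := u))))"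
  using simplex_bounds[OF x order_refl] i a
  by (intro has_int_integ ms_continuous_has_int admissible_section[OF Q x]) auto

text \<open>A constant free of the interval, so that the bounds of nested integrations simply
  multiply.\<close>

lemma sqrt_bound:
  assumes "0 \<le> a" "a \<le> b" "b \<le> T"
  shows "sqrt ((T + 1) * (b - a)) \<le> T + 1"
proof -
  have "(T + 1) * (b - a) \<le> (T + 1) * (T + 1)" using assms by (intro mult_left_mono) auto
  then have "sqrt ((T + 1) * (b - a)) \<le> sqrt ((T + 1) * (T + 1))" by (rule real_sqrt_le_mono)
  then show ?thesis using assms by simp
qed

lemma has_int_bound_const:
  assumes "i \<le> m" "0 \<le> a" "a \<le> b" "b \<le> T" "has_int i a b H X"
    and d: "\<And>s. a \<le> s \<Longrightarrow> s < b \<Longrightarrow> nrm (H s) \<le> d" "0 \<le> d"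
  shows "nrm X \<le> (T + 1) * d"
  using has_int_bound[OF assms] mult_right_mono[OF sqrt_bound[OF assms(2-4)] d(2)] by linarith

lemma small_interval:
  assumes "\<epsilon> > 0" "0 \<le> B" "0 \<le> T"
  obtains \<delta> where "\<delta> > 0" "\<And>r. 0 \<le> r \<Longrightarrow> r < \<delta> \<Longrightarrow> sqrt ((T + 1) * r) * B \<le> \<epsilon>"
proof
  \<comment> \<open>\<open>B + 1\<close> replaces \<open>B\<close>, which may vanish; the condition
    on \<open>r\<close> is then what makes the root at most \<open>h\<close>.\<close>
  define h where "h = \<epsilon> / (B + 1)"
  have h: "h > 0" "h * B \<le> \<epsilon>" using assms by (auto simp: h_def field_simps)
  show "h\<^sup>2 / (T + 1) > 0" using h assms by simp
  fix r assume r: "0 \<le> r" "r < h\<^sup>2 / (T + 1)"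
  then have "(T + 1) * r \<le> h\<^sup>2" using assms by (simp add: field_simps)
  then have "sqrt ((T + 1) * r) \<le> h" using h by (intro real_le_lsqrt) auto
  then have "sqrt ((T + 1) * r) * B \<le> h * B" using assms by (intro mult_right_mono) auto
  then show "sqrt ((T + 1) * r) * B \<le> \<epsilon>" using h(2) by linarith
qed

text \<open>Continuity has two sources. If \<open>x n\<close> is the smaller upper limit, the
  integral up to \<open>x' n\<close> splits at \<open>x n\<close>: on the common part the integrands
  are uniformly close, and the rest is an integral of bounded integrands over a short
  interval.\<close>

lemma admissible_integ:
  assumes i: "i \<le> m" and a: "0 \<le> a" "a \<le> T" and Q: "admissible (Suc n) a y Q"
  shows "admissible n a y (\<lambda>x. integ i a (x n) (\<lambda>u. Q (x(Suc n := u))))"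
  unfolding admissible_def
proof (intro conjI ballI allI impI)
  note I = admissible_has_int[OF i a(1) Q]
  obtain B where B: "0 \<le> B" "\<forall>x\<in>ordered_simplex (Suc n) a y. nrm (Q x) \<le> B" using admissible_bound[OF Q] .
  have B': "nrm (Q (x(Suc n := u))) \<le> B" if "x \<in> ordered_simplex n a y" "a \<le> u" "u \<le> x n" for x u
    using B(2) simplex_upd[OF that] by blast
  show "adapted (x n) (integ i a (x n) (\<lambda>u. Q (x(Suc n := u))))" if "x \<in> ordered_simplex n a y" for x
    by (rule has_int_adapted[OF I[OF that]])
  show "\<exists>B. \<forall>x\<in>ordered_simplex n a y. nrm (integ i a (x n) (\<lambda>u. Q (x(Suc n := u)))) \<le> B"
  proof (intro exI ballI)
    fix x assume x: "x \<in> ordered_simplex n a y"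
    show "nrm (integ i a (x n) (\<lambda>u. Q (x(Suc n := u)))) \<le> (T + 1) * B"
      using simplex_bounds[OF x order_refl] B'[OF x] B(1)
      by (intro has_int_bound_const[OF i a(1) _ _ I[OF x]]) auto
  qed
  fix \<epsilon> :: real assume e: "\<epsilon> > 0"
  define h where "h = \<epsilon> / 2 / (T + 1)"
  have T1: "T + 1 > 0" using a by simp
  have h: "h > 0" using e T1 by (simp add: h_def)
  have hT: "(T + 1) * h = \<epsilon> / 2"
    using T1 unfolding h_def by (metis less_irrefl nonzero_mult_div_cancel_left times_divide_eq_right)
  obtain \<delta>1 where d1: "\<delta>1 > 0" "\<forall>x\<in>ordered_simplex (Suc n) a y. \<forall>x'\<in>ordered_simplex (Suc n) a y.
     (\<forall>l\<le>Suc n. \<bar>x l - x' l\<bar> < \<delta>1) \<longrightarrow> nrm (\<lambda>\<omega>. Q x \<omega> - Q x' \<omega>) \<le> h"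
    using admissible_continuous[OF Q h] .
  have T0: "0 \<le> T" using a by simp
  obtain \<delta>2 where d2: "\<delta>2 > 0" "\<And>r. 0 \<le> r \<Longrightarrow> r < \<delta>2 \<Longrightarrow> sqrt ((T + 1) * r) * B \<le> \<epsilon> / 2"
    using small_interval[of "\<epsilon>/2", OF _ B(1) T0] e by (metis half_gt_zero)
  have key: "nrm (\<lambda>\<omega>. integ i a (x n) (\<lambda>u. Q (x(Suc n := u))) \<omega> - integ i a (x' n) (\<lambda>u. Q (x'(Suc n := u))) \<omega>) \<le> \<epsilon>"
    if x: "x \<in> ordered_simplex n a y" and x': "x' \<in> ordered_simplex n a y" and cl: "\<forall>l\<le>n. \<bar>x l - x' l\<bar> < min \<delta>1 \<delta>2" and le: "x n \<le> x' n" for x x'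
  proof -
    let ?H = "\<lambda>u. Q (x(Suc n := u))" and ?H' = "\<lambda>u. Q (x'(Suc n := u))"
    let ?X = "integ i a (x n) ?H" and ?X' = "integ i a (x' n) ?H'"
    have b: "a \<le> x n" "x n \<le> T" "a \<le> x' n" "x' n \<le> T"
      using simplex_bounds[OF x order_refl] simplex_bounds[OF x' order_refl] by auto
    note H' = admissible_section[OF Q x']
    obtain X1 where X1: "has_int i a (x n) ?H' X1"
      using ms_continuous_has_int[OF i a(1) b(1,2) ms_continuous_subset[OF H' order_refl le]] by blast
    obtain X2 where X2: "has_int i (x n) (x' n) ?H' X2"
      using ms_continuous_has_int[OF i _ le b(4) ms_continuous_subset[OF H' b(1) order_refl]] a b by auto
    \<comment> \<open>Only almost sure, since \<open>integ\<close> and the two pieces are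
      independently chosen versions.\<close>
    have eq: "AE \<omega> in M. ?X' \<omega> = X1 \<omega> + X2 \<omega>"
      by (rule has_int_unique[OF i a(1) b(3,4) I[OF x'] has_int_concat[OF i a(1) b(1) le b(4) X1 X2]]) simp
    have n1: "nrm (\<lambda>\<omega>. ?X \<omega> - X1 \<omega>) \<le> (T + 1) * h"
    proof (rule has_int_bound_const[OF i a(1) b(1,2) has_int_diff[OF i a(1) b(2) I[OF x] X1]])
      fix u assume u: "a \<le> u" "u < x n"
      have "x(Suc n := u) \<in> ordered_simplex (Suc n) a y" "x'(Suc n := u) \<in> ordered_simplex (Suc n) a y"
        using u le x x' by (auto intro: simplex_upd)
      moreover have "\<forall>l\<le>Suc n. \<bar>(x(Suc n := u)) l - (x'(Suc n := u)) l\<bar> < \<delta>1" using cl d1(1) by auto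
      ultimately show "nrm (\<lambda>\<omega>. ?H u \<omega> - ?H' u \<omega>) \<le> h" using d1(2) by blast
    qed (use h in simp)
    have n2: "nrm X2 \<le> sqrt ((T + 1) * (x' n - x n)) * B"
      using a b B(1) le by (intro has_int_bound[OF i _ le b(4) X2] B'[OF x']) auto
    have "x' n - x n < \<delta>2" using cl by (auto simp: abs_less_iff)
    then have n2': "nrm X2 \<le> \<epsilon> / 2" using n2 d2(2)[of "x' n - x n"] le by linarith
    note si = has_int_sq_int[OF I[OF x]] has_int_sq_int[OF I[OF x']] has_int_sq_int[OF X1] has_int_sq_int[OF X2]
    note [measurable] = si[THEN square_integrable_measurable]
    have "nrm (\<lambda>\<omega>. ?X \<omega> - ?X' \<omega>) = nrm (\<lambda>\<omega>. (?X \<omega> - X1 \<omega>) - X2 \<omega>)"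
      using eq by (intro l2norm_cong_AE) auto
    also have "\<dots> \<le> nrm (\<lambda>\<omega>. ?X \<omega> - X1 \<omega>) + nrm X2"
      using l2norm_triangle[OF square_integrable_diff[OF si(1,3)] square_integrable_cmult[OF si(4), of "-1"]]
      by (simp add: l2norm_cmult[of M "-1" X2, simplified])
    finally show ?thesis using n1 n2' hT by linarith
  qed
  show "\<exists>\<delta>>0. \<forall>x\<in>ordered_simplex n a y. \<forall>x'\<in>ordered_simplex n a y. (\<forall>l\<le>n. \<bar>x l - x' l\<bar> < \<delta>) \<longrightarrow>
      nrm (\<lambda>\<omega>. integ i a (x n) (\<lambda>u. Q (x(Suc n := u))) \<omega> - integ i a (x' n) (\<lambda>u. Q (x'(Suc n := u))) \<omega>) \<le> \<epsilon>"
  proof (intro exI conjI ballI impI)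
    show "min \<delta>1 \<delta>2 > 0" using d1(1) d2(1) by simp
    fix x x' assume x: "x \<in> ordered_simplex n a y" "x' \<in> ordered_simplex n a y" and cl: "\<forall>l\<le>n. \<bar>x l - x' l\<bar> < min \<delta>1 \<delta>2"
    have cl': "\<forall>l\<le>n. \<bar>x' l - x l\<bar> < min \<delta>1 \<delta>2" using cl by (simp add: abs_minus_commute)
    show "nrm (\<lambda>\<omega>. integ i a (x n) (\<lambda>u. Q (x(Suc n := u))) \<omega> - integ i a (x' n) (\<lambda>u. Q (x'(Suc n := u))) \<omega>) \<le> \<epsilon>"
    proof (cases "x n \<le> x' n")
      case True
      then show ?thesis by (rule key[OF x cl])
    next
      case False
      then show ?thesis using key[OF x(2,1) cl'] by (subst l2norm_minus_commute) simp
    qed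
  qed
qed

text \<open>\<open>iter \<iota> a d q Q\<close> integrates out the variables \<open>q + 1, \<dots>, q + d\<close> with the integrators \<open>\<iota>\<close>, down to the lower limit \<open>a\<close>.\<close>

primrec iter :: "(nat \<Rightarrow> nat) \<Rightarrow> real \<Rightarrow> nat \<Rightarrow> nat \<Rightarrow> ((nat \<Rightarrow> real) \<Rightarrow> 'a \<Rightarrow> real) \<Rightarrow> (nat \<Rightarrow> real) \<Rightarrow> 'a \<Rightarrow> real" where
  "iter \<iota> a 0 q Q x = Q x"
| "iter \<iota> a (Suc d) q Q x = integ (\<iota> (Suc q)) a (x q) (\<lambda>u. iter \<iota> a d (Suc q) Q (x(Suc q := u)))"

lemma admissible_iter:
  assumes "0 \<le> a" "a \<le> T" "admissible (q + d) a y Q" "\<forall>j\<in>{q<..q + d}. \<iota> j \<le> m"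
  shows "admissible q a y (iter \<iota> a d q Q)"
  using assms(3,4)
proof (induction d arbitrary: q)
  case 0
  then show ?case by (simp add: iter.simps(1)[abs_def])
next
  case (Suc d)
  have "admissible (Suc q) a y (iter \<iota> a d (Suc q) Q)" using Suc by auto
  moreover have "\<iota> (Suc q) \<le> m" using Suc.prems by auto
  ultimately show ?case unfolding iter.simps(2)[abs_def] using assms(1,2) by (intro admissible_integ)
qed

lemma iter_has_int:
  assumes "0 \<le> a" "admissible (q + Suc d) a y Q" "\<forall>j\<in>{q<..q + Suc d}. \<iota> j \<le> m" and x: "x \<in> ordered_simplex q a y"
  shows "has_int (\<iota> (Suc q)) a (x q) (\<lambda>u. iter \<iota> a d (Suc q) Q (x(Suc q := u))) (iter \<iota> a (Suc d) q Q x)"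
proof -
  have aT: "a \<le> T" using simplex_bounds[OF x order_refl] by simp
  have "admissible (Suc q) a y (iter \<iota> a d (Suc q) Q)"
    using assms by (intro admissible_iter aT) auto
  from admissible_has_int[OF _ assms(1) this x, of "\<iota> (Suc q)"] assms(3) show ?thesis by simp
qed

text \<open>An exact equality of functions: updates at different coordinates commute, so
  \<open>integ\<close> is applied to identical integrands on both sides and chooses the same
  version.\<close>

lemma iter_upd_param:
  "q + d < j \<Longrightarrow> iter \<iota> a d q (\<lambda>x. Q (x(j := c))) x = iter \<iota> a d q Q (x(j := c))"
proof (induction d arbitrary: q x)
  case (Suc d)
  have "iter \<iota> a d (Suc q) (\<lambda>x. Q (x(j := c))) (x(Suc q := u)) = iter \<iota> a d (Suc q) Q ((x(j := c))(Suc q := u))" for u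
  proof -
    have "(x(Suc q := u))(j := c) = (x(j := c))(Suc q := u)"
      using Suc.prems by (intro fun_upd_twist) simp
    moreover have "iter \<iota> a d (Suc q) (\<lambda>x. Q (x(j := c))) (x(Suc q := u)) = iter \<iota> a d (Suc q) Q ((x(Suc q := u))(j := c))"
      by (rule Suc.IH) (use Suc.prems in simp)
    ultimately show ?thesis by (simp only:)
  qed
  moreover have "(x(j := c)) q = x q" using Suc.prems by simp
  ultimately show ?case by (simp only: iter.simps)
qed simp

text \<open>
  Neither \<open>C * H\<close> nor \<open>C * X\<close> is known to be square integrable here, so \<open>C\<close> is truncated and uniqueness is
  applied on each event \<open>\<bar>C\<bar> \<le> n\<close>.
\<close>

lemma has_int_mult_eq:
  assumes i: "i \<le> m" and ab: "0 \<le> a" "a \<le> b" "b \<le> T"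
    and X: "has_int i a b H X" and X': "has_int i a b H' X'" and C: "C \<in> borel_measurable (F a)"
    and eq: "\<And>s. a \<le> s \<Longrightarrow> s < b \<Longrightarrow> AE \<omega> in M. H' s \<omega> = C \<omega> * H s \<omega>"
  shows "AE \<omega> in M. X' \<omega> = C \<omega> * X \<omega>"
proof -
  note [measurable] = C
  define c :: "nat \<Rightarrow> 'a \<Rightarrow> real" where "c n \<omega> = (if \<bar>C \<omega>\<bar> \<le> real n then 1 else 0)" for n \<omega>
  have c[measurable]: "c n \<in> borel_measurable (F a)" for n unfolding c_def[abs_def] by measurable
  have "AE \<omega> in M. c n \<omega> * X' \<omega> = (c n \<omega> * C \<omega>) * X \<omega>" for n
  proof (rule has_int_unique[OF i ab])
    show "has_int i a b (\<lambda>s \<omega>. c n \<omega> * H' s \<omega>) (\<lambda>\<omega>. c n \<omega> * X' \<omega>)"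
      by (rule has_int_bounded_mult[OF i ab X' c, of _ 1]) (simp add: c_def)
    show "has_int i a b (\<lambda>s \<omega>. (c n \<omega> * C \<omega>) * H s \<omega>) (\<lambda>\<omega>. (c n \<omega> * C \<omega>) * X \<omega>)"
      by (rule has_int_bounded_mult[OF i ab X, of _ "real n"]) (measurable, simp add: c_def)
    fix s assume "a \<le> s" "s < b"
    from eq[OF this] show "AE \<omega> in M. c n \<omega> * H' s \<omega> = c n \<omega> * C \<omega> * H s \<omega>"
      by eventually_elim simp
  qed
  then have "AE \<omega> in M. \<forall>n. c n \<omega> * X' \<omega> = (c n \<omega> * C \<omega>) * X \<omega>"
    unfolding AE_all_countable by blast
  then show ?thesis
  proof eventually_elim
    case (elim \<omega>)
    obtain n :: nat where "\<bar>C \<omega>\<bar> \<le> real n" using real_arch_simple by blast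
    with elim[rule_format, of n] show ?case by (simp add: c_def)
  qed
qed

text \<open>All nested integrals share the lower limit \<open>a\<close>, at which \<open>C\<close>
  is known, so \<open>C\<close> passes through them one at a time. Admissibility of both families
  provides the integrals, whereas the products with \<open>C\<close> are handled only almost
  surely.\<close>

lemma iter_mult_eq:
  assumes a: "0 \<le> a" "a \<le> T" and C: "C \<in> borel_measurable (F a)"
    and Q: "admissible (q + d) a y Q" and Q': "admissible (q + d) a y Q'"
    and \<iota>: "\<forall>j\<in>{q<..q + d}. \<iota> j \<le> m"
    and eq: "\<And>x. x \<in> ordered_simplex (q + d) a y \<Longrightarrow> AE \<omega> in M. Q' x \<omega> = C \<omega> * Q x \<omega>"
    and x: "x \<in> ordered_simplex q a y"
  shows "AE \<omega> in M. iter \<iota> a d q Q' x \<omega> = C \<omega> * iter \<iota> a d q Q x \<omega>"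
  using Q Q' \<iota> eq x
proof (induction d arbitrary: q x)
  case 0
  then show ?case by simp
next
  case (Suc d)
  have b: "a \<le> x q" "x q \<le> T" using simplex_bounds[OF Suc.prems(5) order_refl] by auto
  have i: "\<iota> (Suc q) \<le> m" using Suc.prems(3) by auto
  show ?case
  proof (rule has_int_mult_eq[OF i a(1) b iter_has_int[OF a(1) Suc.prems(1,3,5)] iter_has_int[OF a(1) Suc.prems(2,3,5)] C])
    fix u assume u: "a \<le> u" "u < x q"
    show "AE \<omega> in M. iter \<iota> a d (Suc q) Q' (x(Suc q := u)) \<omega> = C \<omega> * iter \<iota> a d (Suc q) Q (x(Suc q := u)) \<omega>"
    proof (rule Suc.IH)
      show "x(Suc q := u) \<in> ordered_simplex (Suc q) a y" using u Suc.prems(5) by (intro simplex_upd) auto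
    qed (use Suc.prems in auto)
  qed
qed

section \<open>Interchanging the order of integration\<close>

lemma ms_continuous_bounded:
  assumes H: "ms_continuous a b H"
  obtains B where "0 \<le> B" "\<forall>s\<in>{a..b}. nrm (H s) \<le> B"
proof -
  have "continuous_on {a..b} (\<lambda>s. nrm (\<lambda>\<omega>. 0 - H s \<omega>))"
    by (rule continuous_on_nrm_diff[OF H]) simp
  then have "bounded ((\<lambda>s. nrm (\<lambda>\<omega>. 0 - H s \<omega>)) ` {a..b})"
    by (intro compact_imp_bounded compact_continuous_image) auto
  then obtain B where "\<forall>s\<in>{a..b}. \<bar>nrm (\<lambda>\<omega>. 0 - H s \<omega>)\<bar> \<le> B"
    by (auto simp: bounded_iff)
  moreover have "nrm (\<lambda>\<omega>. 0 - H s \<omega>) = nrm (H s)" for s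
    by (subst l2norm_minus_commute) simp
  ultimately show thesis by (intro that[of "max 0 B"]) (auto intro: max.coboundedI2)
qed

definition unif_bounded :: "((nat \<Rightarrow> real) \<Rightarrow> real) \<Rightarrow> nat \<Rightarrow> real \<Rightarrow> (nat \<Rightarrow> real) \<Rightarrow> bool" where
  "unif_bounded \<phi> n a y \<longleftrightarrow> (\<exists>B. \<forall>x\<in>ordered_simplex n a y. \<bar>\<phi> x\<bar> \<le> B) \<and>
     (\<forall>\<epsilon>>0. \<exists>\<delta>>0. \<forall>x\<in>ordered_simplex n a y. \<forall>x'\<in>ordered_simplex n a y.
        (\<forall>l\<le>n. \<bar>x l - x' l\<bar> < \<delta>) \<longrightarrow> \<bar>\<phi> x - \<phi> x'\<bar> \<le> \<epsilon>)"

lemma unif_bounded_bound: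
  assumes "unif_bounded \<phi> n a y"
  obtains B where "0 \<le> B" "\<forall>x\<in>ordered_simplex n a y. \<bar>\<phi> x\<bar> \<le> B"
proof -
  obtain B where "\<forall>x\<in>ordered_simplex n a y. \<bar>\<phi> x\<bar> \<le> B" using assms by (auto simp: unif_bounded_def)
  then have "\<forall>x\<in>ordered_simplex n a y. \<bar>\<phi> x\<bar> \<le> max 0 B" by (auto intro: max.coboundedI2)
  then show thesis by (intro that[of "max 0 B"]) auto
qed

lemma unif_bounded_fix_param:
  assumes \<phi>: "unif_bounded \<phi> (Suc n) s y" and c: "s \<le> c" "c \<le> a"
  shows "unif_bounded (\<lambda>x. \<phi> (x(Suc n := c))) n a y"
  unfolding unif_bounded_def
proof (intro conjI allI impI)
  note up = simplex_upd_param[OF _ c, of _ n y]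
  show "\<exists>B. \<forall>x\<in>ordered_simplex n a y. \<bar>\<phi> (x(Suc n := c))\<bar> \<le> B"
    using \<phi> up unfolding unif_bounded_def by blast
  fix \<epsilon> :: real assume "\<epsilon> > 0"
  then obtain \<delta> where d: "\<delta> > 0" "\<forall>x\<in>ordered_simplex (Suc n) s y. \<forall>x'\<in>ordered_simplex (Suc n) s y.
        (\<forall>l\<le>Suc n. \<bar>x l - x' l\<bar> < \<delta>) \<longrightarrow> \<bar>\<phi> x - \<phi> x'\<bar> \<le> \<epsilon>"
    using \<phi> unfolding unif_bounded_def by meson
  show "\<exists>\<delta>>0. \<forall>x\<in>ordered_simplex n a y. \<forall>x'\<in>ordered_simplex n a y.
        (\<forall>l\<le>n. \<bar>x l - x' l\<bar> < \<delta>) \<longrightarrow> \<bar>\<phi> (x(Suc n := c)) - \<phi> (x'(Suc n := c))\<bar> \<le> \<epsilon>"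
  proof (intro exI conjI ballI impI)
    show "\<delta> > 0" by (rule d(1))
    fix x x' assume "x \<in> ordered_simplex n a y" "x' \<in> ordered_simplex n a y" and cl: "\<forall>l\<le>n. \<bar>x l - x' l\<bar> < \<delta>"
    then have "x(Suc n := c) \<in> ordered_simplex (Suc n) s y" "x'(Suc n := c) \<in> ordered_simplex (Suc n) s y"
      using up by auto
    moreover have "\<forall>l\<le>Suc n. \<bar>(x(Suc n := c)) l - (x'(Suc n := c)) l\<bar> < \<delta>" using cl d(1) by auto
    ultimately show "\<bar>\<phi> (x(Suc n := c)) - \<phi> (x'(Suc n := c))\<bar> \<le> \<epsilon>" using d(2) by blast
  qed
qed

lemma product_diff_bound:
  assumes "sq_int X" "sq_int Y" "\<bar>p\<bar> \<le> B" "nrm (\<lambda>\<omega>. X \<omega> - Y \<omega>) \<le> d" "\<bar>p - q\<bar> \<le> e" "nrm Y \<le> B'"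
  shows "nrm (\<lambda>\<omega>. p * X \<omega> - q * Y \<omega>) \<le> B * d + e * B'"
proof -
  \<comment> \<open>The random factors and the deterministic coefficients are changed one after the
    other.\<close>
  have "(\<lambda>\<omega>. p * X \<omega> - q * Y \<omega>) = (\<lambda>\<omega>. p * (X \<omega> - Y \<omega>) + (p - q) * Y \<omega>)"
    by (auto simp: algebra_simps)
  then have "nrm (\<lambda>\<omega>. p * X \<omega> - q * Y \<omega>) \<le> \<bar>p\<bar> * nrm (\<lambda>\<omega>. X \<omega> - Y \<omega>) + \<bar>p - q\<bar> * nrm Y"
    using l2norm_triangle[OF square_integrable_cmult[OF square_integrable_diff[OF assms(1,2)], of p] square_integrable_cmult[OF assms(2), of "p - q"]]
    by (simp add: l2norm_cmult)
  also have "\<dots> \<le> B * d + e * B'"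
    using assms(3-6) by (intro add_mono mult_mono) (auto intro: order_trans[OF abs_ge_zero])
  finally show ?thesis .
qed

text \<open>
  Both kinds of integrands are covered: \<open>Z\<close> may depend on the last integration variable, or be a
  constant random variable known at the lower limit.
\<close>

lemma admissible_product:
  assumes \<phi>: "unif_bounded \<phi> n a y" and Z: "\<And>x. x \<in> ordered_simplex n a y \<Longrightarrow> adapted (x n) (Z (x n))"
    and B: "\<And>x. x \<in> ordered_simplex n a y \<Longrightarrow> nrm (Z (x n)) \<le> B"
    and c: "\<And>\<epsilon>. \<epsilon> > 0 \<Longrightarrow> \<exists>\<delta>>0. \<forall>x\<in>ordered_simplex n a y. \<forall>x'\<in>ordered_simplex n a y.
       \<bar>x n - x' n\<bar> < \<delta> \<longrightarrow> nrm (\<lambda>\<omega>. Z (x n) \<omega> - Z (x' n) \<omega>) \<le> \<epsilon>"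
  shows "admissible n a y (\<lambda>x \<omega>. \<phi> x * Z (x n) \<omega>)"
  unfolding admissible_def
proof (intro conjI ballI allI impI)
  obtain B1 where B1: "0 \<le> B1" "\<forall>x\<in>ordered_simplex n a y. \<bar>\<phi> x\<bar> \<le> B1" using unif_bounded_bound[OF \<phi>] .
  show "adapted (x n) (\<lambda>\<omega>. \<phi> x * Z (x n) \<omega>)" if "x \<in> ordered_simplex n a y" for x
    by (rule adapted_cmult[OF Z[OF that]])
  show "\<exists>B. \<forall>x\<in>ordered_simplex n a y. nrm (\<lambda>\<omega>. \<phi> x * Z (x n) \<omega>) \<le> B"
  proof (intro exI ballI)
    fix x assume x: "x \<in> ordered_simplex n a y"
    show "nrm (\<lambda>\<omega>. \<phi> x * Z (x n) \<omega>) \<le> B1 * B"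
      unfolding l2norm_cmult using B1 B[OF x] x by (intro mult_mono) auto
  qed
  fix \<epsilon> :: real assume e: "\<epsilon> > 0"
  \<comment> \<open>\<open>B\<close> can be negative when the simplex is empty, hence the absolute
    value; the 1 keeps the denominator positive.\<close>
  define h where "h = \<epsilon> / (B1 + \<bar>B\<bar> + 1)"
  have pos: "B1 + \<bar>B\<bar> + 1 > 0" using B1(1) by linarith
  have h: "h > 0" using e pos by (simp add: h_def)
  have "h * (B1 + \<bar>B\<bar>) \<le> h * (B1 + \<bar>B\<bar> + 1)" using h by (intro mult_left_mono) auto
  also have "\<dots> = \<epsilon>" using pos by (simp add: h_def)
  finally have hB: "B1 * h + h * \<bar>B\<bar> \<le> \<epsilon>" by (simp add: algebra_simps)
  obtain \<delta>1 where d1: "\<delta>1 > 0" "\<forall>x\<in>ordered_simplex n a y. \<forall>x'\<in>ordered_simplex n a y.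
        (\<forall>l\<le>n. \<bar>x l - x' l\<bar> < \<delta>1) \<longrightarrow> \<bar>\<phi> x - \<phi> x'\<bar> \<le> h"
    using \<phi> h unfolding unif_bounded_def by meson
  obtain \<delta>2 where d2: "\<delta>2 > 0" "\<forall>x\<in>ordered_simplex n a y. \<forall>x'\<in>ordered_simplex n a y.
       \<bar>x n - x' n\<bar> < \<delta>2 \<longrightarrow> nrm (\<lambda>\<omega>. Z (x n) \<omega> - Z (x' n) \<omega>) \<le> h"
    using c[OF h] by blast
  show "\<exists>\<delta>>0. \<forall>x\<in>ordered_simplex n a y. \<forall>x'\<in>ordered_simplex n a y. (\<forall>l\<le>n. \<bar>x l - x' l\<bar> < \<delta>) \<longrightarrow>
      nrm (\<lambda>\<omega>. \<phi> x * Z (x n) \<omega> - \<phi> x' * Z (x' n) \<omega>) \<le> \<epsilon>"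
  proof (intro exI conjI ballI impI)
    show "min \<delta>1 \<delta>2 > 0" using d1(1) d2(1) by simp
    fix x x' assume x: "x \<in> ordered_simplex n a y" "x' \<in> ordered_simplex n a y"
      and cl: "\<forall>l\<le>n. \<bar>x l - x' l\<bar> < min \<delta>1 \<delta>2"
    have p1: "\<bar>\<phi> x - \<phi> x'\<bar> \<le> h" using d1(2) x cl by auto
    have p2: "nrm (\<lambda>\<omega>. Z (x n) \<omega> - Z (x' n) \<omega>) \<le> h" using d2(2) x cl by auto
    have "nrm (\<lambda>\<omega>. \<phi> x * Z (x n) \<omega> - \<phi> x' * Z (x' n) \<omega>) \<le> B1 * h + h * \<bar>B\<bar>"
      by (rule product_diff_bound[OF adapted_sq_int[OF Z[OF x(1)]] adapted_sq_int[OF Z[OF x(2)]] _ p2 p1])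
        (use B1(2) B[OF x(2)] x in auto)
    then show "nrm (\<lambda>\<omega>. \<phi> x * Z (x n) \<omega> - \<phi> x' * Z (x' n) \<omega>) \<le> \<epsilon>" using hB by linarith
  qed
qed

lemma admissible_times_process:
  assumes \<phi>: "unif_bounded \<phi> n a y" and Z: "ms_continuous a T Z"
  shows "admissible n a y (\<lambda>x \<omega>. \<phi> x * Z (x n) \<omega>)"
proof -
  obtain B where B: "\<forall>s\<in>{a..T}. nrm (Z s) \<le> B" using ms_continuous_bounded[OF Z] .
  note b = simplex_bounds[OF _ order_refl, of _ n a y]
  show ?thesis
  proof (rule admissible_product[OF \<phi>, of Z B])
    fix \<epsilon> :: real assume "\<epsilon> > 0"
    from ms_continuousD[OF Z this] obtain \<delta> where "\<delta> > 0"
      "\<forall>s\<in>{a..T}. \<forall>u\<in>{a..T}. \<bar>s - u\<bar> < \<delta> \<longrightarrow> nrm (\<lambda>\<omega>. Z s \<omega> - Z u \<omega>) \<le> \<epsilon>" .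
    then show "\<exists>\<delta>>0. \<forall>x\<in>ordered_simplex n a y. \<forall>x'\<in>ordered_simplex n a y.
       \<bar>x n - x' n\<bar> < \<delta> \<longrightarrow> nrm (\<lambda>\<omega>. Z (x n) \<omega> - Z (x' n) \<omega>) \<le> \<epsilon>"
      using b by (intro exI[of _ \<delta>]) auto
  qed (use b B ms_continuous_adapted[OF Z] in auto)
qed

lemma admissible_times_variable:
  assumes \<phi>: "unif_bounded \<phi> n a y" and C: "adapted a C" and a: "0 \<le> a"
  shows "admissible n a y (\<lambda>x \<omega>. \<phi> x * C \<omega>)"
proof (rule admissible_product[OF \<phi>, of "\<lambda>_. C" "nrm C"])
  show "adapted (x n) C" if "x \<in> ordered_simplex n a y" for x
    using adapted_mono[OF C a] simplex_bounds[OF that order_refl] by simp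
  show "\<exists>\<delta>>0. \<forall>x\<in>ordered_simplex n a y. \<forall>x'\<in>ordered_simplex n a y.
       \<bar>x n - x' n\<bar> < \<delta> \<longrightarrow> nrm (\<lambda>\<omega>. C \<omega> - C \<omega>) \<le> \<epsilon>" if "\<epsilon> > 0" for \<epsilon>
    using that by (intro exI[of _ 1]) auto
qed simp

lemma admissible_deterministic:
  assumes "unif_bounded \<phi> n a y" "0 \<le> a"
  shows "admissible n a y (\<lambda>x \<omega>. \<phi> x)"
  using admissible_times_variable[OF assms(1) _ assms(2), of "\<lambda>_. 1"] square_integrable_const[of 1]
  by (simp add: adapted_def)

text \<open>
  The sum omits the partition interval that contains \<open>x n\<close>; as this interval is short, the integral over it
  is small in mean square.
\<close>

lemma last_integral_approximation:
  assumes i: "i \<le> m" and s: "0 \<le> s" "s \<le> T" and Q: "admissible (Suc n) s y Q" and e: "\<epsilon> > 0"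
  shows "\<exists>\<delta>>0. \<forall>N \<tau>. is_partition s T N \<tau> \<longrightarrow> (\<forall>l<N. \<tau> (Suc l) - \<tau> l < \<delta>) \<longrightarrow>
    (\<forall>x\<in>ordered_simplex n s y.
       nrm (\<lambda>\<omega>. (\<Sum>l<N. if \<tau> (Suc l) \<le> x n then Q (x(Suc n := \<tau> l)) \<omega> * (w i (\<tau> (Suc l)) \<omega> - w i (\<tau> l) \<omega>) else 0)
         - integ i s (x n) (\<lambda>u. Q (x(Suc n := u))) \<omega>) \<le> \<epsilon>)"
proof -
  define h where "h = \<epsilon> / 2 / (T + 1)"
  have T1: "T + 1 > 0" using s by simp
  have h: "h > 0" using e T1 by (simp add: h_def)
  have hT: "(T + 1) * h = \<epsilon> / 2"
    using T1 unfolding h_def by (metis less_irrefl nonzero_mult_div_cancel_left times_divide_eq_right)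
  obtain \<delta>1 where d1: "\<delta>1 > 0" "\<forall>x\<in>ordered_simplex n s y. \<forall>u\<in>{s..x n}. \<forall>v\<in>{s..x n}. \<bar>u - v\<bar> < \<delta>1 \<longrightarrow>
     nrm (\<lambda>\<omega>. Q (x(Suc n := u)) \<omega> - Q (x(Suc n := v)) \<omega>) \<le> h"
    using admissible_section_continuous[OF Q h] .
  obtain B where B: "0 \<le> B" "\<forall>x\<in>ordered_simplex (Suc n) s y. nrm (Q x) \<le> B" using admissible_bound[OF Q] .
  have T0: "0 \<le> T" using s by simp
  obtain \<delta>2 where d2: "\<delta>2 > 0" "\<And>r. 0 \<le> r \<Longrightarrow> r < \<delta>2 \<Longrightarrow> sqrt ((T + 1) * r) * B \<le> \<epsilon> / 2"
    using small_interval[of "\<epsilon>/2", OF _ B(1) T0] e by (metis half_gt_zero)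
  have "nrm (\<lambda>\<omega>. (\<Sum>l<N. if \<tau> (Suc l) \<le> x n then Q (x(Suc n := \<tau> l)) \<omega> * (w i (\<tau> (Suc l)) \<omega> - w i (\<tau> l) \<omega>) else 0)
         - integ i s (x n) (\<lambda>u. Q (x(Suc n := u))) \<omega>) \<le> \<epsilon>"
    if p: "is_partition s T N \<tau>" and mesh: "\<forall>l<N. \<tau> (Suc l) - \<tau> l < min \<delta>1 \<delta>2" and x: "x \<in> ordered_simplex n s y" for N \<tau> x
  proof -
    let ?H = "\<lambda>u. Q (x(Suc n := u))"
    let ?X = "integ i s (x n) ?H"
    have b: "s \<le> x n" "x n \<le> T" using simplex_bounds[OF x order_refl] by auto
    note X = admissible_has_int[OF i s(1) Q x]
    note H = admissible_section[OF Q x]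
    \<comment> \<open>\<open>p\<close> counts the partition intervals that lie wholly below
      \<open>x n\<close>; it equals \<open>N\<close> exactly when \<open>x n = T\<close>. The
      remainder \<open>[\<tau> p, x n]\<close> is shorter than the mesh.\<close>
    obtain p where pN: "p \<le> N" and \<tau>p: "\<tau> p \<le> x n" "x n - \<tau> p < \<delta>2" and iff: "\<And>l. l < N \<Longrightarrow> \<tau> (Suc l) \<le> x n \<longleftrightarrow> l < p"
    proof (cases "x n < T")
      case True
      obtain l where l: "l < N" "\<tau> l \<le> x n" "x n < \<tau> (Suc l)" using is_partition_find[OF p b(1) True] by blast
      show thesis
      proof (rule that[of l])
        show "x n - \<tau> l < \<delta>2" using mesh l by fastforce
        show "\<tau> (Suc j) \<le> x n \<longleftrightarrow> j < l" if "j < N" for j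
          using is_partition_le[OF p, of "Suc j" l] is_partition_le[OF p, of "Suc l" "Suc j"] l that
          by (cases "j < l") auto
      qed (use l in auto)
    next
      case False
      then have xT: "x n = T" using b by simp
      show thesis
      proof (rule that[of N])
        show "\<tau> (Suc j) \<le> x n \<longleftrightarrow> j < N" if "j < N" for j
          using is_partition_bounds[OF p, of "Suc j"] that xT by auto
      qed (use p xT d2(1) in \<open>auto simp: is_partition_def\<close>)
    qed
    have s\<tau>: "s \<le> \<tau> p" using is_partition_bounds[OF p pN] by simp
    have pp: "is_partition s (\<tau> p) p \<tau>" using p pN by (simp add: is_partition_def)
    have in_range: "s \<le> \<tau> l" "\<tau> l \<le> \<tau> p" if "l \<le> p" for l
      using is_partition_bounds[OF pp that] by auto
    have ap: "approximates s (\<tau> p) ?H h p \<tau> (\<lambda>l. ?H (\<tau> l))"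
      unfolding approximates_def
    proof (intro conjI allI impI ballI pp)
      fix l assume l: "l < p"
      have r: "s \<le> \<tau> l" "\<tau> l \<le> x n" "\<tau> (Suc l) \<le> x n"
        using in_range[of l] in_range[of "Suc l"] l \<tau>p by auto
      show "adapted (\<tau> l) (?H (\<tau> l))" using ms_continuous_adapted[OF H r(1,2)] .
      fix u assume u: "u \<in> {\<tau> l..<\<tau> (Suc l)}"
      then show "sq_int (?H u)" using ms_continuous_sq_int[OF H, of u] r by auto
      have "\<tau> (Suc l) - \<tau> l < \<delta>1" using mesh l pN by simp
      then have "\<bar>u - \<tau> l\<bar> < \<delta>1" using u by auto
      then show "nrm (\<lambda>\<omega>. ?H u \<omega> - ?H (\<tau> l) \<omega>) \<le> h" using d1(2) x u r by auto
    qed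
    obtain X1 where X1: "has_int i s (\<tau> p) ?H X1"
      using ms_continuous_has_int[OF i s(1) s\<tau> _ ms_continuous_subset[OF H order_refl \<tau>p(1)]] \<tau>p b by auto
    obtain X2 where X2: "has_int i (\<tau> p) (x n) ?H X2"
      using ms_continuous_has_int[OF i _ \<tau>p(1) b(2) ms_continuous_subset[OF H s\<tau> order_refl]] s s\<tau> by auto
    have eq: "AE \<omega> in M. ?X \<omega> = X1 \<omega> + X2 \<omega>"
      by (rule has_int_unique[OF i s(1) b X has_int_concat[OF i s(1) s\<tau> \<tau>p(1) b(2) X1 X2]]) simp
    let ?S = "step_integral i p \<tau> (\<lambda>l. ?H (\<tau> l))"
    have \<tau>T: "\<tau> p \<le> T" using \<tau>p b by simp
    have n1: "nrm (\<lambda>\<omega>. X1 \<omega> - ?S \<omega>) \<le> (T + 1) * h"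
    proof -
      have "nrm (\<lambda>\<omega>. X1 \<omega> - ?S \<omega>) \<le> sqrt ((T + 1) * (\<tau> p - s)) * h"
        by (rule has_int_step_dist[OF i s(1) \<tau>T X1 ap]) (use h in simp)
      also have "\<dots> \<le> (T + 1) * h" using h by (intro mult_right_mono[OF sqrt_bound[OF s(1) s\<tau> \<tau>T]]) simp
      finally show ?thesis .
    qed
    have n2: "nrm X2 \<le> \<epsilon> / 2"
    proof -
      have "nrm X2 \<le> sqrt ((T + 1) * (x n - \<tau> p)) * B"
      proof (rule has_int_bound[OF i _ \<tau>p(1) b(2) X2])
        fix u assume "\<tau> p \<le> u" "u < x n"
        then have "x(Suc n := u) \<in> ordered_simplex (Suc n) s y" using s\<tau> x by (intro simplex_upd) auto
        then show "nrm (?H u) \<le> B" using B(2) by blast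
      qed (use s s\<tau> B in auto)
      also have "\<dots> \<le> \<epsilon> / 2" using \<tau>p by (intro d2(2)) auto
      finally show ?thesis .
    qed
    have sum_eq: "(\<Sum>l<N. if \<tau> (Suc l) \<le> x n then ?H (\<tau> l) \<omega> * (w i (\<tau> (Suc l)) \<omega> - w i (\<tau> l) \<omega>) else 0) = ?S \<omega>" for \<omega>
    proof -
      have "(\<Sum>l<N. if \<tau> (Suc l) \<le> x n then ?H (\<tau> l) \<omega> * (w i (\<tau> (Suc l)) \<omega> - w i (\<tau> l) \<omega>) else 0)
          = (\<Sum>l<N. if l < p then ?H (\<tau> l) \<omega> * (w i (\<tau> (Suc l)) \<omega> - w i (\<tau> l) \<omega>) else 0)"
        by (intro sum.cong refl) (simp add: iff)
      also have "\<dots> = (\<Sum>l\<in>{l\<in>{..<N}. l < p}. ?H (\<tau> l) \<omega> * (w i (\<tau> (Suc l)) \<omega> - w i (\<tau> l) \<omega>))"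
        by (rule sum.inter_filter[symmetric]) simp
      also have "{l\<in>{..<N}. l < p} = {..<p}" using pN by auto
      finally show ?thesis unfolding step_integral_def .
    qed
    have Sa: "sq_int ?S"
      using step_integral_adapted[OF i s(1) \<tau>T approximatesD(1,2)[OF ap]] by (simp add: adapted_def)
    note si = has_int_sq_int[OF X] has_int_sq_int[OF X1] has_int_sq_int[OF X2]
    note [measurable] = si[THEN square_integrable_measurable] square_integrable_measurable[OF Sa]
    have "nrm (\<lambda>\<omega>. ?S \<omega> - ?X \<omega>) = nrm (\<lambda>\<omega>. (?S \<omega> - X1 \<omega>) + (-1) * X2 \<omega>)"
      using eq by (intro l2norm_cong_AE) auto
    also have "\<dots> \<le> nrm (\<lambda>\<omega>. ?S \<omega> - X1 \<omega>) + nrm (\<lambda>\<omega>. (-1) * X2 \<omega>)"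
      by (rule l2norm_triangle[OF square_integrable_diff[OF Sa si(2)] square_integrable_cmult[OF si(3)]])
    also have "nrm (\<lambda>\<omega>. (-1) * X2 \<omega>) = nrm X2" unfolding l2norm_cmult by simp
    also have "nrm (\<lambda>\<omega>. ?S \<omega> - X1 \<omega>) = nrm (\<lambda>\<omega>. X1 \<omega> - ?S \<omega>)" by (rule l2norm_minus_commute)
    finally have "nrm (\<lambda>\<omega>. ?S \<omega> - ?X \<omega>) \<le> \<epsilon>" using n1 n2 hT by linarith
    then show ?thesis unfolding sum_eq .
  qed
  then show ?thesis using d1(1) d2(1) by (intro exI[of _ "min \<delta>1 \<delta>2"]) (simp del: min_less_iff_conj)
qed

text \<open>
  Each factor of the \<open>l\<close>-th summand is known at time \<open>\<tau> (l + 1)\<close> and can be moved inside the outer integrals.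
  The sum then becomes an iterated integral of the sums of the previous lemma, cut off at \<open>x n\<close>, and the
  error made there is amplified by at most a factor \<open>T + 1\<close> by each of the \<open>n\<close> outer integrals.
\<close>

lemma reversed_sum_limit:
  assumes \<iota>: "\<forall>j\<in>{1..Suc n}. \<iota> j \<le> m" and s: "0 \<le> s" "s \<le> T" and \<phi>: "unif_bounded \<phi> (Suc n) s y"
    and Z: "ms_continuous s T Z" and x0: "x0 \<in> ordered_simplex 0 s y"
  shows "has_partition_limit M s T
     (\<lambda>N \<tau> \<omega>. \<Sum>l<N. Z (\<tau> l) \<omega> * (w (\<iota> (Suc n)) (\<tau> (Suc l)) \<omega> - w (\<iota> (Suc n)) (\<tau> l) \<omega>) *
        iter \<iota> (\<tau> (Suc l)) n 0 (\<lambda>x \<omega>. \<phi> x) (x0(Suc n := \<tau> l)) \<omega>)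
     (iter \<iota> s (Suc n) 0 (\<lambda>x \<omega>. \<phi> x * Z (x (Suc n)) \<omega>) x0)"
proof -
  define i where "i = \<iota> (Suc n)"
  have i: "i \<le> m" using \<iota> by (simp add: i_def)
  define Q where "Q x \<omega> = \<phi> x * Z (x (Suc n)) \<omega>" for x \<omega>
  have Q: "admissible (Suc n) s y Q" unfolding Q_def[abs_def] by (rule admissible_times_process[OF \<phi> Z])
  \<comment> \<open>The iterated integral of \<open>Q\<close> after \<open>q + 1, ..., n + 1\<close>
    have been integrated out; \<open>V 0\<close> is the claimed limit.\<close>
  define V where "V q = iter \<iota> s (Suc n - q) q Q" for q
  have T1: "T + 1 > 0" using s by simp
  define err where "err N \<tau> x \<omega> =
      (\<Sum>l<N. if \<tau> (Suc l) \<le> x n then Q (x(Suc n := \<tau> l)) \<omega> * (w i (\<tau> (Suc l)) \<omega> - w i (\<tau> l) \<omega>) else 0)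
        - integ i s (x n) (\<lambda>u. Q (x(Suc n := u))) \<omega>" for N :: nat and \<tau> x \<omega>
  define R where "R N \<tau> \<omega> = (\<Sum>l<N. Z (\<tau> l) \<omega> * (w i (\<tau> (Suc l)) \<omega> - w i (\<tau> l) \<omega>) * iter \<iota> (\<tau> (Suc l)) n 0 (\<lambda>x \<omega>. \<phi> x) (x0(Suc n := \<tau> l)) \<omega>)" for N \<tau> \<omega>
  \<comment> \<open>An estimate for one fixed partition: the distance from the reversed sum to the
    limit is at most \<open>(T + 1) ^ n\<close> times the uniform error of the innermost sums. The
    choice of the mesh is deferred to the end.\<close>
  have part: "sq_int (R N \<tau>) \<and> (\<forall>e. 0 \<le> e \<longrightarrow> (\<forall>x\<in>ordered_simplex n s y. nrm (err N \<tau> x) \<le> e) \<longrightarrow>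
       nrm (\<lambda>\<omega>. R N \<tau> \<omega> - V 0 x0 \<omega>) \<le> (T + 1) ^ n * e)" if p: "is_partition s T N \<tau>" for N \<tau>
  proof -
    have bd: "s \<le> \<tau> l" "\<tau> l \<le> \<tau> (Suc l)" "\<tau> (Suc l) \<le> T" if "l < N" for l
      using is_partition_bounds[OF p, of l] is_partition_bounds[OF p, of "Suc l"] is_partition_le[OF p, of l "Suc l"] that by auto
    define C where "C l \<omega> = Z (\<tau> l) \<omega> * (w i (\<tau> (Suc l)) \<omega> - w i (\<tau> l) \<omega>)" for l \<omega>
    have C: "adapted (\<tau> (Suc l)) (C l)" if "l < N" for l
      unfolding C_def[abs_def] using bd[OF that] s
      by (intro adapted_increment_mult[OF i] ms_continuous_adapted[OF Z]) auto
    define P where "P l x \<omega> = \<phi> (x(Suc n := \<tau> l)) * C l \<omega>" for l x \<omega>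
    have \<phi>l: "unif_bounded (\<lambda>x. \<phi> (x(Suc n := \<tau> l))) n (\<tau> (Suc l)) y" if "l < N" for l
      using bd[OF that] by (intro unif_bounded_fix_param[OF \<phi>]) auto
    have \<tau>0: "0 \<le> \<tau> (Suc l)" if "l < N" for l using bd[OF that] s by simp
    have P: "admissible n (\<tau> (Suc l)) y (P l)" if "l < N" for l
      unfolding P_def[abs_def] by (rule admissible_times_variable[OF \<phi>l[OF that] C[OF that] \<tau>0[OF that]])
    \<comment> \<open>The \<open>l\<close>-th summand after part of the outer integrations, with
      \<open>C l\<close> inside. Setting it to zero for \<open>x q\<close> below
      \<open>\<tau> (Suc l)\<close> replaces the lower limit \<open>\<tau> (Suc l)\<close> by the
      limit \<open>s\<close> common to all summands.\<close>
    define G where "G l q x = (if \<tau> (Suc l) \<le> x q then iter \<iota> (\<tau> (Suc l)) (n - q) q (P l) x else (\<lambda>\<omega>. 0))" for l q x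
    define D where "D q x \<omega> = (\<Sum>l<N. G l q x \<omega>) - V q x \<omega>" for q x \<omega>
    have G_int: "has_int (\<iota> (Suc q)) s (x q) (\<lambda>u. G l (Suc q) (x(Suc q := u))) (G l q x)"
      if l: "l < N" and q: "q < n" and x: "x \<in> ordered_simplex q s y" for l q x
    proof -
      have b: "s \<le> x q" "x q \<le> T" using simplex_bounds[OF x order_refl] by auto
      have j: "\<iota> (Suc q) \<le> m" using \<iota> q by simp
      show ?thesis
      proof (cases "\<tau> (Suc l) \<le> x q")
        case True
        have x': "x \<in> ordered_simplex q (\<tau> (Suc l)) y" by (rule simplex_raise[OF x True])
        have nq: "n - q = Suc (n - Suc q)" "q + Suc (n - Suc q) = n" using q by auto
        have jj: "\<forall>j\<in>{q<..q + Suc (n - Suc q)}. \<iota> j \<le> m" using \<iota> nq(2) by auto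
        have I: "has_int (\<iota> (Suc q)) (\<tau> (Suc l)) (x q) (\<lambda>u. iter \<iota> (\<tau> (Suc l)) (n - Suc q) (Suc q) (P l) (x(Suc q := u)))
            (iter \<iota> (\<tau> (Suc l)) (Suc (n - Suc q)) q (P l) x)"
          by (rule iter_has_int[OF \<tau>0[OF l] _ jj x']) (use P[OF l] nq(2) in simp)
        have s\<tau>: "s \<le> \<tau> (Suc l)" using bd[OF l] by simp
        \<comment> \<open>On \<open>[s, \<tau> (Suc l))\<close> the cut-off integrand vanishes, so
          concatenation with the zero integral extends the range down to \<open>s\<close>.\<close>
        have "has_int (\<iota> (Suc q)) s (x q) (\<lambda>u. G l (Suc q) (x(Suc q := u)))
            (\<lambda>\<omega>. 0 + iter \<iota> (\<tau> (Suc l)) (Suc (n - Suc q)) q (P l) x \<omega>)"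
        proof (rule has_int_concat[OF j s(1) s\<tau> True b(2)])
          show "has_int (\<iota> (Suc q)) s (\<tau> (Suc l)) (\<lambda>u. G l (Suc q) (x(Suc q := u))) (\<lambda>\<omega>. 0)"
            by (rule has_int_cong[OF has_int_zero[OF s\<tau>]]) (simp add: G_def)
          show "has_int (\<iota> (Suc q)) (\<tau> (Suc l)) (x q) (\<lambda>u. G l (Suc q) (x(Suc q := u)))
              (iter \<iota> (\<tau> (Suc l)) (Suc (n - Suc q)) q (P l) x)"
            by (rule has_int_cong[OF I]) (simp add: G_def)
        qed
        moreover have "G l q x = iter \<iota> (\<tau> (Suc l)) (Suc (n - Suc q)) q (P l) x"
          using True nq(1) by (simp only: G_def if_True)
        ultimately show ?thesis by simp
      next
        case False
        then have "G l q x = (\<lambda>\<omega>. 0)" by (simp add: G_def)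
        moreover have "has_int (\<iota> (Suc q)) s (x q) (\<lambda>u. G l (Suc q) (x(Suc q := u))) (\<lambda>\<omega>. 0)"
          by (rule has_int_cong[OF has_int_zero[OF b(1)]]) (use False in \<open>simp add: G_def\<close>)
        ultimately show ?thesis by simp
      qed
    qed
    have V_int: "has_int (\<iota> (Suc q)) s (x q) (\<lambda>u. V (Suc q) (x(Suc q := u))) (V q x)"
      if q: "q \<le> n" and x: "x \<in> ordered_simplex q s y" for q x
    proof -
      have nq: "Suc n - q = Suc (n - q)" "q + Suc (n - q) = Suc n" using q by auto
      have jj: "\<forall>j\<in>{q<..q + Suc (n - q)}. \<iota> j \<le> m" using \<iota> nq(2) by auto
      show ?thesis
        unfolding V_def nq(1) diff_Suc_Suc by (rule iter_has_int[OF s(1) _ jj x]) (use Q nq(2) in simp)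
    qed
    have D_int: "has_int (\<iota> (Suc q)) s (x q) (\<lambda>u. D (Suc q) (x(Suc q := u))) (D q x)"
      if q: "q < n" and x: "x \<in> ordered_simplex q s y" for q x
    proof -
      have b: "s \<le> x q" "x q \<le> T" using simplex_bounds[OF x order_refl] by auto
      have j: "\<iota> (Suc q) \<le> m" using \<iota> q by simp
      have "has_int (\<iota> (Suc q)) s (x q) (\<lambda>u \<omega>. \<Sum>l<N. G l (Suc q) (x(Suc q := u)) \<omega>) (\<lambda>\<omega>. \<Sum>l<N. G l q x \<omega>)"
        by (rule has_int_sum[OF j s(1) b G_int[OF _ q x]])
      from has_int_diff[OF j s(1) b(2) this V_int[OF less_imp_le[OF q] x]]
      show ?thesis by (simp only: D_def[abs_def])
    qed
    \<comment> \<open>Before any outer integration, the sum of the cut-off summands is precisely the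
      truncated integral sum for the innermost variable.\<close>
    have D_n: "D n x = err N \<tau> x" for x
    proof
      fix \<omega>
      have "G l n x \<omega> = (if \<tau> (Suc l) \<le> x n then Q (x(Suc n := \<tau> l)) \<omega> * (w i (\<tau> (Suc l)) \<omega> - w i (\<tau> l) \<omega>) else 0)" for l
        by (simp add: G_def P_def C_def Q_def mult.assoc)
      moreover have "V n x = integ i s (x n) (\<lambda>u. Q (x(Suc n := u)))"
        by (simp add: V_def i_def Suc_diff_le)
      ultimately show "D n x \<omega> = err N \<tau> x \<omega>" by (simp only: D_def err_def)
    qed
    \<comment> \<open>\<open>d\<close> counts the outer integrations carried out so far. By
      linearity \<open>D\<close> at each level is the integral of \<open>D\<close> at the next one,
      and every integration costs a factor \<open>T + 1\<close>.\<close>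
    have D_bound: "\<forall>x\<in>ordered_simplex (n - d) s y. nrm (D (n - d) x) \<le> (T + 1) ^ d * e"
      if e: "0 \<le> e" and base: "\<forall>x\<in>ordered_simplex n s y. nrm (err N \<tau> x) \<le> e" and "d \<le> n" for d e
      using that(3)
    proof (induction d)
      case 0
      then show ?case using base by (simp add: D_n)
    next
      case (Suc d)
      define q where "q = n - Suc d"
      have q: "q < n" "Suc q = n - d" using Suc.prems by (auto simp: q_def)
      have IH: "\<forall>x\<in>ordered_simplex (Suc q) s y. nrm (D (Suc q) x) \<le> (T + 1) ^ d * e"
        using Suc by (simp add: q(2))
      have "nrm (D q x) \<le> (T + 1) * ((T + 1) ^ d * e)" if x: "x \<in> ordered_simplex q s y" for x
      proof -
        have b: "s \<le> x q" "x q \<le> T" using simplex_bounds[OF x order_refl] by auto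
        have j: "\<iota> (Suc q) \<le> m" using \<iota> q by simp
        show ?thesis
        proof (rule has_int_bound_const[OF j s(1) b D_int[OF q(1) x]])
          fix u assume "s \<le> u" "u < x q"
          then have "x(Suc q := u) \<in> ordered_simplex (Suc q) s y" using x by (intro simplex_upd) auto
          then show "nrm (D (Suc q) (x(Suc q := u))) \<le> (T + 1) ^ d * e" using IH by blast
        qed (use e T1 in simp)
      qed
      then show ?case by (simp add: q_def mult.assoc)
    qed
    have x0T: "x0 0 = T" using x0 by (simp add: ordered_simplex_def)
    define E where "E l = iter \<iota> (\<tau> (Suc l)) n 0 (\<lambda>x \<omega>. \<phi> x) (x0(Suc n := \<tau> l))" for l
    \<comment> \<open>\<open>C l\<close> is known at \<open>\<tau> (Suc l)\<close>, the lower limit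
      of all integrals in \<open>G l\<close>, and so comes out of them. Square integrability is
      recorded for \<open>G l\<close>, as a value of an admissible family, and passes to the sum of
      the products through the almost sure equality.\<close>
    have G_eq: "sq_int (G l 0 x0) \<and> E l \<in> borel_measurable M \<and> (AE \<omega> in M. G l 0 x0 \<omega> = C l \<omega> * E l \<omega>)" if l: "l < N" for l
    proof -
      have x0': "x0 \<in> ordered_simplex 0 (\<tau> (Suc l)) y"
        using simplex_raise[OF x0, of "\<tau> (Suc l)"] bd[OF l] x0T by simp
      have jj: "\<forall>j\<in>{0<..0 + n}. \<iota> j \<le> m" using \<iota> by auto
      have ad1: "admissible (0 + n) (\<tau> (Suc l)) y (P l)" using P[OF l] by simp
      have ad2: "admissible (0 + n) (\<tau> (Suc l)) y (\<lambda>x \<omega>. \<phi> (x(Suc n := \<tau> l)))"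
        using admissible_deterministic[OF \<phi>l[OF l] \<tau>0[OF l]] by simp
      have G0: "G l 0 x0 = iter \<iota> (\<tau> (Suc l)) n 0 (P l) x0" using bd[OF l] x0T by (simp add: G_def)
      have E: "E l = iter \<iota> (\<tau> (Suc l)) n 0 (\<lambda>x \<omega>. \<phi> (x(Suc n := \<tau> l))) x0"
        unfolding E_def by (rule iter_upd_param[symmetric, where Q="\<lambda>x \<omega>. \<phi> x"]) simp
      have "AE \<omega> in M. iter \<iota> (\<tau> (Suc l)) n 0 (P l) x0 \<omega> = C l \<omega> * iter \<iota> (\<tau> (Suc l)) n 0 (\<lambda>x \<omega>. \<phi> (x(Suc n := \<tau> l))) x0 \<omega>"
        by (rule iter_mult_eq[OF \<tau>0[OF l] bd(3)[OF l] adapted_measurable[OF C[OF l]] ad2 ad1 jj _ x0'])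
          (simp add: P_def mult.commute)
      moreover have "adapted T (iter \<iota> (\<tau> (Suc l)) n 0 (P l) x0)" "adapted T (iter \<iota> (\<tau> (Suc l)) n 0 (\<lambda>x \<omega>. \<phi> (x(Suc n := \<tau> l))) x0)"
        using admissible_iter[OF \<tau>0[OF l] bd(3)[OF l] ad1 jj] admissible_iter[OF \<tau>0[OF l] bd(3)[OF l] ad2 jj] x0' x0T
        by (auto simp: admissible_def)
      ultimately show ?thesis unfolding G0 E by (auto simp: adapted_def square_integrable_def)
    qed
    have R_eq: "R N \<tau> = (\<lambda>\<omega>. \<Sum>l<N. C l \<omega> * E l \<omega>)"
      by (simp add: R_def[abs_def] C_def E_def)
    have RG: "AE \<omega> in M. (\<Sum>l<N. G l 0 x0 \<omega>) = R N \<tau> \<omega>"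
    proof -
      have "AE \<omega> in M. \<forall>l\<in>{..<N}. G l 0 x0 \<omega> = C l \<omega> * E l \<omega>"
        by (intro AE_finite_allI) (use G_eq in auto)
      then show ?thesis by eventually_elim (simp add: R_eq)
    qed
    have Gsi: "sq_int (\<lambda>\<omega>. \<Sum>l<N. G l 0 x0 \<omega>)" using G_eq by (intro square_integrable_sum) auto
    have Rm: "R N \<tau> \<in> borel_measurable M"
      unfolding R_eq using G_eq square_integrable_measurable[OF adapted_sq_int[OF C]]
      by (intro borel_measurable_sum borel_measurable_times) auto
    have Rsi: "sq_int (R N \<tau>)" by (rule square_integrable_cong_AE[OF Gsi Rm RG])
    have Vsi: "sq_int (V 0 x0)" by (rule has_int_sq_int[OF V_int[OF _ x0]]) simp
    note [measurable] = Rm square_integrable_measurable[OF Gsi] square_integrable_measurable[OF Vsi]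
    have "nrm (\<lambda>\<omega>. R N \<tau> \<omega> - V 0 x0 \<omega>) = nrm (D 0 x0)"
      unfolding D_def[abs_def] using RG by (intro l2norm_cong_AE) auto
    with Rsi D_bound[of _ n] x0 show ?thesis by simp
  qed
  have "has_partition_limit M s T R (V 0 x0)"
    unfolding has_partition_limit_def
  proof (intro allI impI ms_limitI)
    fix N \<tau> assume r: "refining_partitions s T N \<tau>"
    then have p: "is_partition s T (N k) (\<tau> k)" for k by (simp add: refining_partitions_def)
    have "admissible 0 s y (iter \<iota> s (Suc n) 0 Q)"
      by (rule admissible_iter[OF s]) (use Q \<iota> in auto)
    then show "sq_int (V 0 x0)" using x0 by (auto simp: V_def admissible_def adapted_def simp del: iter.simps)
    show "sq_int (R (N k) (\<tau> k))" for k using part[OF p] by blast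
    fix \<epsilon> :: real assume e: "\<epsilon> > 0"
    \<comment> \<open>Compensates the amplification of the innermost error by the \<open>n\<close>
      outer integrations.\<close>
    define e' where "e' = \<epsilon> / (T + 1) ^ n"
    have e': "e' > 0" "(T + 1) ^ n * e' = \<epsilon>" using e T1 by (simp_all add: e'_def)
    obtain \<delta> where d: "\<delta> > 0" "\<forall>N \<tau>. is_partition s T N \<tau> \<longrightarrow> (\<forall>l<N. \<tau> (Suc l) - \<tau> l < \<delta>) \<longrightarrow>
        (\<forall>x\<in>ordered_simplex n s y. nrm (err N \<tau> x) \<le> e')"
      using last_integral_approximation[OF i s Q e'(1)] unfolding err_def[abs_def] by blast
    have "\<forall>\<^sub>F k in sequentially. \<forall>l<N k. \<tau> k (Suc l) - \<tau> k l < \<delta>"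
      using r d(1) by (simp add: refining_partitions_def)
    then show "\<forall>\<^sub>F k in sequentially. nrm (\<lambda>\<omega>. R (N k) (\<tau> k) \<omega> - V 0 x0 \<omega>) \<le> \<epsilon>"
    proof eventually_elim
      case (elim k)
      then have "\<forall>x\<in>ordered_simplex n s y. nrm (err (N k) (\<tau> k) x) \<le> e'" using d(2) p by blast
      then show ?case using part[OF p, of k] less_imp_le[OF e'(1)] unfolding e'(2)[symmetric] by blast
    qed
  qed
  then show ?thesis unfolding R_def[abs_def] V_def i_def Q_def[abs_def] by simp
qed

end

section \<open>Continuous functions of decreasing points\<close>

lemma decreasing_points_iff:
  "x \<in> decreasing_points p q a b \<longleftrightarrow>
     (\<forall>j\<in>{p..q}. a \<le> x j \<and> x j \<le> b) \<and> (\<forall>j. j \<notin> {p..q} \<longrightarrow> x j = undefined) \<and>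
     (\<forall>j\<in>{p..q}. \<forall>l\<in>{p..q}. j \<le> l \<longrightarrow> x l \<le> x j)"
  by (auto simp: decreasing_points_def PiE_iff extensional_def monotone_on_def)

text \<open>Tychonoff: the set is a closed part of a product of intervals and, at the indices
  outside \<open>{p..q}\<close>, of the singletons \<open>{undefined}\<close>.\<close>

lemma compact_decreasing_points: "compact (decreasing_points p q a b)"
proof -
  define S where "S j = (if j \<in> {p..q} then {a..b} else {undefined :: real})" for j :: nat
  have "compactin (product_topology (\<lambda>j. euclidean) UNIV) (PiE UNIV S)"
    unfolding compactin_PiE by (auto simp: S_def)
  then have "compact (PiE UNIV S)" by (simp add: euclidean_product_topology)
  moreover have "closed {x :: nat \<Rightarrow> real. \<forall>j\<in>{p..q}. \<forall>l\<in>{p..q}. j \<le> l \<longrightarrow> x l \<le> x j}"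
    unfolding Ball_def
    by (intro closed_Collect_all closed_Collect_imp open_Collect_const closed_Collect_le continuous_on_product_coordinates)
  ultimately have "compact (PiE UNIV S \<inter> {x. \<forall>j\<in>{p..q}. \<forall>l\<in>{p..q}. j \<le> l \<longrightarrow> x l \<le> x j})"
    by (rule compact_Int_closed)
  moreover have "decreasing_points p q a b = PiE UNIV S \<inter> {x. \<forall>j\<in>{p..q}. \<forall>l\<in>{p..q}. j \<le> l \<longrightarrow> x l \<le> x j}"
    by (rule set_eqI) (auto simp: decreasing_points_iff S_def PiE_iff split: if_splits)
  ultimately show ?thesis by simp
qed

lemma coordinatewise_close_imp_dist_less:
  fixes e :: real
  assumes "e > 0"
  obtains d where "d > 0" "\<And>x y :: nat \<Rightarrow> real. (\<And>j. \<bar>x j - y j\<bar> < d) \<Longrightarrow> dist x y < e"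
proof -
  \<comment> \<open>The distance on sequences is at most twice the maximum over the first
    coordinates plus the tail \<open>(1/2)^N\<close>; a coordinate error below \<open>e / 4\<close>
    makes the first part less than \<open>e / 2\<close>.\<close>
  obtain N :: nat where N: "(1/2)^N < e / 2" using real_arch_pow_inv[of "e/2" "1/2"] assms by auto
  have "dist x y < e" if c: "\<And>j. \<bar>x j - y j\<bar> < e / 4" for x y :: "nat \<Rightarrow> real"
  proof -
    let ?S = "{dist (x (from_nat n)) (y (from_nat n)) |n. n \<le> N}"
    have S: "?S = (\<lambda>n. dist (x (from_nat n)) (y (from_nat n))) ` {..N}" by auto
    have "Max ?S < e / 4" unfolding S using c by (subst Max_less_iff) (auto simp: dist_real_def)
    then show ?thesis using dist_fun_le_dist_first_terms[of x y N] N by linarith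
  qed
  then show thesis using assms by (intro that[of "e/4"]) auto
qed

lemma decreasing_points_uniform:
  assumes "continuous_on (decreasing_points 1 p a b) \<Phi>" and e: "(\<epsilon>::real) > 0"
  obtains \<delta> where "\<delta> > 0"
    "\<forall>z\<in>decreasing_points 1 p a b. \<forall>z'\<in>decreasing_points 1 p a b. (\<forall>j. \<bar>z j - z' j\<bar> < \<delta>) \<longrightarrow> \<bar>\<Phi> z - \<Phi> z'\<bar> \<le> \<epsilon>"
proof -
  have "uniformly_continuous_on (decreasing_points 1 p a b) \<Phi>"
    by (rule compact_uniformly_continuous[OF assms(1) compact_decreasing_points])
  then obtain d where d: "d > 0"
    "\<And>z z'. z \<in> decreasing_points 1 p a b \<Longrightarrow> z' \<in> decreasing_points 1 p a b \<Longrightarrow> dist z' z < d \<Longrightarrow> dist (\<Phi> z') (\<Phi> z) < \<epsilon>"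
    using e unfolding uniformly_continuous_on_def by metis
  obtain \<delta> where \<delta>: "\<delta> > 0" "\<And>x y :: nat \<Rightarrow> real. (\<And>j. \<bar>x j - y j\<bar> < \<delta>) \<Longrightarrow> dist x y < d"
    using coordinatewise_close_imp_dist_less[OF d(1)] by blast
  show thesis
  proof (rule that[OF \<delta>(1)], intro ballI impI)
    fix z z' assume z: "z \<in> decreasing_points 1 p a b" "z' \<in> decreasing_points 1 p a b" and "\<forall>j. \<bar>z j - z' j\<bar> < \<delta>"
    then have "dist z z' < d" by (intro \<delta>(2)) simp
    then have "dist (\<Phi> z) (\<Phi> z') < \<epsilon>" by (rule d(2)[OF z(2,1)])
    then show "\<bar>\<Phi> z - \<Phi> z'\<bar> \<le> \<epsilon>" by (simp add: dist_real_def)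
  qed
qed

context wiener_setting
begin

lemma unif_bounded_restrict:
  assumes \<Phi>: "continuous_on (decreasing_points 1 p t T) \<Phi>"
    and sub: "\<And>x. x \<in> ordered_simplex n a y \<Longrightarrow> restrict x {1..p} \<in> decreasing_points 1 p t T"
  shows "unif_bounded (\<lambda>x. \<Phi> (restrict x {1..p})) n a y"
  unfolding unif_bounded_def
proof (intro conjI allI impI)
  have "bounded (\<Phi> ` decreasing_points 1 p t T)"
    by (intro compact_imp_bounded compact_continuous_image[OF \<Phi>] compact_decreasing_points)
  then obtain B where "\<forall>z\<in>decreasing_points 1 p t T. \<bar>\<Phi> z\<bar> \<le> B" by (auto simp: bounded_iff)
  then show "\<exists>B. \<forall>x\<in>ordered_simplex n a y. \<bar>\<Phi> (restrict x {1..p})\<bar> \<le> B" using sub by blast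
  fix \<epsilon> :: real assume "\<epsilon> > 0"
  from decreasing_points_uniform[OF \<Phi> this] obtain \<delta> where d: "\<delta> > 0"
    "\<forall>z\<in>decreasing_points 1 p t T. \<forall>z'\<in>decreasing_points 1 p t T. (\<forall>j. \<bar>z j - z' j\<bar> < \<delta>) \<longrightarrow> \<bar>\<Phi> z - \<Phi> z'\<bar> \<le> \<epsilon>" .
  show "\<exists>\<delta>>0. \<forall>x\<in>ordered_simplex n a y. \<forall>x'\<in>ordered_simplex n a y.
        (\<forall>l\<le>n. \<bar>x l - x' l\<bar> < \<delta>) \<longrightarrow> \<bar>\<Phi> (restrict x {1..p}) - \<Phi> (restrict x' {1..p})\<bar> \<le> \<epsilon>"
  proof (intro exI conjI ballI impI)
    show "\<delta> > 0" by (rule d(1))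
    fix x x' assume x: "x \<in> ordered_simplex n a y" "x' \<in> ordered_simplex n a y" and cl: "\<forall>l\<le>n. \<bar>x l - x' l\<bar> < \<delta>"
    have "\<bar>restrict x {1..p} j - restrict x' {1..p} j\<bar> < \<delta>" for j
    proof (cases "j \<le> n")
      case True
      then show ?thesis using cl d(1) by (auto simp: restrict_def)
    next
      case False
      \<comment> \<open>Both points carry the same frozen parameters \<open>y\<close> beyond
        \<open>n\<close>, so closeness in the first \<open>n\<close> coordinates gives closeness in
        all.\<close>
      then have "x j = x' j" using x by (simp add: ordered_simplex_def)
      then show ?thesis using d(1) by (simp add: restrict_def)
    qed
    then show "\<bar>\<Phi> (restrict x {1..p}) - \<Phi> (restrict x' {1..p})\<bar> \<le> \<epsilon>" using d(2) sub x by blast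
  qed
qed

text \<open>The integration variables lie above \<open>a\<close> and the parameters below it, so
  putting them together preserves the order.\<close>

lemma ordered_simplex_restrict:
  assumes x: "x \<in> ordered_simplex n a y" and y: "y \<in> decreasing_points (Suc n) p t a" and t: "t \<le> a"
  shows "restrict x {1..p} \<in> decreasing_points 1 p t T"
proof -
  have aT: "a \<le> T" using simplex_bounds[OF x order_refl] by simp
  have hi: "a \<le> x j \<and> x j \<le> T" if "j \<le> n" for j using simplex_bounds[OF x that] by simp
  have lo: "x j = y j \<and> t \<le> y j \<and> y j \<le> a" if "n < j" "j \<le> p" for j
    using that x y by (auto simp: ordered_simplex_def decreasing_points_iff)
  have 1: "t \<le> x j \<and> x j \<le> T" if "j \<le> p" for j
    using hi[of j] lo[of j] that t aT by (cases "j \<le> n") auto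
  have 2: "x l \<le> x j" if "j \<le> l" "l \<le> p" for j l
  proof (cases "l \<le> n")
    case True
    then show ?thesis using simplex_decreasing[OF x] that by simp
  next
    case False
    show ?thesis
    proof (cases "j \<le> n")
      case True
      then show ?thesis using hi[of j] lo[of l] False that by auto
    next
      case False
      then show ?thesis using y lo[of j] lo[of l] that by (auto simp: decreasing_points_iff)
    qed
  qed
  show ?thesis unfolding decreasing_points_iff using 1 2 by auto
qed

lemma decreasing_points_ordered_simplex:
  assumes "x \<in> decreasing_points 1 q t T" "t \<le> T"
  shows "x(0 := T) \<in> ordered_simplex q t (\<lambda>_. undefined)"
  using assms by (cases q) (auto simp: decreasing_points_iff ordered_simplex_def)

lemma decreasing_points_start:
  assumes "s \<le> T"
  shows "y(0 := T) \<in> ordered_simplex 0 s y"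
  using assms by (auto simp: ordered_simplex_def)

lemma decreasing_points_upd_last:
  assumes "x \<in> decreasing_points 1 q t T" "t \<le> u" "u \<le> (x(0 := T)) q"
  shows "x(Suc q := u) \<in> decreasing_points 1 (Suc q) t T"
proof -
  have "u \<le> x j" if "1 \<le> j" "j \<le> q" for j
  proof -
    have "x q \<le> x j" using assms(1) that by (auto simp: decreasing_points_iff)
    then show ?thesis using assms(3) that by auto
  qed
  moreover have "u \<le> T"
    using assms by (cases "q = 0") (auto simp: decreasing_points_iff intro: order_trans)
  ultimately show ?thesis using assms(1,2) unfolding decreasing_points_iff
    by (auto simp: le_Suc_eq)
qed

lemma decreasing_points_upd_first:
  assumes "y \<in> decreasing_points (Suc r) p t s" "t \<le> s" "s \<le> c" "c \<le> s'" "r \<le> p"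
  shows "y(r := c) \<in> decreasing_points r p t s'"
  unfolding decreasing_points_iff
proof (intro conjI ballI allI impI)
  have y: "t \<le> y j \<and> y j \<le> s" if "Suc r \<le> j" "j \<le> p" for j
    using assms(1) that by (auto simp: decreasing_points_iff)
  fix j
  show "t \<le> (y(r := c)) j" "(y(r := c)) j \<le> s'" if "j \<in> {r..p}"
    using y[of j] that assms by (cases "j = r"; force)+
  show "(y(r := c)) j = undefined" if "j \<notin> {r..p}"
    using that assms(1,5) by (auto simp: decreasing_points_iff)
  fix l assume jl: "j \<in> {r..p}" "l \<in> {r..p}" "j \<le> l"
  show "(y(r := c)) l \<le> (y(r := c)) j"
  proof (cases "j = r")
    case True
    then show ?thesis using y[of l] jl assms by (cases "l = r") auto
  next
    case False
    then show ?thesis using assms(1) jl by (auto simp: decreasing_points_iff)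
  qed
qed

text \<open>The Heine-Cantor argument by sequences: two sequences of times with vanishing distance
  have a common limit along a subsequence, and mean-square continuity at that limit contradicts a
  gap between the values.\<close>

lemma class_S2_ms_continuous:
  assumes t: "0 \<le> t" and \<xi>: "\<xi> \<in> class_S2 M F f m t T"
  shows "ms_continuous t T \<xi>"
proof -
  have ad: "adapted s (\<xi> s)" if "s \<in> {t..T}" for s
    using \<xi> that by (simp add: class_S2_def class_M2_def adapted_def)
  have lim: "(\<lambda>n. nrm (\<lambda>\<omega>. \<xi> (X n) \<omega> - \<xi> l \<omega>)) \<longlonglongrightarrow> 0"
    if X: "\<And>n. X n \<in> {t..T}" "X \<longlonglongrightarrow> l" and l: "l \<in> {t..T}" for X :: "nat \<Rightarrow> real" and l
  proof -
    have "((\<lambda>s. \<integral>\<omega>. (\<xi> s \<omega> - \<xi> l \<omega>)\<^sup>2 \<partial>M) \<longlongrightarrow> (\<integral>\<omega>. (\<xi> l \<omega> - \<xi> l \<omega>)\<^sup>2 \<partial>M)) (at l within {t..T})"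
      using \<xi> l by (simp add: class_S2_def)
    then have "continuous (at l within {t..T}) (\<lambda>s. \<integral>\<omega>. (\<xi> s \<omega> - \<xi> l \<omega>)\<^sup>2 \<partial>M)"
      by (simp add: continuous_within)
    then have "((\<lambda>s. \<integral>\<omega>. (\<xi> s \<omega> - \<xi> l \<omega>)\<^sup>2 \<partial>M) \<circ> X) \<longlonglongrightarrow> (\<integral>\<omega>. (\<xi> l \<omega> - \<xi> l \<omega>)\<^sup>2 \<partial>M)"
      using X unfolding continuous_within_sequentially by blast
    from tendsto_real_sqrt[OF this] show ?thesis by (simp add: l2norm_def o_def)
  qed
  have "\<exists>\<delta>>0. \<forall>s\<in>{t..T}. \<forall>u\<in>{t..T}. \<bar>s - u\<bar> < \<delta> \<longrightarrow> nrm (\<lambda>\<omega>. \<xi> s \<omega> - \<xi> u \<omega>) \<le> \<epsilon>" if e: "\<epsilon> > 0" for \<epsilon>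
  proof (rule ccontr)
    assume "\<not> ?thesis"
    then have neg: "\<forall>\<delta>>0. \<exists>s\<in>{t..T}. \<exists>u\<in>{t..T}. \<bar>s - u\<bar> < \<delta> \<and> \<not> nrm (\<lambda>\<omega>. \<xi> s \<omega> - \<xi> u \<omega>) \<le> \<epsilon>"
      by blast
    have "\<exists>s u. s \<in> {t..T} \<and> u \<in> {t..T} \<and> \<bar>s - u\<bar> < inverse (real (Suc n)) \<and> nrm (\<lambda>\<omega>. \<xi> s \<omega> - \<xi> u \<omega>) > \<epsilon>" for n
    proof -
      have "inverse (real (Suc n)) > 0" by simp
      with neg obtain s u where "s \<in> {t..T}" "u \<in> {t..T}" "\<bar>s - u\<bar> < inverse (real (Suc n))"
        "\<not> nrm (\<lambda>\<omega>. \<xi> s \<omega> - \<xi> u \<omega>) \<le> \<epsilon>" by blast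
      then show ?thesis by (intro exI[of _ s] exI[of _ u]) auto
    qed
    then obtain X Y where XY: "\<And>n. X n \<in> {t..T}" "\<And>n. Y n \<in> {t..T}"
      "\<And>n. \<bar>X n - Y n\<bar> < inverse (real (Suc n))" "\<And>n. nrm (\<lambda>\<omega>. \<xi> (X n) \<omega> - \<xi> (Y n) \<omega>) > \<epsilon>"
      by metis
    obtain l r where l: "l \<in> {t..T}" "strict_mono (r :: nat \<Rightarrow> nat)" "(X \<circ> r) \<longlonglongrightarrow> l"
      using seq_compactE[OF compact_imp_seq_compact[OF compact_Icc[of t T]], of X] XY(1) by blast
    have "(\<lambda>n. X n - Y n) \<longlonglongrightarrow> 0"
    proof (rule Lim_null_comparison)
      show "\<forall>\<^sub>F n in sequentially. norm (X n - Y n) \<le> inverse (real (Suc n))"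
        using XY(3) by (auto intro!: always_eventually less_imp_le)
    qed (rule LIMSEQ_inverse_real_of_nat)
    then have "((\<lambda>n. X n - Y n) \<circ> r) \<longlonglongrightarrow> 0" by (rule LIMSEQ_subseq_LIMSEQ[OF _ l(2)])
    from tendsto_diff[OF l(3) this] have Yl: "(Y \<circ> r) \<longlonglongrightarrow> l" by (simp add: o_def)
    have "(\<lambda>n. nrm (\<lambda>\<omega>. \<xi> ((X \<circ> r) n) \<omega> - \<xi> l \<omega>) + nrm (\<lambda>\<omega>. \<xi> ((Y \<circ> r) n) \<omega> - \<xi> l \<omega>)) \<longlonglongrightarrow> 0 + 0"
      using XY(1,2) by (intro tendsto_add lim l(1) l(3) Yl) simp_all
    then have "\<forall>\<^sub>F n in sequentially. nrm (\<lambda>\<omega>. \<xi> ((X \<circ> r) n) \<omega> - \<xi> l \<omega>) + nrm (\<lambda>\<omega>. \<xi> ((Y \<circ> r) n) \<omega> - \<xi> l \<omega>) < \<epsilon>"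
      using order_tendstoD(2)[of _ "0 + 0" _ \<epsilon>] e by simp
    then obtain n where n: "nrm (\<lambda>\<omega>. \<xi> (X (r n)) \<omega> - \<xi> l \<omega>) + nrm (\<lambda>\<omega>. \<xi> (Y (r n)) \<omega> - \<xi> l \<omega>) < \<epsilon>"
      by (auto simp: eventually_sequentially)
    have "nrm (\<lambda>\<omega>. \<xi> (X (r n)) \<omega> - \<xi> (Y (r n)) \<omega>) \<le> nrm (\<lambda>\<omega>. \<xi> (X (r n)) \<omega> - \<xi> l \<omega>) + nrm (\<lambda>\<omega>. \<xi> l \<omega> - \<xi> (Y (r n)) \<omega>)"
      by (intro l2norm_triangle_diff adapted_sq_int[OF ad]) (use XY l in auto)
    then show False using n XY(4)[of "r n"] l2norm_minus_commute[of M "\<xi> l" "\<xi> (Y (r n))"] by linarith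
  qed
  then show ?thesis unfolding ms_continuous_def using ad by blast
qed


section \<open>Both iterated integrals\<close>

context
  fixes k :: nat and \<iota> :: "nat \<Rightarrow> nat" and t :: real and \<xi> :: "real \<Rightarrow> 'a \<Rightarrow> real" and \<Phi> :: "(nat \<Rightarrow> real) \<Rightarrow> real"
  assumes t: "0 \<le> t" "t < T" and k: "k \<ge> 2" and \<iota>: "\<forall>j\<in>{1..k}. \<iota> j \<le> m"
    and \<xi>: "ms_continuous t T \<xi>" and \<Phi>: "continuous_on (decreasing_points 1 (k-1) t T) \<Phi>"
begin

text \<open>Continuity of \<open>\<Phi>\<close> is assumed on extensional tuples; restriction
  removes the auxiliary entry 0 and the variable with index \<open>k\<close>.\<close>

definition \<psi> :: "(nat \<Rightarrow> real) \<Rightarrow> real" where "\<psi> x = \<Phi> (restrict x {1..k-1})"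

definition integrand :: "(nat \<Rightarrow> real) \<Rightarrow> 'a \<Rightarrow> real" where "integrand x \<omega> = \<psi> x * \<xi> (x k) \<omega>"

text \<open>The candidate for \<open>I (Suc q)\<close>: the index \<open>q\<close> counts the
  variables that are still free. The entry 0 is set to \<open>T\<close> to serve as upper limit for
  the first variable.\<close>

definition ito_iter :: "nat \<Rightarrow> (nat \<Rightarrow> real) \<Rightarrow> 'a \<Rightarrow> real" where
  "ito_iter q x = iter \<iota> t (k - q) q integrand (x(0 := T))"

text \<open>The candidate for \<open>A r s y\<close> is the ordinary iterated Ito integral over the
  \<open>r\<close> variables above \<open>s\<close>, in the usual order; that it also arises as the
  reversed limit is the content of the exchange.\<close>

definition rev_iter :: "nat \<Rightarrow> real \<Rightarrow> (nat \<Rightarrow> real) \<Rightarrow> 'a \<Rightarrow> real" where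
  "rev_iter r s y = iter \<iota> s r 0 (\<lambda>x \<omega>. \<psi> x) (y(0 := T))"

lemma unif_\<psi>:
  assumes "y \<in> decreasing_points (Suc n) (k-1) t a" "t \<le> a"
  shows "unif_bounded \<psi> n a y"
  unfolding \<psi>_def[abs_def] by (rule unif_bounded_restrict[OF \<Phi> ordered_simplex_restrict[OF _ assms]])

text \<open>The empty tuple, which occurs as parameter whenever no free variable is left.\<close>

lemma undefined_decreasing_points: "q < p \<Longrightarrow> (\<lambda>_. undefined) \<in> decreasing_points p q a b"
  by (auto simp: decreasing_points_iff)

lemma admissible_integrand: "admissible k t (\<lambda>_. undefined) integrand"
  unfolding integrand_def[abs_def] using k
  by (intro admissible_times_process unif_\<psi> undefined_decreasing_points \<xi>) auto

section \<open>The iterated Ito integral: existence and uniqueness\<close>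

lemma ito_iter_integral:
  assumes q: "q < k" and x: "x \<in> decreasing_points 1 q t T"
  shows "ms_continuous t ((x(0 := T)) q) (\<lambda>u. ito_iter (Suc q) (x(Suc q := u)))" (is ?c)
    and "has_int (\<iota> (Suc q)) t ((x(0 := T)) q) (\<lambda>u. ito_iter (Suc q) (x(Suc q := u))) (ito_iter q x)" (is ?h)
    and "t \<le> (x(0 := T)) q" "(x(0 := T)) q \<le> T"
proof -
  have x0: "x(0 := T) \<in> ordered_simplex q t (\<lambda>_. undefined)"
    by (rule decreasing_points_ordered_simplex[OF x]) (use t in simp)
  show "t \<le> (x(0 := T)) q" "(x(0 := T)) q \<le> T" using simplex_bounds[OF x0 order_refl] by auto
  have d: "k - q = Suc (k - Suc q)" using q by simp
  have upd: "ito_iter (Suc q) (x(Suc q := u)) = iter \<iota> t (k - Suc q) (Suc q) integrand ((x(0 := T))(Suc q := u))" for u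
    unfolding ito_iter_def by (subst fun_upd_twist) simp_all
  have "admissible (Suc q) t (\<lambda>_. undefined) (iter \<iota> t (k - Suc q) (Suc q) integrand)"
    by (rule admissible_iter) (use t q \<iota> admissible_integrand in auto)
  from admissible_section[OF this x0] show ?c unfolding upd .
  have "has_int (\<iota> (Suc q)) t ((x(0 := T)) q) (\<lambda>u. iter \<iota> t (k - Suc q) (Suc q) integrand ((x(0 := T))(Suc q := u)))
      (iter \<iota> t (Suc (k - Suc q)) q integrand (x(0 := T)))"
    by (rule iter_has_int[OF t(1) _ _ x0]) (use q \<iota> admissible_integrand in auto)
  then show ?h unfolding upd unfolding ito_iter_def d .
qed

lemma upper_limit: "(x(0 := T)) q = (if Suc q = 1 then T else x (Suc q - 1))"
  by simp

lemma ito_iter_last: "ito_iter k x = (\<lambda>\<omega>. \<Phi> (restrict x {1..k-1}) * \<xi> (x k) \<omega>)"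
proof -
  have "restrict (x(0 := T)) {1..k-1} = restrict x {1..k-1}" by (auto simp: restrict_def)
  then show ?thesis using k by (simp add: ito_iter_def integrand_def[abs_def] \<psi>_def)
qed

lemma iterated_ito_exists: "has_iterated_ito_integral M F f k \<iota> t T \<xi> \<Phi> (ito_iter 0 (\<lambda>_. undefined))"
  unfolding has_iterated_ito_integral_def
\<comment> \<open>The shift matches the two indexings: the \<open>j\<close>-th integral of the
  definition has \<open>j - 1\<close> free variables.\<close>
proof (intro exI[of _ "\<lambda>j. ito_iter (j - 1)"] conjI ballI)
  fix x show "ito_iter (Suc k - 1) x = (\<lambda>\<omega>. \<Phi> (restrict x {1..k-1}) * \<xi> (x k) \<omega>)" by (simp add: ito_iter_last)
next
  fix j x assume j: "j \<in> {1..k}" and x: "x \<in> decreasing_points 1 (j - 1) t T"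
  define q where "q = j - 1"
  have q: "j = Suc q" "q < k" using j by (auto simp: q_def)
  have x': "x \<in> decreasing_points 1 q t T" using x q by simp
  have "has_stochastic_integral M F f (\<iota> (Suc q)) t ((x(0 := T)) q) (\<lambda>u. ito_iter (Suc q) (x(Suc q := u))) (ito_iter q x)"
    using \<iota> q t(1) ito_iter_integral[OF q(2) x'] by (intro has_int_imp_has_stochastic_integral) auto
  then show "has_stochastic_integral M F f (\<iota> j) t (if j = 1 then T else x (j - 1))
      (\<lambda>s. ito_iter (Suc j - 1) (x(j := s))) (ito_iter (j - 1) x)"
    unfolding q(1) upper_limit by simp
qed simp

text \<open>Starting from the integrand, where both families coincide, almost sure equality is
  carried outwards one integration at a time. The null sets may vary with the point of the
  simplex.\<close>

lemma iterated_ito_unique: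
  assumes "has_iterated_ito_integral M F f k \<iota> t T \<xi> \<Phi> J"
  shows "AE \<omega> in M. J \<omega> = ito_iter 0 (\<lambda>_. undefined) \<omega>"
proof -
  obtain I' where last: "\<And>x. x \<in> decreasing_points 1 k t T \<Longrightarrow> I' (Suc k) x = (\<lambda>\<omega>. \<Phi> (restrict x {1..k-1}) * \<xi> (x k) \<omega>)"
    and step: "\<And>j x. j \<in> {1..k} \<Longrightarrow> x \<in> decreasing_points 1 (j-1) t T \<Longrightarrow>
      has_stochastic_integral M F f (\<iota> j) t (if j = 1 then T else x (j-1)) (\<lambda>s. I' (Suc j) (x(j := s))) (I' j x)"
    and J: "J = I' 1 (\<lambda>_. undefined)"
    using assms unfolding has_iterated_ito_integral_def by blast
  have "\<forall>x\<in>decreasing_points 1 (k - d) t T. AE \<omega> in M. ito_iter (k - d) x \<omega> = I' (Suc (k - d)) x \<omega>" if "d \<le> k" for d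
    using that
  proof (induction d)
    case 0
    then show ?case by (simp add: last ito_iter_last)
  next
    case (Suc d)
    define q where "q = k - Suc d"
    have q: "q < k" "k - d = Suc q" using Suc.prems by (auto simp: q_def)
    have IH: "\<forall>x\<in>decreasing_points 1 (Suc q) t T. AE \<omega> in M. ito_iter (Suc q) x \<omega> = I' (Suc (Suc q)) x \<omega>"
      using Suc by (simp add: q(2))
    have "AE \<omega> in M. ito_iter q x \<omega> = I' (Suc q) x \<omega>" if x: "x \<in> decreasing_points 1 q t T" for x
    proof (rule has_int_eq_stochastic_integral[OF _ t(1) ito_iter_integral(3,4)[OF q(1) x] ito_iter_integral(1,2)[OF q(1) x]])
      show "\<iota> (Suc q) \<le> m" using \<iota> q by simp
      show "has_stochastic_integral M F f (\<iota> (Suc q)) t ((x(0 := T)) q) (\<lambda>s. I' (Suc (Suc q)) (x(Suc q := s))) (I' (Suc q) x)"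
        unfolding upper_limit by (rule step) (use q x in auto)
      fix s assume "t \<le> s" "s \<le> (x(0 := T)) q"
      then have "x(Suc q := s) \<in> decreasing_points 1 (Suc q) t T" by (rule decreasing_points_upd_last[OF x])
      then show "AE \<omega> in M. ito_iter (Suc q) (x(Suc q := s)) \<omega> = I' (Suc (Suc q)) (x(Suc q := s)) \<omega>" using IH by blast
    qed
    then show ?case by (simp add: q_def)
  qed
  from this[of k] undefined_decreasing_points[of 0 1 t T]
  have "AE \<omega> in M. ito_iter 0 (\<lambda>_. undefined) \<omega> = J \<omega>" by (simp add: J)
  then show ?thesis by eventually_elim simp
qed

section \<open>The reversed integral: existence and uniqueness\<close>

lemma rev_iter_first:
  assumes s: "s \<in> {t..T}" and y: "y \<in> decreasing_points 2 (k-1) t s"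
  shows "ms_continuous s T (\<lambda>u \<omega>. \<Phi> (y(1 := u)))" and "has_int (\<iota> 1) s T (\<lambda>u \<omega>. \<Phi> (y(1 := u))) (rev_iter 1 s y)"
proof -
  have y0: "y(0 := T) \<in> ordered_simplex 0 s y" by (rule decreasing_points_start) (use s in simp)
  have y2: "y \<in> decreasing_points (Suc 1) (k-1) t s" using y by (simp add: numeral_2_eq_2)
  have ad: "admissible (Suc 0) s y (\<lambda>x \<omega>. \<psi> x)"
    using unif_\<psi>[OF y2] s t by (intro admissible_deterministic) auto
  \<comment> \<open>\<open>y\<close> is undefined outside \<open>{2..k-1}\<close>, so after
    restriction only the new entry 1 is added to it.\<close>
  have eq: "\<psi> ((y(0 := T))(Suc 0 := u)) = \<Phi> (y(1 := u))" for u
  proof -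
    have "restrict ((y(0 := T))(Suc 0 := u)) {1..k-1} = y(1 := u)"
      using y k by (auto simp: restrict_def fun_eq_iff decreasing_points_iff)
    then show ?thesis by (simp add: \<psi>_def)
  qed
  show "ms_continuous s T (\<lambda>u \<omega>. \<Phi> (y(1 := u)))"
    using admissible_section[OF ad y0] by (simp only: eq) simp
  have i: "\<iota> (Suc 0) \<le> m" using \<iota> k by auto
  show "has_int (\<iota> 1) s T (\<lambda>u \<omega>. \<Phi> (y(1 := u))) (rev_iter 1 s y)"
    using admissible_has_int[OF i _ ad y0] s t unfolding rev_iter_def One_nat_def iter.simps eq by simp
qed

text \<open>The exchange with the constant process 1 in place of \<xi>: the increment alone is the
  factor moved inside the inner integrals.\<close>

lemma rev_iter_step:
  assumes r: "r \<in> {2..k-1}" and s: "s \<in> {t..T}" and y: "y \<in> decreasing_points (Suc r) (k-1) t s"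
  shows "has_partition_limit M s T
     (\<lambda>N \<tau> \<omega>. \<Sum>l<N. (integrator f (\<iota> r) (\<tau> (Suc l)) \<omega> - integrator f (\<iota> r) (\<tau> l) \<omega>) * rev_iter (r-1) (\<tau> (Suc l)) (y(r := \<tau> l)) \<omega>)
     (rev_iter r s y)"
proof -
  define n where "n = r - 1"
  have n: "r = Suc n" "n \<ge> 1" using r by (auto simp: n_def)
  have one: "ms_continuous s T (\<lambda>_ _. 1)"
    unfolding ms_continuous_def using square_integrable_const[of 1] by (auto simp: adapted_def intro!: exI[of _ 1])
  have upd: "(y(0 := T))(Suc n := c) = (y(r := c))(0 := T)" for c
    unfolding n(1) by (rule fun_upd_twist) simp
  have "\<forall>j\<in>{1..Suc n}. \<iota> j \<le> m" using \<iota> r n by auto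
  from reversed_sum_limit[OF this _ _ unif_\<psi> one decreasing_points_start, of y]
  have "has_partition_limit M s T
     (\<lambda>N \<tau> \<omega>. \<Sum>l<N. 1 * (w (\<iota> (Suc n)) (\<tau> (Suc l)) \<omega> - w (\<iota> (Suc n)) (\<tau> l) \<omega>) *
        iter \<iota> (\<tau> (Suc l)) n 0 (\<lambda>x \<omega>. \<psi> x) ((y(0 := T))(Suc n := \<tau> l)) \<omega>)
     (iter \<iota> s (Suc n) 0 (\<lambda>x \<omega>. \<psi> x * 1) (y(0 := T)))"
    using s t y n by simp
  then show ?thesis unfolding upd rev_iter_def n(1) mult_1 mult_1_right diff_Suc_1 .
qed

text \<open>The exchange with \<xi> as random factor. Its limit is the full iterated Ito integral,
  and this is where the two constructions meet.\<close>

lemma rev_iter_last: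
  "has_partition_limit M t T
     (\<lambda>N \<tau> \<omega>. \<Sum>l<N. \<xi> (\<tau> l) \<omega> * (integrator f (\<iota> k) (\<tau> (Suc l)) \<omega> - integrator f (\<iota> k) (\<tau> l) \<omega>) *
        rev_iter (k-1) (\<tau> (Suc l)) (\<lambda>_. undefined) \<omega>)
     (ito_iter 0 (\<lambda>_. undefined))"
proof -
  define n where "n = k - 1"
  have n: "k = Suc n" using k by (simp add: n_def)
  define x0 :: "nat \<Rightarrow> real" where "x0 = (\<lambda>_. undefined)(0 := T)"
  have x0: "x0 \<in> ordered_simplex 0 t (\<lambda>_. undefined)"
    unfolding x0_def by (rule decreasing_points_start) (use t in simp)
  have "unif_bounded \<psi> (Suc n) t (\<lambda>_. undefined)"
    by (intro unif_\<psi> undefined_decreasing_points) (use n in auto)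
  from reversed_sum_limit[OF _ t(1) less_imp_le[OF t(2)] this \<xi> x0, of \<iota>]
  have lim: "has_partition_limit M t T
     (\<lambda>N \<tau> \<omega>. \<Sum>l<N. \<xi> (\<tau> l) \<omega> * (w (\<iota> (Suc n)) (\<tau> (Suc l)) \<omega> - w (\<iota> (Suc n)) (\<tau> l) \<omega>) *
        iter \<iota> (\<tau> (Suc l)) n 0 (\<lambda>x \<omega>. \<psi> x) (x0(Suc n := \<tau> l)) \<omega>)
     (iter \<iota> t (Suc n) 0 (\<lambda>x \<omega>. \<psi> x * \<xi> (x (Suc n)) \<omega>) x0)"
    using \<iota> n by simp
  \<comment> \<open>Index \<open>k\<close> lies outside \<open>{1..k-1}\<close>, hence the point
    \<open>\<tau> l\<close> enters only through \<xi> and the increment, and the inner reversed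
    integral has no parameter.\<close>
  have \<psi>_upd: "\<psi> (x(Suc n := c)) = \<psi> x" for x c
  proof -
    have "restrict (x(Suc n := c)) {1..k-1} = restrict x {1..k-1}" by (auto simp: restrict_def n)
    then show ?thesis by (simp add: \<psi>_def)
  qed
  have indep: "iter \<iota> a n 0 (\<lambda>x \<omega>. \<psi> x) (x0(Suc n := c)) = rev_iter (k-1) a (\<lambda>_. undefined)" for a c
  proof -
    have "iter \<iota> a n 0 (\<lambda>x \<omega>. \<psi> x) (x0(Suc n := c)) = iter \<iota> a n 0 (\<lambda>x \<omega>. \<psi> (x(Suc n := c))) x0"
      by (rule iter_upd_param[symmetric, where Q = "\<lambda>x \<omega>. \<psi> x"]) simp
    also have "(\<lambda>x (\<omega>::'a). \<psi> (x(Suc n := c))) = (\<lambda>x \<omega>. \<psi> x)" by (simp only: \<psi>_upd)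
    finally show ?thesis unfolding rev_iter_def x0_def n_def .
  qed
  have "ito_iter 0 (\<lambda>_. undefined) = iter \<iota> t (Suc n) 0 (\<lambda>x \<omega>. \<psi> x * \<xi> (x (Suc n)) \<omega>) x0"
    unfolding ito_iter_def x0_def integrand_def[abs_def] by (simp only: n diff_zero)
  with lim show ?thesis unfolding indep by (simp only: n)
qed

lemma reversed_exists: "has_reversed_integral M F f k \<iota> t T \<xi> \<Phi> (ito_iter 0 (\<lambda>_. undefined))"
  unfolding has_reversed_integral_def
proof (intro exI[of _ rev_iter] conjI ballI)
  fix s y assume s: "s \<in> {t..T}" and y: "y \<in> decreasing_points 2 (k-1) t s"
  show "has_stochastic_integral M F f (\<iota> 1) s T (\<lambda>u \<omega>. \<Phi> (y(1 := u))) (rev_iter 1 s y)"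
    using \<iota> k s t rev_iter_first[OF s y] by (intro has_int_imp_has_stochastic_integral) auto
qed (use rev_iter_step rev_iter_last in auto)

text \<open>Upward induction on \<open>r\<close>. Each sum uses only finitely many inner integrals,
  so versions agreeing almost surely for each parameter give almost surely equal sums for every
  partition, and their limits agree.\<close>

lemma reversed_unique:
  assumes "has_reversed_integral M F f k \<iota> t T \<xi> \<Phi> J"
  shows "AE \<omega> in M. J \<omega> = ito_iter 0 (\<lambda>_. undefined) \<omega>"
proof -
  obtain A' where first: "\<And>s y. s \<in> {t..T} \<Longrightarrow> y \<in> decreasing_points 2 (k-1) t s \<Longrightarrow>
        has_stochastic_integral M F f (\<iota> 1) s T (\<lambda>u \<omega>. \<Phi> (y(1 := u))) (A' 1 s y)"
    and A'_step: "\<And>r s y. r \<in> {2..k-1} \<Longrightarrow> s \<in> {t..T} \<Longrightarrow> y \<in> decreasing_points (Suc r) (k-1) t s \<Longrightarrow>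
        has_partition_limit M s T
         (\<lambda>N \<tau> \<omega>. \<Sum>l<N. (integrator f (\<iota> r) (\<tau> (Suc l)) \<omega> - integrator f (\<iota> r) (\<tau> l) \<omega>) * A' (r-1) (\<tau> (Suc l)) (y(r := \<tau> l)) \<omega>)
         (A' r s y)"
    and last: "has_partition_limit M t T
         (\<lambda>N \<tau> \<omega>. \<Sum>l<N. \<xi> (\<tau> l) \<omega> * (integrator f (\<iota> k) (\<tau> (Suc l)) \<omega> - integrator f (\<iota> k) (\<tau> l) \<omega>) *
            A' (k-1) (\<tau> (Suc l)) (\<lambda>_. undefined) \<omega>) J"
    using assms unfolding has_reversed_integral_def by blast
  have eq: "\<forall>s\<in>{t..T}. \<forall>y\<in>decreasing_points (Suc r) (k-1) t s. AE \<omega> in M. rev_iter r s y \<omega> = A' r s y \<omega>"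
    if "1 \<le> r" "r \<le> k - 1" for r
    using that
  proof (induction r rule: dec_induct)
    case base
    show ?case
    proof (intro ballI)
      fix s y assume s: "s \<in> {t..T}" and "y \<in> decreasing_points (Suc 1) (k-1) t s"
      then have y: "y \<in> decreasing_points 2 (k-1) t s" by (simp add: numeral_2_eq_2)
      show "AE \<omega> in M. rev_iter 1 s y \<omega> = A' 1 s y \<omega>"
        by (rule has_int_eq_stochastic_integral[OF _ _ _ _ rev_iter_first[OF s y] first[OF s y]]) (use \<iota> k s t in auto)
    qed
  next
    case (step n)
    note IH = step.IH[OF Suc_leD[OF step.prems]]
    have r: "Suc n \<in> {2..k-1}" using step by auto
    show ?case
    proof (intro ballI)
      fix s y assume s: "s \<in> {t..T}" and y: "y \<in> decreasing_points (Suc (Suc n)) (k-1) t s"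
      show "AE \<omega> in M. rev_iter (Suc n) s y \<omega> = A' (Suc n) s y \<omega>"
      proof (rule has_partition_limit_unique[OF _ rev_iter_step[OF r s y] A'_step[OF r s y]])
        show "s \<le> T" using s by simp
        fix N \<tau> assume p: "is_partition s T N \<tau>"
        have "AE \<omega> in M. \<forall>l\<in>{..<N}. rev_iter n (\<tau> (Suc l)) (y(Suc n := \<tau> l)) \<omega> = A' n (\<tau> (Suc l)) (y(Suc n := \<tau> l)) \<omega>"
        proof (rule AE_finite_allI)
          fix l assume "l \<in> {..<N}"
          then have l: "l < N" by simp
          have b: "s \<le> \<tau> l" "\<tau> l \<le> \<tau> (Suc l)" "\<tau> (Suc l) \<le> T"
            using is_partition_bounds[OF p, of l] is_partition_bounds[OF p, of "Suc l"] is_partition_le[OF p, of l "Suc l"] l by auto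
          then have "\<tau> (Suc l) \<in> {t..T}" using s by simp
          \<comment> \<open>The new parameter \<open>\<tau> l\<close> lies above \<open>s\<close>,
            which bounds the old parameters, and below \<open>\<tau> (Suc l)\<close>, the lower
            limit of the inner integral; this is why the inner integral starts at the right
            endpoint.\<close>
          moreover have "y(Suc n := \<tau> l) \<in> decreasing_points (Suc n) (k-1) t (\<tau> (Suc l))"
            by (rule decreasing_points_upd_first[OF y]) (use b s r in auto)
          ultimately show "AE \<omega> in M. rev_iter n (\<tau> (Suc l)) (y(Suc n := \<tau> l)) \<omega> = A' n (\<tau> (Suc l)) (y(Suc n := \<tau> l)) \<omega>"
            using IH by blast
        qed simp
        then show "AE \<omega> in M. (\<Sum>l<N. (integrator f (\<iota> (Suc n)) (\<tau> (Suc l)) \<omega> - integrator f (\<iota> (Suc n)) (\<tau> l) \<omega>) * rev_iter (Suc n - 1) (\<tau> (Suc l)) (y(Suc n := \<tau> l)) \<omega>)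
            = (\<Sum>l<N. (integrator f (\<iota> (Suc n)) (\<tau> (Suc l)) \<omega> - integrator f (\<iota> (Suc n)) (\<tau> l) \<omega>) * A' (Suc n - 1) (\<tau> (Suc l)) (y(Suc n := \<tau> l)) \<omega>)"
          by eventually_elim (auto intro!: sum.cong)
      qed
    qed
  qed
  have "AE \<omega> in M. ito_iter 0 (\<lambda>_. undefined) \<omega> = J \<omega>"
  proof (rule has_partition_limit_unique[OF less_imp_le[OF t(2)] rev_iter_last last])
    fix N \<tau> assume p: "is_partition t T N \<tau>"
    have "AE \<omega> in M. \<forall>l\<in>{..<N}. rev_iter (k-1) (\<tau> (Suc l)) (\<lambda>_. undefined) \<omega> = A' (k-1) (\<tau> (Suc l)) (\<lambda>_. undefined) \<omega>"
    proof (rule AE_finite_allI)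
      fix l assume "l \<in> {..<N}"
      then have "\<tau> (Suc l) \<in> {t..T}" using is_partition_bounds[OF p, of "Suc l"] by simp
      moreover have "(\<lambda>_. undefined) \<in> decreasing_points (Suc (k-1)) (k-1) t (\<tau> (Suc l))"
        by (rule undefined_decreasing_points) simp
      ultimately show "AE \<omega> in M. rev_iter (k-1) (\<tau> (Suc l)) (\<lambda>_. undefined) \<omega> = A' (k-1) (\<tau> (Suc l)) (\<lambda>_. undefined) \<omega>"
        using eq[of "k-1"] k by auto
    qed simp
    then show "AE \<omega> in M. (\<Sum>l<N. \<xi> (\<tau> l) \<omega> * (integrator f (\<iota> k) (\<tau> (Suc l)) \<omega> - integrator f (\<iota> k) (\<tau> l) \<omega>) * rev_iter (k-1) (\<tau> (Suc l)) (\<lambda>_. undefined) \<omega>)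
        = (\<Sum>l<N. \<xi> (\<tau> l) \<omega> * (integrator f (\<iota> k) (\<tau> (Suc l)) \<omega> - integrator f (\<iota> k) (\<tau> l) \<omega>) * A' (k-1) (\<tau> (Suc l)) (\<lambda>_. undefined) \<omega>)"
      by eventually_elim (auto intro!: sum.cong)
  qed
  then show ?thesis by eventually_elim simp
qed

end

end

theorem theorem2:
  fixes M :: "'a measure"
    and F :: "real \<Rightarrow> 'a measure"
    and f :: "nat \<Rightarrow> real \<Rightarrow> 'a \<Rightarrow> real"
    and m k :: nat
    and i :: "nat \<Rightarrow> nat"
    and t T :: real
    and \<xi> :: "real \<Rightarrow> 'a \<Rightarrow> real"
    and \<Phi> :: "(nat \<Rightarrow> real) \<Rightarrow> real"
  assumes "wiener_setting M F f m T"
    and "0 \<le> t" and "t < T"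
    and "k \<ge> 2"
    and "\<forall>j\<in>{1..k}. i j \<in> {0..m}"
    and "\<xi> \<in> class_S2 M F f m t T"
    and "continuous_on (decreasing_points 1 (k-1) t T) \<Phi>"
  shows "(\<exists>J. has_iterated_ito_integral M F f k i t T \<xi> \<Phi> J) \<and>
         (\<exists>J'. has_reversed_integral M F f k i t T \<xi> \<Phi> J') \<and>
         (\<forall>J J'. has_iterated_ito_integral M F f k i t T \<xi> \<Phi> J \<longrightarrow>
                 has_reversed_integral M F f k i t T \<xi> \<Phi> J' \<longrightarrow>
                 (AE \<omega> in M. J \<omega> = J' \<omega>))"
proof -
  interpret wiener_setting M F f m T by (rule assms(1))
  have i: "\<forall>j\<in>{1..k}. i j \<le> m" using assms(5) by simp
  have \<xi>: "ms_continuous t T \<xi>" by (rule class_S2_ms_continuous[OF assms(2,6)])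
  note prems = assms(2-4) i \<xi> assms(7)
  show ?thesis
  proof (intro conjI allI impI)
    show "\<exists>J. has_iterated_ito_integral M F f k i t T \<xi> \<Phi> J" using iterated_ito_exists[OF prems] by blast
    show "\<exists>J'. has_reversed_integral M F f k i t T \<xi> \<Phi> J'" using reversed_exists[OF prems] by blast
    fix J J' assume J: "has_iterated_ito_integral M F f k i t T \<xi> \<Phi> J" and J': "has_reversed_integral M F f k i t T \<xi> \<Phi> J'"
    show "AE \<omega> in M. J \<omega> = J' \<omega>"
      using iterated_ito_unique[OF prems J] reversed_unique[OF prems J'] by eventually_elim simp
  qed
qed

end
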